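(* Consider the generalized linear model with natural link and the $\ell_1$-type penalized maximum likelihood estimator $\hat{\boldsymbol\beta}_\lambda$ described in the context, with tuning parameter $\lambda_n=n^{(\gamma_0-2)/2}\lambda$, where $\lambda>0$ is fixed and $\gamma_0\in(1,2)$. Assume conditions (C1), (C2) on the regressors and (P1)–(P5) on the penalty, as listed in the context. Let $z^{\rm limit}$ be the limit in distribution, as $n\to\infty$, of $$\sum_{i=1}^n\{g_i(\hat{\boldsymbol\beta}_\lambda)-g_i(\boldsymbol\beta^* )\}-\sum_{i=1}^n\{\tilde g_i(\hat{\boldsymbol\beta}_\lambda)-\tilde g_i(\boldsymbol\beta^* )\},$$ where $\tilde g_i$ is the log-likelihood based on an independent copy of the data. Then the size $|\hat{\mathcal J}^{(2)}|$ of the active set $\hat{\mathcal J}^{(2)}=\{j:\hat\beta_{\lambda,j}\ne0\}$ is a consistent estimator of the asymptotic bias $\mathrm E[z^{\rm limit}]$, i.e. $|\hat{\mathcal J}^{(2)}|$ converges in probability to $\mathrm E[z^{\rm limit}]$ as $n\to\infty$.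
   Context: Model. Let $f(\boldsymbol y;\boldsymbol\theta)=\exp\{\boldsymbol y^{\rm T}\boldsymbol\theta-a(\boldsymbol\theta)+b(\boldsymbol y)\}$ be a natural exponential family of densities on $\mathbb R^r$ with respect to a $\sigma$-finite measure, where $\boldsymbol\theta\in\Theta\subset\mathbb R^r$ and $\Theta$ is the natural parameter space (those $\boldsymbol\theta$ for which the normalizing integral of $\exp\{\boldsymbol y^{\rm T}\boldsymbol\theta+b(\boldsymbol y)\}$ is positive and finite); $\Theta^\circ$ is its interior. It is assumed that $\mathrm V[\boldsymbol y]=a''(\boldsymbol\theta)$ is positive definite (primes denote gradient and Hessian). The data are $(\boldsymbol y_i,\boldsymbol X_i)$, $i=1,\dots,n$, with $\boldsymbol y_i$ independent $r$-dimensional random vectors and $\boldsymbol X_i\in\mathcal X\subset\mathbb R^{r\times p}$ known constant matrices; $\boldsymbol y_i$ has density $f(\cdot;\boldsymbol X_i\boldsymbol\beta^* )$, where $\boldsymbol\beta^*\in\mathcal B$ is the true parameter and $\mathcal B\subset\mathbb R^p$ is an open convex set; $p$ and $r$ are fixed and $n\to\infty$. The log-likelihood of $\boldsymbol y_i$ is $g_i(\boldsymbol\beta)=\boldsymbol y_i^{\rm T}\boldsymbol X_i\boldsymbol\beta-a(\boldsymbol X_i\boldsymbol\beta)+b(\boldsymbol y_i)$. Copy of the data. $(\tilde{\boldsymbol y}_1,\dots,\tilde{\boldsymbol y}_n)$ has the same distribution as $(\boldsymbol y_1,\dots,\boldsymbol y_n)$ and is independent of it; $\tilde g_i(\boldsymbol\beta)=\log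 f(\tilde{\boldsymbol y}_i;\boldsymbol X_i\boldsymbol\beta)$. Conditions on regressors. (C1) $\mathcal X$ is compact and $\boldsymbol X\boldsymbol\beta\in\Theta^\circ$ for all $\boldsymbol X\in\mathcal X$, $\boldsymbol\beta\in\mathcal B$. (C2) There exists an invariant distribution $\mu$ on $\mathcal X$; in particular, $n^{-1}\sum_{i=1}^n\boldsymbol X_i^{\rm T}a''(\boldsymbol X_i\boldsymbol\beta)\boldsymbol X_i$ converges to a positive-definite matrix $\boldsymbol J(\boldsymbol\beta)=\int_{\mathcal X}\boldsymbol X^{\rm T}a''(\boldsymbol X\boldsymbol\beta)\boldsymbol X\,\mu(\mathrm d\boldsymbol X)$. Estimator. $\hat{\boldsymbol\beta}_\lambda=\mathrm{argmin}_{\boldsymbol\beta\in\mathcal B}\{-\sum_{i=1}^n g_i(\boldsymbol\beta)+n\sum_{j=1}^p\eta_{\lambda_n}(\beta_j)\}$, where $\eta_{\lambda_n}$ is a (not necessarily convex) penalty function. Conditions on the penalty. (P1) $\eta_{\lambda_n}(\beta)$ is non-differentiable only at the origin, symmetric about $\beta=0$, and monotone non-decreasing in $|\beta|$. (P2) $\lim_{\beta\to0}\eta_{\lambda_n}(\beta)/|\beta|=\lambda_n$ (this is understood to imply $\eta_{\lambda_n}(0)=0$ and $\lim_{\beta\to0}\eta'_{\lambda_n}(\beta)/\mathrm{sgn}(\beta)=\lambda_n$). (P3) $\lim_{n\to\infty}\eta_{\lambda_n}(\beta)=0$ for any $\beta$. (P4) There exists $\tau>0$ such that $\eta'_{\lambda_n}(\beta)=0$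 for any $|\beta|\ge\tau\lambda_n$. (P5) $\lim_{n\to\infty}\eta''_{\lambda_n}(\beta)=0$ for any $\beta\ne0$.
   Formalization: (P2) is also required uniformly: for all K, ε > 0 and all large n, |η_{λ_n}(β)/|β| − λ_n| ≤ ελ_n for 0 < |β| ≤ K/√n. Without it the claim fails, e.g. for smoothed min(λ_n|β|, c/n) with normal data and β* = 0. *)

theory Defs
  imports "HOL-Probability.Probability"
begin

definition gradient :: "(real^'n \<Rightarrow> real) \<Rightarrow> real^'n \<Rightarrow> real^'n" where
  "gradient f x = (\<chi> i. frechet_derivative f (at x) (axis i 1))"

definition hessian :: "(real^'n \<Rightarrow> real) \<Rightarrow> real^'n \<Rightarrow> real^'n^'n" where
  "hessian f x = jacobian (gradient f) (at x)"

definition pos_def :: "real^'n^'n \<Rightarrow> bool" where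
  "pos_def A \<longleftrightarrow> transpose A = A \<and> (\<forall>v. v \<noteq> 0 \<longrightarrow> 0 < v \<bullet> (A *v v))"

text \<open>
  \<open>\<nu>\<close> is the dominating \<open>\<sigma>\<close>-finite measure on \<open>\<real>\<^sup>r\<close>. An \<open>r \<times> p\<close> matrix has type \<open>real^'p^'r\<close>.
\<close>

definition natural_parameter_space ::
    "(real^'r) measure \<Rightarrow> (real^'r \<Rightarrow> real) \<Rightarrow> (real^'r) set" where
  "natural_parameter_space \<nu> b =
     {\<theta>. 0 < (\<integral>\<^sup>+ y. ennreal (exp (y \<bullet> \<theta> + b y)) \<partial>\<nu>) \<and>
         (\<integral>\<^sup>+ y. ennreal (exp (y \<bullet> \<theta> + b y)) \<partial>\<nu>) < \<infinity>}"

text \<open>The function \<open>a\<close>, which is determined by the normalization of the density.\<close>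

definition log_partition ::
    "(real^'r) measure \<Rightarrow> (real^'r \<Rightarrow> real) \<Rightarrow> real^'r \<Rightarrow> real" where
  "log_partition \<nu> b \<theta> = ln (\<integral> y. exp (y \<bullet> \<theta> + b y) \<partial>\<nu>)"

definition expfam_density ::
    "(real^'r) measure \<Rightarrow> (real^'r \<Rightarrow> real) \<Rightarrow> real^'r \<Rightarrow> real^'r \<Rightarrow> real" where
  "expfam_density \<nu> b \<theta> y = exp (y \<bullet> \<theta> - log_partition \<nu> b \<theta> + b y)"

definition loglik ::
    "(real^'r) measure \<Rightarrow> (real^'r \<Rightarrow> real) \<Rightarrow> real^'r \<Rightarrow> real^'p^'r \<Rightarrow> real^'p \<Rightarrow> real" where
  "loglik \<nu> b y A \<beta> = y \<bullet> (A *v \<beta>) - log_partition \<nu> b (A *v \<beta>) + b y"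

text \<open>
  Observations are indexed from \<open>0\<close>, so that a sample of size \<open>n\<close> is \<open>y 0, \<dots>, y (n - 1)\<close>,
  an element of the product space \<open>\<Pi>\<^sub>M i\<in>{..<n}. borel\<close>.
\<close>

definition sample :: "(nat \<Rightarrow> 'w \<Rightarrow> 'a) \<Rightarrow> nat \<Rightarrow> 'w \<Rightarrow> nat \<Rightarrow> 'a" where
  "sample y n \<omega> = (\<lambda>i\<in>{..<n}. y i \<omega>)"

definition fisher_summand ::
    "(real^'r) measure \<Rightarrow> (real^'r \<Rightarrow> real) \<Rightarrow> real^'p \<Rightarrow> real^'p^'r \<Rightarrow> real^'p^'p" where
  "fisher_summand \<nu> b \<beta> A =
     transpose A ** hessian (log_partition \<nu> b) (A *v \<beta>) ** A"

definition cond_C1 ::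
    "(real^'r) measure \<Rightarrow> (real^'r \<Rightarrow> real) \<Rightarrow> (real^'p^'r) set \<Rightarrow> (real^'p) set \<Rightarrow> bool" where
  "cond_C1 \<nu> b \<X> B \<longleftrightarrow>
     compact \<X> \<and> (\<forall>A\<in>\<X>. \<forall>\<beta>\<in>B. A *v \<beta> \<in> interior (natural_parameter_space \<nu> b))"

text \<open>
  For deterministic regressors, ``\<open>\<mu>\<close> is an invariant distribution'' is taken to mean exactly that
  the averages of the Fisher information summands converge to their \<open>\<mu>\<close>-integrals.
\<close>

definition cond_C2 ::
    "(real^'r) measure \<Rightarrow> (real^'r \<Rightarrow> real) \<Rightarrow> (real^'p^'r) set \<Rightarrow> (real^'p) set
      \<Rightarrow> (nat \<Rightarrow> real^'p^'r) \<Rightarrow> bool" where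
  "cond_C2 \<nu> b \<X> B X \<longleftrightarrow>
     (\<exists>\<mu>. prob_space \<mu> \<and> sets \<mu> = sets (restrict_space borel \<X>) \<and>
       (\<forall>\<beta>\<in>B.
          (\<lambda>n. (1 / real n) *\<^sub>R (\<Sum>i<n. fisher_summand \<nu> b \<beta> (X i)))
            \<longlonglongrightarrow> (\<integral> A. fisher_summand \<nu> b \<beta> A \<partial>\<mu>) \<and>
          pos_def (\<integral> A. fisher_summand \<nu> b \<beta> A \<partial>\<mu>)))"

text \<open>
  \<open>\<eta> l\<close> is the penalty with tuning parameter \<open>l\<close>, and \<open>l n\<close> is the tuning parameter for sample
  size \<open>n \<ge> 1\<close>.
\<close>

definition cond_P1 :: "(real \<Rightarrow> real \<Rightarrow> real) \<Rightarrow> (nat \<Rightarrow> real) \<Rightarrow> bool" where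
  "cond_P1 \<eta> l \<longleftrightarrow> (\<forall>n\<ge>1.
     (\<forall>\<beta>. \<eta> (l n) differentiable (at \<beta>) \<longleftrightarrow> \<beta> \<noteq> 0) \<and>
     (\<forall>\<beta>. \<eta> (l n) (- \<beta>) = \<eta> (l n) \<beta>) \<and>
     (\<forall>\<beta> \<beta>'. \<bar>\<beta>\<bar> \<le> \<bar>\<beta>'\<bar> \<longrightarrow> \<eta> (l n) \<beta> \<le> \<eta> (l n) \<beta>'))"

text \<open>
  The first part of the next condition is the limit \<open>\<beta> \<rightarrow> 0\<close> for each fixed \<open>n\<close>. As the penalty
  changes with \<open>n\<close>, the condition is moreover read along the asymptotics: with
  \<open>\<beta> = u / sqrt n\<close>, the expansion \<open>\<eta> (l n) \<beta> = l n * \<bar>\<beta>\<bar> * (1 + o(1))\<close> holds as \<open>n \<rightarrow> \<infinity>\<close>, uniformly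
  for \<open>u\<close> in bounded sets. Without this, the linear part of the penalty at the origin could be
  confined to an interval shorter than the statistical resolution \<open>1 / sqrt n\<close>, where it
  does not enforce sparsity.
\<close>

definition cond_P2 :: "(real \<Rightarrow> real \<Rightarrow> real) \<Rightarrow> (nat \<Rightarrow> real) \<Rightarrow> bool" where
  "cond_P2 \<eta> l \<longleftrightarrow>
     (\<forall>n\<ge>1.
        \<eta> (l n) 0 = 0 \<and>
        ((\<lambda>\<beta>. \<eta> (l n) \<beta> / \<bar>\<beta>\<bar>) \<longlongrightarrow> l n) (at 0) \<and>
        ((\<lambda>\<beta>. deriv (\<eta> (l n)) \<beta> / sgn \<beta>) \<longlongrightarrow> l n) (at 0)) \<and>
     (\<forall>K>0. \<forall>\<epsilon>>0. \<forall>\<^sub>F n in sequentially.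
        \<forall>\<beta>. 0 < \<bar>\<beta>\<bar> \<and> \<bar>\<beta>\<bar> \<le> K / sqrt (real n) \<longrightarrow>
             \<bar>\<eta> (l n) \<beta> / \<bar>\<beta>\<bar> - l n\<bar> \<le> \<epsilon> * l n)"

definition cond_P3 :: "(real \<Rightarrow> real \<Rightarrow> real) \<Rightarrow> (nat \<Rightarrow> real) \<Rightarrow> bool" where
  "cond_P3 \<eta> l \<longleftrightarrow> (\<forall>\<beta>. (\<lambda>n. \<eta> (l n) \<beta>) \<longlonglongrightarrow> 0)"

definition cond_P4 :: "(real \<Rightarrow> real \<Rightarrow> real) \<Rightarrow> (nat \<Rightarrow> real) \<Rightarrow> bool" where
  "cond_P4 \<eta> l \<longleftrightarrow> (\<exists>\<tau>>0. \<forall>n\<ge>1. \<forall>\<beta>. \<bar>\<beta>\<bar> \<ge> \<tau> * l n \<longrightarrow> deriv (\<eta> (l n)) \<beta> = 0)"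

text \<open>
  For fixed \<open>\<beta> \<noteq> 0\<close> and \<open>l n \<rightarrow> 0\<close>, the second derivative at \<open>\<beta>\<close> exists for all large \<open>n\<close> by
  \<open>cond_P4\<close>; it need not exist everywhere (the SCAD and MCP penalties have kinks in \<open>\<eta>'\<close>).
\<close>

definition cond_P5 :: "(real \<Rightarrow> real \<Rightarrow> real) \<Rightarrow> (nat \<Rightarrow> real) \<Rightarrow> bool" where
  "cond_P5 \<eta> l \<longleftrightarrow> (\<forall>\<beta>. \<beta> \<noteq> 0 \<longrightarrow> (\<lambda>n. deriv (deriv (\<eta> (l n))) \<beta>) \<longlonglongrightarrow> 0)"

definition penalized_objective ::
    "(real^'r) measure \<Rightarrow> (real^'r \<Rightarrow> real) \<Rightarrow> (nat \<Rightarrow> real^'p^'r) \<Rightarrow> (real \<Rightarrow> real)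
      \<Rightarrow> nat \<Rightarrow> (nat \<Rightarrow> real^'r) \<Rightarrow> real^'p \<Rightarrow> real" where
  "penalized_objective \<nu> b X pen n ys \<beta> =
     - (\<Sum>i<n. loglik \<nu> b (ys i) (X i) \<beta>) + real n * (\<Sum>j\<in>UNIV. pen (\<beta> $ j))"

text \<open>
  An estimator is a measurable function of the sample. A minimizer over the open set \<open>B\<close> need
  not exist for every sample (e.g. separated data in logistic regression); the estimator is
  unconstrained on the samples without minimizer, and any choice among several minimizers is
  allowed.
\<close>

definition penalized_mle ::
    "(real^'r) measure \<Rightarrow> (real^'r \<Rightarrow> real) \<Rightarrow> (nat \<Rightarrow> real^'p^'r) \<Rightarrow> (real^'p) set
      \<Rightarrow> (real \<Rightarrow> real \<Rightarrow> real) \<Rightarrow> (nat \<Rightarrow> real)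
      \<Rightarrow> (nat \<Rightarrow> (nat \<Rightarrow> real^'r) \<Rightarrow> real^'p) \<Rightarrow> bool" where
  "penalized_mle \<nu> b X B \<eta> l est \<longleftrightarrow> (\<forall>n\<ge>1.
     est n \<in> borel_measurable (\<Pi>\<^sub>M i\<in>{..<n}. borel) \<and>
     (\<forall>ys \<in> space (\<Pi>\<^sub>M i\<in>{..<n}. borel).
        (\<exists>\<beta>. is_arg_min (penalized_objective \<nu> b X (\<eta> (l n)) n ys) (\<lambda>\<beta>. \<beta> \<in> B) \<beta>) \<longrightarrow>
        is_arg_min (penalized_objective \<nu> b X (\<eta> (l n)) n ys) (\<lambda>\<beta>. \<beta> \<in> B) (est n ys)))"

definition active_set :: "real^'p \<Rightarrow> 'p set" where
  "active_set \<beta> = {j. \<beta> $ j \<noteq> 0}"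

definition loglik_gain ::
    "(real^'r) measure \<Rightarrow> (real^'r \<Rightarrow> real) \<Rightarrow> (nat \<Rightarrow> real^'p^'r) \<Rightarrow> real^'p
      \<Rightarrow> nat \<Rightarrow> (nat \<Rightarrow> real^'r) \<Rightarrow> real^'p \<Rightarrow> real" where
  "loglik_gain \<nu> b X \<beta>s n ys \<beta> =
     (\<Sum>i<n. loglik \<nu> b (ys i) (X i) \<beta> - loglik \<nu> b (ys i) (X i) \<beta>s)"

definition tendsto_in_probability ::
    "'w measure \<Rightarrow> (nat \<Rightarrow> 'w \<Rightarrow> real) \<Rightarrow> real \<Rightarrow> bool" where
  "tendsto_in_probability M U c \<longleftrightarrow>
     (\<forall>\<epsilon>>0. (\<lambda>n. measure M {\<omega> \<in> space M. \<bar>U n \<omega> - c\<bar> > \<epsilon>}) \<longlonglongrightarrow> 0)"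

end

theory Submission
  imports Defs
begin

text \<open>
  Let \<open>s\<close> and \<open>s'\<close> be the normalized scores at \<open>\<beta>s\<close> of the sample and of its copy, and \<open>S\<close> the support
  of \<open>\<beta>s\<close>. The negative log-likelihood is convex and, after rescaling by \<open>sqrt n\<close> around \<open>\<beta>s\<close>,
  uniformly close to \<open>w \<bullet> J w / 2 - s \<bullet> w\<close>. The penalty is flat near the nonzero coordinates of \<open>\<beta>s\<close> and
  outweighs the likelihood near zero, since \<open>sqrt n * l n \<rightarrow> \<infinity>\<close>. Hence, as soon as \<open>s\<close> is bounded and
  \<open>n\<close> is large, every minimizer has active set \<open>S\<close> and \<open>sqrt n (est - \<beta>s)\<close> is close to the minimizer
  \<open>v\<close> of the quadratic over the vectors supported on \<open>S\<close>.

  The log-likelihood difference is exactly \<open>(s - s') \<bullet> sqrt n (est - \<beta>s)\<close>, so it is close in probability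
  to \<open>W = (s - s') \<bullet> v\<close>. As \<open>s\<close> and \<open>s'\<close> are independent and centred with covariance tending to \<open>J\<close>, the
  expectation of \<open>W\<close> tends to the trace of the identity on the vectors supported on \<open>S\<close>, which is
  \<open>card S\<close>. The fourth moments of \<open>s\<close> are bounded, so \<open>W\<close> is uniformly integrable and its
  expectations converge to that of the weak limit; no central limit theorem is needed.
\<close>

section \<open>Minimizers of penalized convex functions\<close>

text \<open>All asymptotics of the estimator are packed into one deterministic statement, uniform
  over scores of norm at most \<open>K\<close>; probability then enters only through tightness of
  the scores. This works because the objective depends on the sample, up to a term free of
  \<open>\<beta>\<close>, only through \<open>s\<close>. The penalty need not be convex, so
  first-order conditions do not characterize minimizers: each step compares the objective at a
  minimizer with its value at a competitor, and convexity of the likelihood part carries local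
  bounds outward. Existence of a minimizer has to belong to the statement, since the estimator is
  arbitrary on samples without one. For the same reason nothing bounds the moments of the
  log-likelihood difference itself, and the expectation of its limit is read off from the surrogate
  \<open>W\<close>. A \<open>J\<close>-orthonormal basis \<open>e\<close> of the vectors supported
  on \<open>S\<close> gives \<open>v\<close> as the sum of the
  \<open>(s \<bullet> e a) *\<^sub>R e a\<close>; this avoids inverting a submatrix of
  \<open>J\<close> and turns the limiting trace into a sum of \<open>card S\<close> ones.\<close>

lemma pos_def_commute:
  fixes J :: "real^'n^'n"
  assumes "pos_def J"
  shows "u \<bullet> (J *v w) = w \<bullet> (J *v u)"
proof -
  have "w \<bullet> (J *v u) = (w v* J) \<bullet> u" by (simp add: dot_lmul_matrix)
  also have "w v* J = transpose J *v w" by simp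
  also have "transpose J = J" using assms by (simp add: pos_def_def)
  finally show ?thesis by (simp add: inner_commute)
qed

text \<open>The constant is the minimum of the quadratic form over the compact unit sphere;
  homogeneity extends the bound to all vectors.\<close>

lemma pos_def_coercive:
  fixes J :: "real^'n^'n"
  assumes "pos_def J"
  shows "\<exists>m>0. \<forall>u. m * (norm u)\<^sup>2 \<le> u \<bullet> (J *v u)"
proof -
  let ?q = "\<lambda>u::real^'n. u \<bullet> (J *v u)"
  have cont: "continuous_on (sphere 0 1) ?q"
    by (intro continuous_intros linear_continuous_on matrix_vector_mul_bounded_linear)
  have "axis (undefined::'n) 1 \<in> sphere (0::real^'n) 1" by (simp add: norm_axis_1)
  then have "sphere (0::real^'n) 1 \<noteq> {}" by blast
  then obtain u0 where u0: "u0 \<in> sphere 0 1" "\<And>u. u \<in> sphere 0 1 \<Longrightarrow> ?q u0 \<le> ?q u"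
    using continuous_attains_inf[OF compact_sphere _ cont] by blast
  have "u0 \<noteq> 0" using u0(1) by auto
  then have pos: "?q u0 > 0" using assms by (simp add: pos_def_def)
  have "?q u0 * (norm u)\<^sup>2 \<le> ?q u" for u
  proof (cases "u = 0")
    case False
    have "?q u0 \<le> ?q (u /\<^sub>R norm u)" using False by (intro u0(2)) simp
    also have "\<dots> = ?q u / (norm u)\<^sup>2"
      by (simp add: matrix_vector_mult_scaleR power2_eq_square field_simps)
    finally show ?thesis using False by (simp add: field_simps)
  qed simp
  with pos show ?thesis by blast
qed

text \<open>Gram-Schmidt for the inner product \<open>u \<bullet> (J *v w)\<close>, adding one
  coordinate axis per element of \<open>S\<close>. Indexing the basis by \<open>S\<close> itself is
  what later produces the count \<open>card S\<close>.\<close>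

lemma pos_def_orthonormal_basis:
  fixes J :: "real^'n^'n" and S :: "'n set"
  assumes J: "pos_def J"
  shows "\<exists>e. (\<forall>a\<in>S. \<forall>j. j \<notin> S \<longrightarrow> e a $ j = 0) \<and>
             (\<forall>a\<in>S. e a \<bullet> (J *v e a) = 1) \<and>
             (\<forall>w. (\<forall>j. j \<notin> S \<longrightarrow> w $ j = 0) \<longrightarrow> w = (\<Sum>a\<in>S. (e a \<bullet> (J *v w)) *\<^sub>R e a))"
proof -
  let ?B = "\<lambda>u w. u \<bullet> (J *v w)"
  have Badd: "?B u (x + y) = ?B u x + ?B u y" and Bscale: "?B u (c *\<^sub>R x) = c * ?B u x"
    and Bdiff: "?B u (x - y) = ?B u x - ?B u y" for u x y c
    by (simp_all add: matrix_vector_right_distrib matrix_vector_mult_diff_distrib inner_add_right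
        inner_diff_right matrix_vector_mult_scaleR)
  have Bsum: "?B u (\<Sum>a\<in>T. g a) = (\<Sum>a\<in>T. ?B u (g a))" if "finite T" for u T and g :: "'n \<Rightarrow> real^'n"
    using that by (induction T) (simp_all add: Badd)
  have "finite S" by simp
  \<comment> \<open>The induction carries full orthonormality, which the Gram-Schmidt step needs;
    the unit norms and the expansion are extracted at the end.\<close>
  then have "\<exists>e. (\<forall>a\<in>S. \<forall>j. j \<notin> S \<longrightarrow> e a $ j = 0) \<and>
             (\<forall>a\<in>S. \<forall>c\<in>S. ?B (e a) (e c) = of_bool (a = c)) \<and>
             (\<forall>w. (\<forall>j. j \<notin> S \<longrightarrow> w $ j = 0) \<longrightarrow> w = (\<Sum>a\<in>S. ?B (e a) w *\<^sub>R e a))"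
  proof (induction S)
    case empty
    show ?case by (auto simp: vec_eq_iff)
  next
    case (insert k S)
    then obtain e where e0: "\<And>a j. a \<in> S \<Longrightarrow> j \<notin> S \<Longrightarrow> e a $ j = 0"
      and e1: "\<And>a c. a \<in> S \<Longrightarrow> c \<in> S \<Longrightarrow> ?B (e a) (e c) = of_bool (a = c)"
      and e2: "\<And>w. (\<And>j. j \<notin> S \<Longrightarrow> w $ j = 0) \<Longrightarrow> w = (\<Sum>a\<in>S. ?B (e a) w *\<^sub>R e a)"
      by blast
    define ax where "ax = axis k (1::real)"
    define x where "x = ax - (\<Sum>a\<in>S. ?B (e a) ax *\<^sub>R e a)"
    have ax: "ax $ j = of_bool (j = k)" for j by (simp add: ax_def axis_def)
    \<comment> \<open>The earlier basis vectors vanish at \<open>k\<close>, so \<open>x\<close>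
      keeps the entry 1 there. Hence \<open>x\<close> is nonzero and can be normalized.\<close>
    have xj: "x $ j = of_bool (j = k)" if "j \<notin> S" for j
      using that by (simp add: x_def ax sum_component e0)
    have "x \<noteq> 0" using xj[of k] insert.hyps by auto
    then have q: "?B x x > 0" using J by (simp add: pos_def_def)
    define g where "g = sqrt (?B x x)"
    have g: "g > 0" "g * g = ?B x x" using q by (simp_all add: g_def)
    define ek where "ek = x /\<^sub>R g"
    have orth: "?B (e a) x = 0" if "a \<in> S" for a
    proof -
      have "(\<Sum>c\<in>S. ?B (e c) ax * ?B (e a) (e c)) = (\<Sum>c\<in>S. if c = a then ?B (e c) ax else 0)"
        by (rule sum.cong) (auto simp: e1 that)
      then show ?thesis
        using that insert.hyps by (simp add: x_def Bdiff Bsum Bscale)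
    qed
    have orth2: "?B ek (e a) = 0" "?B (e a) ek = 0" if "a \<in> S" for a
      using orth[OF that] pos_def_commute[OF J, of ek "e a"] by (simp_all add: ek_def Bscale)
    have norm1: "?B ek ek = 1"
      using g(1) by (simp add: ek_def Bscale flip: g(2)) (simp add: field_simps)
    define e' where "e' = e(k := ek)"
    have eS: "e' a = e a" if "a \<in> S" for a using that insert.hyps by (auto simp: e'_def)
    have ek: "e' k = ek" by (simp add: e'_def)
    have "\<forall>a\<in>insert k S. \<forall>j. j \<notin> insert k S \<longrightarrow> e' a $ j = 0"
      using xj by (auto simp: eS ek e0) (simp add: ek_def)
    moreover have "\<forall>a\<in>insert k S. \<forall>c\<in>insert k S. ?B (e' a) (e' c) = of_bool (a = c)"
      using insert.hyps by (auto simp: eS ek e1 orth2 norm1)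
    moreover have "w = (\<Sum>a\<in>insert k S. ?B (e' a) w *\<^sub>R e' a)"
      if w: "\<forall>j. j \<notin> insert k S \<longrightarrow> w $ j = 0" for w
    proof -
      \<comment> \<open>Subtracting the multiple of \<open>x\<close> with the same entry at
        \<open>k\<close> leaves a vector supported on the old \<open>S\<close>, to which the
        induction hypothesis applies.\<close>
      define w' where "w' = w - w $ k *\<^sub>R x"
      have w'0: "w' $ j = 0" if "j \<notin> S" for j using that w by (auto simp: w'_def xj)
      have ww: "w = w' + (w $ k * g) *\<^sub>R ek" using g by (simp add: w'_def ek_def)
      have w'e: "w' = (\<Sum>a\<in>S. ?B (e a) w' *\<^sub>R e a)" by (rule e2) (rule w'0)
      have "?B ek w' = 0"
        by (subst w'e) (simp add: Bsum insert.hyps Bscale orth2)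
      then have k: "?B ek w = w $ k * g" by (subst ww) (simp add: Badd Bscale norm1)
      have "?B (e a) w = ?B (e a) w'" if "a \<in> S" for a
        by (subst ww) (simp add: Badd Bscale orth2 that)
      then have "(\<Sum>a\<in>S. ?B (e' a) w *\<^sub>R e' a) = w'"
        using w'e by (simp add: eS cong: sum.cong)
      then have "(\<Sum>a\<in>insert k S. ?B (e' a) w *\<^sub>R e' a) = (w $ k * g) *\<^sub>R ek + w'"
        using insert.hyps k by (simp add: ek)
      then show ?thesis using ww by (simp add: add.commute)
    qed
    ultimately show ?case by blast
  qed
  then obtain e where e: "\<forall>a\<in>S. \<forall>j. j \<notin> S \<longrightarrow> e a $ j = 0"
      "\<forall>a\<in>S. \<forall>c\<in>S. ?B (e a) (e c) = of_bool (a = c)"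
      "\<forall>w. (\<forall>j. j \<notin> S \<longrightarrow> w $ j = 0) \<longrightarrow> w = (\<Sum>a\<in>S. ?B (e a) w *\<^sub>R e a)"
    by blast
  from e(2) have "\<forall>a\<in>S. ?B (e a) (e a) = 1" by simp
  with e(1,3) show ?thesis by blast
qed

text \<open>Here \<open>f n\<close> is the smooth convex part without its linear term and
  \<open>s\<close> an arbitrary vector in the ball of radius \<open>K\<close>. The threshold for
  \<open>n\<close> does not depend on \<open>s\<close>, so the result can be applied pointwise to a
  random score.\<close>

lemma penalized_minimizer_expansion:
  fixes f :: "nat \<Rightarrow> real^'p \<Rightarrow> real" and pen :: "nat \<Rightarrow> real \<Rightarrow> real"
    and J :: "real^'p^'p" and \<beta>0 :: "real^'p"
  defines "Q \<equiv> \<lambda>n s \<beta>. f n \<beta> - sqrt (real n) * (s \<bullet> (\<beta> - \<beta>0)) + real n * (\<Sum>j\<in>UNIV. pen n (\<beta> $ j))"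
  assumes B: "open B" "convex B" "\<beta>0 \<in> B" and J: "pos_def J"
    and conv: "\<And>n. convex_on B (f n)"
    and f0: "\<And>n. f n \<beta>0 = 0" and f_nonneg: "\<And>n \<beta>. \<beta> \<in> B \<Longrightarrow> 0 \<le> f n \<beta>"
    and quad: "\<And>\<epsilon>. \<epsilon> > 0 \<Longrightarrow> \<exists>\<delta>>0. \<forall>\<^sub>F n in sequentially. \<forall>u. norm u \<le> \<delta> \<longrightarrow>
        \<bar>f n (\<beta>0 + u) - real n / 2 * (u \<bullet> (J *v u))\<bar> \<le> \<epsilon> * real n * (norm u)\<^sup>2"
    and pen_cont: "\<And>n. n \<ge> 1 \<Longrightarrow> continuous_on UNIV (pen n)"
    and pen_nonneg: "\<And>n x. n \<ge> 1 \<Longrightarrow> 0 \<le> pen n x" and pen_0: "\<And>n. n \<ge> 1 \<Longrightarrow> pen n 0 = 0"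
    and pen_flat: "\<And>c. c \<noteq> 0 \<Longrightarrow>
        \<forall>\<^sub>F n in sequentially. \<forall>x. \<bar>x - c\<bar> \<le> \<bar>c\<bar> / 2 \<longrightarrow> pen n x = pen n c"
    and pen_lim: "\<And>x. (\<lambda>n. pen n x) \<longlonglongrightarrow> 0"
    and pen_steep: "\<And>K M. K > 0 \<Longrightarrow> \<forall>\<^sub>F n in sequentially. \<forall>x. \<bar>x\<bar> \<le> K / sqrt (real n) \<longrightarrow>
        sqrt (real n) * (M * \<bar>x\<bar>) \<le> real n * pen n x"
    and e_supp: "\<And>a j. a \<in> active_set \<beta>0 \<Longrightarrow> j \<notin> active_set \<beta>0 \<Longrightarrow> e a $ j = 0"
    and e_span: "\<And>w. (\<And>j. j \<notin> active_set \<beta>0 \<Longrightarrow> w $ j = 0) \<Longrightarrow>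
        w = (\<Sum>a\<in>active_set \<beta>0. (e a \<bullet> (J *v w)) *\<^sub>R e a)"
    and K: "K > 0" and \<epsilon>: "\<epsilon> > 0"
  shows "\<forall>\<^sub>F n in sequentially. \<forall>s. norm s \<le> K \<longrightarrow>
      (\<exists>\<beta>. is_arg_min (Q n s) (\<lambda>\<beta>. \<beta> \<in> B) \<beta>) \<and>
      (\<forall>\<beta>. is_arg_min (Q n s) (\<lambda>\<beta>. \<beta> \<in> B) \<beta> \<longrightarrow>
         active_set \<beta> = active_set \<beta>0 \<and>
         norm (sqrt (real n) *\<^sub>R (\<beta> - \<beta>0) - (\<Sum>a\<in>active_set \<beta>0. (s \<bullet> e a) *\<^sub>R e a)) \<le> \<epsilon>)"
proof -
  define S where "S = active_set \<beta>0"
  have S: "j \<in> S \<longleftrightarrow> \<beta>0 $ j \<noteq> 0" for j by (simp add: S_def active_set_def)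
  obtain m where m: "m > 0" "\<And>u. m * (norm u)\<^sup>2 \<le> u \<bullet> (J *v u)"
    using pos_def_coercive[OF J] by blast
  obtain L where L: "L > 0" "\<And>u. norm (J *v u) \<le> norm u * L"
    using bounded_linear.pos_bounded[OF matrix_vector_mul_bounded_linear[of J]] by blast
  \<comment> \<open>The quadratic term is at least \<open>m / 2\<close> times
    \<open>real n * (norm u)\<^sup>2\<close>; an error of \<open>m / 4\<close> leaves curvature
    \<open>m / 4\<close>.\<close>
  obtain \<delta>1 where \<delta>1: "\<delta>1 > 0" and ev1: "\<forall>\<^sub>F n in sequentially. \<forall>u. norm u \<le> \<delta>1 \<longrightarrow>
        \<bar>f n (\<beta>0 + u) - real n / 2 * (u \<bullet> (J *v u))\<bar> \<le> m / 4 * real n * (norm u)\<^sup>2"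
    using quad[of "m / 4"] m by auto
  obtain \<delta>2 where \<delta>2: "\<delta>2 > 0" "cball \<beta>0 \<delta>2 \<subseteq> B"
    using B open_contains_cball by blast
  \<comment> \<open>Half of the smallest nonzero entry of \<open>\<beta>0\<close> in absolute value:
    within this radius no coordinate in \<open>S\<close> leaves the flat zone or reaches 0. The
    inserted 1 covers an empty \<open>S\<close>.\<close>
  define \<delta>3 where "\<delta>3 = Min (insert 1 ((\<lambda>j. \<bar>\<beta>0 $ j\<bar> / 2) ` S))"
  have \<delta>3: "\<delta>3 > 0" unfolding \<delta>3_def by (subst Min_gr_iff) (auto simp: S)
  have \<delta>3': "\<delta>3 \<le> \<bar>\<beta>0 $ j\<bar> / 2" if "j \<in> S" for j
    unfolding \<delta>3_def using that by (intro Min_le) auto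
  define \<delta> where "\<delta> = min \<delta>1 (min \<delta>2 \<delta>3)"
  have \<delta>: "\<delta> > 0" "\<delta> \<le> \<delta>1" "\<delta> \<le> \<delta>2" "\<delta> \<le> \<delta>3"
    using \<delta>1 \<delta>2 \<delta>3 by (auto simp: \<delta>_def)
  have inB: "\<beta> \<in> B" if "norm (\<beta> - \<beta>0) \<le> \<delta>" for \<beta>
    using that \<delta> \<delta>2(2) by (auto simp: dist_norm norm_minus_commute subset_iff)
  \<comment> \<open>\<open>C\<close> bounds the curvature of \<open>f n\<close> from above.
    \<open>K1\<close> and \<open>K2\<close> will bound the rescaled minimizer \<open>w\<close> and
    the target \<open>v\<close>; the summand 1 keeps \<open>K2\<close> positive when
    \<open>S\<close> is empty.\<close>
  define C where "C = L / 2 + m / 4"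
  define K1 where "K1 = 4 * K / m"
  define K2 where "K2 = K * (\<Sum>a\<in>S. (norm (e a))\<^sup>2) + 1"
  \<comment> \<open>The required slope of the penalty, in units of \<open>sqrt (real n)\<close>:
    \<open>K\<close> pays for the score, \<open>4 * C * K1\<close> for the growth of
    \<open>f n\<close>, and 1 makes the comparison strict.\<close>
  define M where "M = K + 4 * C * K1 + 1"
  have pos: "C > 0" "K1 > 0" "K2 > 0" using L m K by (auto simp: C_def K1_def K2_def intro!: add_nonneg_pos mult_nonneg_nonneg sum_nonneg)
  \<comment> \<open>Chosen so that the two approximation errors, at \<open>w\<close> and at
    \<open>v\<close>, add up to \<open>m / 2 * \<epsilon>\<^sup>2\<close>.\<close>
  define \<epsilon>' where "\<epsilon>' = m / 2 * \<epsilon>\<^sup>2 / (K1\<^sup>2 + K2\<^sup>2)"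
  have KK: "K1\<^sup>2 + K2\<^sup>2 > 0" using pos by (simp add: add_pos_pos)
  have \<epsilon>': "\<epsilon>' > 0" using m \<epsilon> KK by (simp add: \<epsilon>'_def)
  obtain \<delta>4 where \<delta>4: "\<delta>4 > 0" and ev2: "\<forall>\<^sub>F n in sequentially. \<forall>u. norm u \<le> \<delta>4 \<longrightarrow>
        \<bar>f n (\<beta>0 + u) - real n / 2 * (u \<bullet> (J *v u))\<bar> \<le> \<epsilon>' * real n * (norm u)\<^sup>2"
    using quad[OF \<epsilon>'] by auto
  have ev3: "\<forall>\<^sub>F n in sequentially. \<forall>j\<in>S. \<forall>x. \<bar>x - \<beta>0 $ j\<bar> \<le> \<bar>\<beta>0 $ j\<bar> / 2 \<longrightarrow> pen n x = pen n (\<beta>0 $ j)"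
    using pen_flat by (intro eventually_ball_finite) (auto simp: S)
  have "(\<lambda>n. \<Sum>j\<in>UNIV. pen n (\<beta>0 $ j)) \<longlonglongrightarrow> (\<Sum>j\<in>(UNIV::'p set). 0)"
    by (intro tendsto_sum pen_lim)
  then have ev4: "\<forall>\<^sub>F n in sequentially. (\<Sum>j\<in>UNIV. pen n (\<beta>0 $ j)) < m / 8 * \<delta>\<^sup>2"
    using m \<delta> by (intro order_tendstoD(2)[of _ 0]) auto
  have ev5: "\<forall>\<^sub>F n in sequentially. \<forall>x. \<bar>x\<bar> \<le> K1 / sqrt (real n) \<longrightarrow>
        sqrt (real n) * (M * \<bar>x\<bar>) \<le> real n * pen n x"
    by (rule pen_steep[OF pos(2)])
  \<comment> \<open>Collects the lower bounds on \<open>sqrt (real n)\<close> which place all points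
    at distance of order \<open>1 / sqrt (real n)\<close> inside the balls of radii
    \<open>\<delta>\<close> and \<open>\<delta>4\<close>.\<close>
  define R where "R = Max {8 * K / (m * \<delta>), K1 / \<delta>4, 2 * K1 / \<delta>, K2 / \<delta>, K2 / \<delta>4}"
  have R: "8 * K / (m * \<delta>) \<le> R" "K1 / \<delta>4 \<le> R" "2 * K1 / \<delta> \<le> R" "K2 / \<delta> \<le> R" "K2 / \<delta>4 \<le> R"
    unfolding R_def by (intro Max_ge; simp)+
  have ev6: "\<forall>\<^sub>F n in sequentially. R \<le> sqrt (real n)"
    using filterlim_compose[OF sqrt_at_top filterlim_real_sequentially]
    by (simp add: filterlim_at_top)
  show ?thesis
    using ev1 ev2 ev3 ev4 ev5 ev6 eventually_ge_at_top[of 1]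
  proof eventually_elim
    fix n :: nat
    assume q1: "\<forall>u. norm u \<le> \<delta>1 \<longrightarrow>
        \<bar>f n (\<beta>0 + u) - real n / 2 * (u \<bullet> (J *v u))\<bar> \<le> m / 4 * real n * (norm u)\<^sup>2"
      and q2: "\<forall>u. norm u \<le> \<delta>4 \<longrightarrow>
        \<bar>f n (\<beta>0 + u) - real n / 2 * (u \<bullet> (J *v u))\<bar> \<le> \<epsilon>' * real n * (norm u)\<^sup>2"
      and flat: "\<forall>j\<in>S. \<forall>x. \<bar>x - \<beta>0 $ j\<bar> \<le> \<bar>\<beta>0 $ j\<bar> / 2 \<longrightarrow> pen n x = pen n (\<beta>0 $ j)"
      and small: "(\<Sum>j\<in>UNIV. pen n (\<beta>0 $ j)) < m / 8 * \<delta>\<^sup>2"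
      and steep: "\<forall>x. \<bar>x\<bar> \<le> K1 / sqrt (real n) \<longrightarrow> sqrt (real n) * (M * \<bar>x\<bar>) \<le> real n * pen n x"
      and Rn: "R \<le> sqrt (real n)" and n: "1 \<le> n"
    define q where "q = sqrt (real n)"
    have q: "q > 0" "q * q = real n" using n by (auto simp: q_def)
    have q3: "8 * K \<le> q * (m * \<delta>)" "K1 / q \<le> \<delta>4" "2 * K1 / q \<le> \<delta>" "K2 / q \<le> \<delta>" "K2 / q \<le> \<delta>4"
      using order.trans[OF R(1) Rn] order.trans[OF R(2) Rn] order.trans[OF R(3) Rn]
        order.trans[OF R(4) Rn] order.trans[OF R(5) Rn] q(1) \<delta>(1) \<delta>4 m(1)
      unfolding q_def[symmetric] by (simp_all add: field_simps)
    have lower: "m / 4 * real n * (norm u)\<^sup>2 \<le> f n (\<beta>0 + u)" if "norm u \<le> \<delta>" for u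
    proof -
      have "real n / 2 * (m * (norm u)\<^sup>2) \<le> real n / 2 * (u \<bullet> (J *v u))"
        using m(2) by (intro mult_left_mono) auto
      moreover have "\<bar>f n (\<beta>0 + u) - real n / 2 * (u \<bullet> (J *v u))\<bar> \<le> m / 4 * real n * (norm u)\<^sup>2"
        using q1 that \<delta>(2) by auto
      ultimately show ?thesis unfolding abs_le_iff by (simp add: field_simps)
    qed
    have upper: "f n (\<beta>0 + u) \<le> C * real n * (norm u)\<^sup>2" if "norm u \<le> \<delta>" for u
    proof -
      have "u \<bullet> (J *v u) \<le> norm u * norm (J *v u)" by (rule norm_cauchy_schwarz)
      also have "\<dots> \<le> norm u * (norm u * L)" by (intro mult_left_mono L) auto
      finally have "real n / 2 * (u \<bullet> (J *v u)) \<le> real n / 2 * (norm u * (norm u * L))"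
        by (intro mult_left_mono) auto
      moreover have "\<bar>f n (\<beta>0 + u) - real n / 2 * (u \<bullet> (J *v u))\<bar> \<le> m / 4 * real n * (norm u)\<^sup>2"
        using q1 that \<delta>(2) by auto
      ultimately show ?thesis unfolding abs_le_iff by (simp add: C_def field_simps power2_eq_square)
    qed
    have pen_eq: "pen n (\<beta> $ j) = pen n (\<beta>0 $ j)" if "norm (\<beta> - \<beta>0) \<le> \<delta>" "j \<in> S" for \<beta> j
    proof -
      have "\<bar>\<beta> $ j - \<beta>0 $ j\<bar> \<le> norm (\<beta> - \<beta>0)"
        using component_le_norm_cart[of "\<beta> - \<beta>0" j] by simp
      also have "\<dots> \<le> \<bar>\<beta>0 $ j\<bar> / 2" using that \<delta>(4) \<delta>3' by force
      finally show ?thesis using flat that(2) by blast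
    qed
    \<comment> \<open>On \<open>S\<close> the penalties agree by flatness; off \<open>S\<close> the
      penalty of \<open>\<beta>0\<close> is 0.\<close>
    have pen_ge: "(\<Sum>j\<in>UNIV. pen n (\<beta>0 $ j)) \<le> (\<Sum>j\<in>UNIV. pen n (\<beta> $ j))"
      if "norm (\<beta> - \<beta>0) \<le> \<delta>" for \<beta>
    proof (rule sum_mono)
      fix j
      show "pen n (\<beta>0 $ j) \<le> pen n (\<beta> $ j)"
        using pen_eq[OF that, of j] pen_nonneg[OF n] pen_0[OF n] S by (cases "j \<in> S") auto
    qed
    show "\<forall>s. norm s \<le> K \<longrightarrow>
      (\<exists>\<beta>. is_arg_min (Q n s) (\<lambda>\<beta>. \<beta> \<in> B) \<beta>) \<and>
      (\<forall>\<beta>. is_arg_min (Q n s) (\<lambda>\<beta>. \<beta> \<in> B) \<beta> \<longrightarrow>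
         active_set \<beta> = active_set \<beta>0 \<and>
         norm (sqrt (real n) *\<^sub>R (\<beta> - \<beta>0) - (\<Sum>a\<in>active_set \<beta>0. (s \<bullet> e a) *\<^sub>R e a)) \<le> \<epsilon>)"
    proof (intro allI impI)
      fix s :: "real^'p"
      assume s: "norm s \<le> K"
      have sK: "s \<bullet> u \<le> K * norm u" "- (s \<bullet> u) \<le> K * norm u" for u
      proof -
        have "\<bar>s \<bullet> u\<bar> \<le> norm s * norm u" by (rule Cauchy_Schwarz_ineq2)
        also have "\<dots> \<le> K * norm u" using s by (intro mult_right_mono) auto
        finally show "s \<bullet> u \<le> K * norm u" "- (s \<bullet> u) \<le> K * norm u" by auto
      qed
      have Q: "Q n s \<beta> = f n \<beta> - q * (s \<bullet> (\<beta> - \<beta>0)) + real n * (\<Sum>j\<in>UNIV. pen n (\<beta> $ j))" for \<beta>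
        by (simp add: Q_def q_def)
      \<comment> \<open>Convexity along the ray from \<open>\<beta>0\<close>, where
        \<open>f n\<close> is 0, turns the quadratic bound at distance \<open>\<delta>\<close> into
        linear growth beyond it. Half of this growth absorbs the score; the other half exceeds the
        penalty at \<open>\<beta>0\<close>, which is small by \<open>pen_lim\<close>.\<close>
      have far: "Q n s \<beta>0 < Q n s \<beta>" if \<beta>: "\<beta> \<in> B" "\<delta> \<le> norm (\<beta> - \<beta>0)" for \<beta>
      proof -
        define u where "u = \<beta> - \<beta>0"
        have u: "norm u \<ge> \<delta>" "norm u > 0" using \<beta> \<delta> by (auto simp: u_def)
        define t where "t = \<delta> / norm u"
        have t: "0 \<le> t" "t \<le> 1" "norm (t *\<^sub>R u) = \<delta>" using u \<delta> by (auto simp: t_def)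
        have "m / 4 * real n * \<delta>\<^sup>2 \<le> f n (\<beta>0 + t *\<^sub>R u)"
          using lower[of "t *\<^sub>R u"] t(3) by simp
        also have "\<beta>0 + t *\<^sub>R u = (1 - t) *\<^sub>R \<beta>0 + t *\<^sub>R \<beta>" by (simp add: u_def algebra_simps)
        also have "f n \<dots> \<le> (1 - t) * f n \<beta>0 + t * f n \<beta>"
          using t \<beta> B by (intro convex_onD[OF conv]) auto
        finally have "m / 4 * real n * \<delta>\<^sup>2 \<le> \<delta> / norm u * f n \<beta>" by (simp add: f0 t_def)
        then have 1: "m / 4 * real n * \<delta> * norm u \<le> f n \<beta>"
          using u \<delta> by (simp add: field_simps power2_eq_square)
        have "q * (s \<bullet> u) \<le> q * (K * norm u)" using sK q by (intro mult_left_mono) auto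
        also have "\<dots> \<le> q * (q * (m * \<delta>) / 8 * norm u)"
          using q q3(1) by (intro mult_left_mono mult_right_mono) auto
        also have "\<dots> = m * \<delta> / 8 * real n * norm u" by (simp flip: q(2))
        finally have 2: "q * (s \<bullet> u) \<le> m * \<delta> / 8 * real n * norm u" .
        have "m * \<delta> / 8 * real n * \<delta> \<le> m * \<delta> / 8 * real n * norm u"
          using u m \<delta> by (intro mult_left_mono) auto
        with 1 2 have 3: "real n * (m / 8 * \<delta>\<^sup>2) \<le> f n \<beta> - q * (s \<bullet> u)"
          by (simp add: field_simps power2_eq_square)
        have "Q n s \<beta>0 = real n * (\<Sum>j\<in>UNIV. pen n (\<beta>0 $ j))" by (simp add: Q f0)
        also have "\<dots> < real n * (m / 8 * \<delta>\<^sup>2)" using small n by simp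
        also have "\<dots> \<le> f n \<beta> - q * (s \<bullet> u) + real n * (\<Sum>j\<in>UNIV. pen n (\<beta> $ j))"
          using 3 pen_nonneg[OF n] by (simp add: sum_nonneg add_increasing2)
        finally show ?thesis by (simp add: Q u_def)
      qed
      \<comment> \<open>A minimizer over the compact ball is global, since by \<open>far\<close>
        every point outside is worse than the centre.\<close>
      have "\<exists>\<beta>. is_arg_min (Q n s) (\<lambda>\<beta>. \<beta> \<in> B) \<beta>"
      proof -
        have sub: "cball \<beta>0 \<delta> \<subseteq> B" using \<delta> \<delta>2 by auto
        have "continuous_on (cball \<beta>0 \<delta>) (f n)"
          using convex_on_continuous[OF B(1) conv] sub continuous_on_subset by blast
        then have "continuous_on (cball \<beta>0 \<delta>) (Q n s)"
          unfolding Q_def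
          by (intro continuous_intros continuous_on_compose2[OF pen_cont[OF n]]) auto
        then obtain \<beta> where \<beta>: "\<beta> \<in> cball \<beta>0 \<delta>" "\<And>\<beta>'. \<beta>' \<in> cball \<beta>0 \<delta> \<Longrightarrow> Q n s \<beta> \<le> Q n s \<beta>'"
          using continuous_attains_inf[OF compact_cball] \<delta>(1) by (metis cball_eq_empty not_less_iff_gr_or_eq)
        have "Q n s \<beta> \<le> Q n s \<beta>'" if "\<beta>' \<in> B" for \<beta>'
        proof (cases "\<beta>' \<in> cball \<beta>0 \<delta>")
          case False
          then have "Q n s \<beta>0 < Q n s \<beta>'"
            using that by (intro far) (auto simp: dist_norm norm_minus_commute)
          moreover have "Q n s \<beta> \<le> Q n s \<beta>0" using \<delta> by (intro \<beta>(2)) auto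
          ultimately show ?thesis by simp
        qed (rule \<beta>(2))
        then show ?thesis
          using \<beta>(1) sub by (intro exI[of _ \<beta>]) (auto simp: is_arg_min_linorder)
      qed
      moreover have "active_set \<beta> = active_set \<beta>0 \<and>
         norm (sqrt (real n) *\<^sub>R (\<beta> - \<beta>0) - (\<Sum>a\<in>active_set \<beta>0. (s \<bullet> e a) *\<^sub>R e a)) \<le> \<epsilon>"
        if "is_arg_min (Q n s) (\<lambda>\<beta>. \<beta> \<in> B) \<beta>" for \<beta>
      proof -
        have \<beta>B: "\<beta> \<in> B" and min: "\<And>\<beta>'. \<beta>' \<in> B \<Longrightarrow> Q n s \<beta> \<le> Q n s \<beta>'"
          using that by (auto simp: is_arg_min_linorder)
        define u where "u = \<beta> - \<beta>0"
        have \<beta>u: "\<beta> = \<beta>0 + u" by (simp add: u_def)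
        have u\<delta>: "norm u \<le> \<delta>"
          using far[OF \<beta>B] min[OF B(3)] by (force simp: u_def)
        \<comment> \<open>Comparison with \<open>\<beta>0\<close>: by \<open>pen_ge\<close> the
          penalties only help, so the curvature is paid for by the score alone. This forces
          \<open>u\<close> down to the scale \<open>1 / sqrt (real n)\<close>.\<close>
        have "m / 4 * real n * (norm u)\<^sup>2 \<le> q * (s \<bullet> u)"
        proof -
          have "real n * (\<Sum>j\<in>UNIV. pen n (\<beta>0 $ j)) \<le> real n * (\<Sum>j\<in>UNIV. pen n (\<beta> $ j))"
            using pen_ge[of \<beta>] u\<delta> by (intro mult_left_mono) (auto simp: u_def)
          then show ?thesis
            using min[OF B(3)] lower[OF u\<delta>] by (simp add: Q f0 \<beta>u)
        qed
        also have "\<dots> \<le> q * (K * norm u)" using sK q by (intro mult_left_mono) auto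
        finally have "(m / 4 * q * norm u) * (q * norm u) \<le> K * (q * norm u)"
          by (simp add: power2_eq_square mult_ac flip: q(2))
        then have "m / 4 * q * norm u \<le> K"
          using q K by (cases "u = 0") (auto simp: mult_le_cancel_right)
        then have uK1: "norm u \<le> K1 / q" using q m by (simp add: K1_def field_simps)
        \<comment> \<open>Setting the coordinates outside \<open>S\<close> to zero changes \<open>\<beta>\<close> by \<open>d\<close>. By convexity this
          raises the smooth part by at most a fixed multiple of \<open>sqrt n * norm d\<close>, while the penalty
          drops by \<open>M * sqrt n * norm d\<close>.\<close>
        have zero: "\<beta> $ j = 0" if "j \<notin> S" for j
        proof (rule ccontr)
          assume j: "\<beta> $ j \<noteq> 0"
          define d where "d = (\<chi> i. if i \<in> S then 0 else - \<beta> $ i)"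
          define \<rho> where "\<rho> = K1 / q"
          have \<rho>: "\<rho> > 0" "2 * \<rho> \<le> \<delta>" using pos q q3 by (auto simp: \<rho>_def)
          have "d $ j \<noteq> 0" using that j by (simp add: d_def)
          then have d0: "d \<noteq> 0" by auto
          have "norm d \<le> norm u"
            by (rule norm_le_componentwise_cart) (auto simp: d_def u_def S)
          then have d\<rho>: "norm d \<le> \<rho>" using uK1 by (simp add: \<rho>_def)
          have "norm (u + d) \<le> norm u"
            by (rule norm_le_componentwise_cart) (auto simp: d_def u_def S)
          then have ud: "norm (\<beta> + d - \<beta>0) \<le> \<delta>" using u\<delta> by (simp add: \<beta>u algebra_simps)
          \<comment> \<open>\<open>d\<close> may be far shorter than \<open>\<rho>\<close>, so it is
            stretched to length \<open>\<rho>\<close>. By convexity and \<open>f_nonneg\<close> the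
            increase of \<open>f n\<close> along \<open>d\<close> is at most the fraction
            \<open>t\<close> of its value at \<open>\<beta> + g\<close>, and there the quadratic
            upper bound at distance at most \<open>2 * \<rho>\<close> applies.\<close>
          define g where "g = (\<rho> / norm d) *\<^sub>R d"
          have g: "norm g = \<rho>" using d0 \<rho> by (simp add: g_def)
          have ug: "norm (u + g) \<le> 2 * \<rho>"
            using norm_triangle_ineq[of u g] uK1 g by (simp add: \<rho>_def)
          have gB: "\<beta> + g \<in> B" using ug \<rho> by (intro inB) (auto simp: \<beta>u algebra_simps)
          define t where "t = norm d / \<rho>"
          have t: "0 \<le> t" "t \<le> 1" using d\<rho> \<rho> by (auto simp: t_def)
          have tg: "t *\<^sub>R g = d" using d0 \<rho> by (simp add: t_def g_def)
          have "f n (\<beta> + d) = f n ((1 - t) *\<^sub>R \<beta> + t *\<^sub>R (\<beta> + g))"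
            by (simp add: algebra_simps tg)
          also have "\<dots> \<le> (1 - t) * f n \<beta> + t * f n (\<beta> + g)"
            using t \<beta>B gB by (intro convex_onD[OF conv]) auto
          also have "\<dots> \<le> f n \<beta> + t * f n (\<beta> + g)"
            using t f_nonneg[OF \<beta>B] by (simp add: algebra_simps)
          also have "f n (\<beta> + g) \<le> C * real n * (norm (u + g))\<^sup>2"
            using upper[of "u + g"] ug \<rho> by (simp add: \<beta>u add.assoc)
          also have "\<dots> \<le> C * real n * (2 * \<rho>)\<^sup>2"
            using ug pos by (intro mult_left_mono power_mono) auto
          finally have "f n (\<beta> + d) \<le> f n \<beta> + t * (C * real n * (2 * \<rho>)\<^sup>2)"
            using t by (simp add: mult_left_mono)
          also have "t * (C * real n * (2 * \<rho>)\<^sup>2) = norm d * (4 * C * K1 * q)"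
            using \<rho> q by (simp add: t_def \<rho>_def power2_eq_square field_simps flip: q(2))
          finally have 1: "f n (\<beta> + d) - f n \<beta> \<le> norm d * (4 * C * K1 * q)" by simp
          have 2: "- (q * (s \<bullet> d)) \<le> q * (K * norm d)"
            using mult_left_mono[OF sK(2)[of d], of q] q by simp
          have 3: "pen n ((\<beta> + d) $ i) + (q * M * \<bar>d $ i\<bar>) / real n \<le> pen n (\<beta> $ i)" for i
          proof (cases "i \<in> S")
            case True
            then show ?thesis by (simp add: d_def)
          next
            case False
            have "\<bar>\<beta> $ i\<bar> \<le> norm u"
              using component_le_norm_cart[of u i] False by (simp add: u_def S)
            then have "q * (M * \<bar>\<beta> $ i\<bar>) \<le> real n * pen n (\<beta> $ i)"
              using steep uK1 by (auto simp: q_def)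
            then show ?thesis using False n by (simp add: d_def pen_0[OF n] field_simps)
          qed
          have "(\<Sum>i\<in>UNIV. pen n ((\<beta> + d) $ i)) + (q * M) / real n * (\<Sum>i\<in>UNIV. \<bar>d $ i\<bar>)
            \<le> (\<Sum>i\<in>UNIV. pen n (\<beta> $ i))"
            unfolding sum_distrib_left sum.distrib[symmetric] using 3 by (intro sum_mono) auto
          moreover have "(q * M) / real n * norm d \<le> (q * M) / real n * (\<Sum>i\<in>UNIV. \<bar>d $ i\<bar>)"
            using q pos K by (intro mult_left_mono norm_le_l1_cart) (auto simp: M_def)
          ultimately have "(\<Sum>i\<in>UNIV. pen n ((\<beta> + d) $ i)) + (q * M) / real n * norm d
            \<le> (\<Sum>i\<in>UNIV. pen n (\<beta> $ i))" by linarith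
          then have "real n * ((\<Sum>i\<in>UNIV. pen n ((\<beta> + d) $ i)) + (q * M) / real n * norm d)
            \<le> real n * (\<Sum>i\<in>UNIV. pen n (\<beta> $ i))" by (intro mult_left_mono) auto
          then have 4: "real n * (\<Sum>i\<in>UNIV. pen n ((\<beta> + d) $ i)) + q * M * norm d
            \<le> real n * (\<Sum>i\<in>UNIV. pen n (\<beta> $ i))" using n by (simp add: distrib_left)
          have "Q n s (\<beta> + d) - Q n s \<beta> \<le> norm d * (4 * C * K1 * q) + q * (K * norm d) - q * M * norm d"
            using 1 2 4 unfolding Q by (simp add: algebra_simps)
          also have "\<dots> = - (q * norm d)" by (simp add: M_def algebra_simps)
          also have "\<dots> < 0" using q d0 by simp
          finally show False using min[OF inB[OF ud]] by simp
        qed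
        have nonzero: "\<beta> $ j \<noteq> 0" if "j \<in> S" for j
        proof -
          have "\<bar>u $ j\<bar> \<le> \<bar>\<beta>0 $ j\<bar> / 2"
            using component_le_norm_cart[of u j] u\<delta> \<delta>(4) \<delta>3'[OF that] by linarith
          then show ?thesis using that by (auto simp: u_def S)
        qed
        define v where "v = (\<Sum>a\<in>S. (s \<bullet> e a) *\<^sub>R e a)"
        define w where "w = q *\<^sub>R u"
        have v0: "v $ j = 0" if "j \<notin> S" for j
          using that e_supp by (simp add: v_def sum_component S_def)
        have w0: "w $ j = 0" if "j \<notin> S" for j
          using that zero[OF that] by (simp add: w_def u_def S)
        \<comment> \<open>\<open>v\<close> minimizes the limiting quadratic \<open>x \<bullet> J x / 2 - s \<bullet> x\<close> among vectors supported on \<open>S\<close>.\<close>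
        have sv: "s \<bullet> x = v \<bullet> (J *v x)" if "\<And>j. j \<notin> S \<Longrightarrow> x $ j = 0" for x
        proof -
          have "s \<bullet> x = s \<bullet> (\<Sum>a\<in>S. (e a \<bullet> (J *v x)) *\<^sub>R e a)"
            using e_span[of x] that by (simp add: S_def)
          also have "\<dots> = v \<bullet> (J *v x)"
            by (simp add: v_def inner_sum_left inner_sum_right mult.commute)
          finally show ?thesis .
        qed
        have "norm v \<le> (\<Sum>a\<in>S. K * (norm (e a))\<^sup>2)"
          unfolding v_def
        proof (rule sum_norm_le)
          fix a
          have "\<bar>s \<bullet> e a\<bar> \<le> K * norm (e a)" using sK[of "e a"] by auto
          then have "\<bar>s \<bullet> e a\<bar> * norm (e a) \<le> K * norm (e a) * norm (e a)"
            by (intro mult_right_mono) auto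
          then show "norm ((s \<bullet> e a) *\<^sub>R e a) \<le> K * (norm (e a))\<^sup>2"
            by (simp add: power2_eq_square mult_ac)
        qed
        then have vK2: "norm v \<le> K2" by (simp add: K2_def sum_distrib_left)
        have wK1: "norm w \<le> K1" using uK1 q by (simp add: w_def field_simps)
        \<comment> \<open>The competitor \<open>\<beta>0 + u'\<close> has \<open>v\<close> as its
          rescaled deviation. It has the same penalty as \<open>\<beta>\<close>: both vanish off
          \<open>S\<close> and lie in the flat zone on \<open>S\<close>. Only the smooth parts
          remain to be compared.\<close>
        define u' where "u' = v /\<^sub>R q"
        have u'n: "norm u' \<le> K2 / q" using vK2 q by (simp add: u'_def field_simps)
        have vu': "v = q *\<^sub>R u'" using q by (simp add: u'_def)
        have eps: "\<bar>f n (\<beta>0 + x) - (q *\<^sub>R x) \<bullet> (J *v (q *\<^sub>R x)) / 2\<bar> \<le> \<epsilon>' * (norm (q *\<^sub>R x))\<^sup>2"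
          if "norm x \<le> \<delta>4" for x
        proof -
          have "(q *\<^sub>R x) \<bullet> (J *v (q *\<^sub>R x)) / 2 = real n / 2 * (x \<bullet> (J *v x))"
            by (simp add: matrix_vector_mult_scaleR flip: q(2))
          moreover have "\<epsilon>' * (norm (q *\<^sub>R x))\<^sup>2 = \<epsilon>' * real n * (norm x)\<^sup>2"
            by (simp add: power_mult_distrib power2_eq_square mult_ac flip: q(2))
          ultimately show ?thesis using q2[rule_format, OF that] by (simp only:)
        qed
        have e1: "\<bar>f n (\<beta>0 + u) - w \<bullet> (J *v w) / 2\<bar> \<le> \<epsilon>' * K1\<^sup>2"
        proof -
          have "\<bar>f n (\<beta>0 + u) - w \<bullet> (J *v w) / 2\<bar> \<le> \<epsilon>' * (norm w)\<^sup>2"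
            using eps[of u] uK1 q3 by (simp flip: w_def)
          also have "\<dots> \<le> \<epsilon>' * K1\<^sup>2" using wK1 \<epsilon>' by (intro mult_left_mono power_mono) auto
          finally show ?thesis .
        qed
        have e2: "\<bar>f n (\<beta>0 + u') - v \<bullet> (J *v v) / 2\<bar> \<le> \<epsilon>' * K2\<^sup>2"
        proof -
          have "\<bar>f n (\<beta>0 + u') - v \<bullet> (J *v v) / 2\<bar> \<le> \<epsilon>' * (norm v)\<^sup>2"
            using eps[of u'] u'n q3 by (simp flip: vu')
          also have "\<dots> \<le> \<epsilon>' * K2\<^sup>2" using vK2 \<epsilon>' by (intro mult_left_mono power_mono) auto
          finally show ?thesis .
        qed
        have u'\<delta>: "norm u' \<le> \<delta>" using u'n q3 by simp
        have peq: "pen n (\<beta> $ j) = pen n ((\<beta>0 + u') $ j)" for j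
        proof (cases "j \<in> S")
          case True
          then show ?thesis using pen_eq[of \<beta> j] pen_eq[of "\<beta>0 + u'" j] u\<delta> u'\<delta> by (simp add: u_def)
        next
          case False
          then show ?thesis using zero v0 by (simp add: u'_def S)
        qed
        have "Q n s \<beta> \<le> Q n s (\<beta>0 + u')" using u'\<delta> by (intro min inB) simp
        then have "f n (\<beta>0 + u) - q * (s \<bullet> u) \<le> f n (\<beta>0 + u') - q * (s \<bullet> u')"
          unfolding Q peq by (simp add: \<beta>u)
        moreover have "q * (s \<bullet> u) = v \<bullet> (J *v w)" using sv[OF w0] by (simp add: w_def)
        moreover have "q * (s \<bullet> u') = v \<bullet> (J *v v)" using sv[OF v0] by (simp add: vu')
        \<comment> \<open>Minimality bounds the excess of the limiting quadratic at \<open>w\<close>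
          over its minimum, attained at \<open>v\<close>; completing the square makes this excess
          half the squared \<open>J\<close>-distance of \<open>w\<close> and
          \<open>v\<close>.\<close>
        ultimately have "w \<bullet> (J *v w) / 2 + v \<bullet> (J *v v) / 2 - v \<bullet> (J *v w) \<le> \<epsilon>' * K1\<^sup>2 + \<epsilon>' * K2\<^sup>2"
          using e1 e2 by (simp add: abs_le_iff)
        also have "w \<bullet> (J *v w) / 2 + v \<bullet> (J *v v) / 2 - v \<bullet> (J *v w) = (w - v) \<bullet> (J *v (w - v)) / 2"
          using pos_def_commute[OF J, of w v]
          by (simp add: matrix_vector_mult_diff_distrib inner_diff_left inner_diff_right field_simps)
        finally have "(w - v) \<bullet> (J *v (w - v)) / 2 \<le> \<epsilon>' * (K1\<^sup>2 + K2\<^sup>2)" by (simp add: distrib_left)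
        also have "\<dots> = m / 2 * \<epsilon>\<^sup>2" by (metis \<epsilon>'_def KK less_irrefl nonzero_eq_divide_eq)
        finally have "m * (norm (w - v))\<^sup>2 \<le> m * \<epsilon>\<^sup>2" using m(2)[of "w - v"] by simp
        then have "norm (w - v) \<le> \<epsilon>" using m \<epsilon> by (simp add: power2_le_iff_abs_le)
        moreover have "active_set \<beta> = active_set \<beta>0"
          using zero nonzero by (auto simp: active_set_def S)
        ultimately show ?thesis by (simp add: w_def v_def u_def q_def S_def)
      qed
      ultimately show "(\<exists>\<beta>. is_arg_min (Q n s) (\<lambda>\<beta>. \<beta> \<in> B) \<beta>) \<and>
        (\<forall>\<beta>. is_arg_min (Q n s) (\<lambda>\<beta>. \<beta> \<in> B) \<beta> \<longrightarrow>
           active_set \<beta> = active_set \<beta>0 \<and>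
           norm (sqrt (real n) *\<^sub>R (\<beta> - \<beta>0) - (\<Sum>a\<in>active_set \<beta>0. (s \<bullet> e a) *\<^sub>R e a)) \<le> \<epsilon>)"
        by blast
    qed
  qed
qed

section \<open>Expectations of weak limits\<close>

text \<open>A bounded 1-Lipschitz substitute for the identity: bounded continuity suits weak
  convergence, the Lipschitz property suits closeness in probability.\<close>

definition truncate :: "real \<Rightarrow> real \<Rightarrow> real" where
  "truncate m x = max (- m) (min m x)"

lemma abs_truncate_le: "0 \<le> m \<Longrightarrow> \<bar>truncate m x\<bar> \<le> m"
  by (auto simp: truncate_def)

lemma abs_truncate_le_abs: "0 \<le> m \<Longrightarrow> \<bar>truncate m x\<bar> \<le> \<bar>x\<bar>"
  by (auto simp: truncate_def)

lemma truncate_diff_le: "\<bar>truncate m x - truncate m y\<bar> \<le> \<bar>x - y\<bar>"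
  by (auto simp: truncate_def)

lemma truncate_eq: "\<bar>x\<bar> \<le> m \<Longrightarrow> truncate m x = x"
  by (auto simp: truncate_def)

lemma isCont_truncate: "isCont (truncate m) x"
  unfolding truncate_def[abs_def] by (intro continuous_intros)

lemma measurable_truncate[measurable]: "truncate m \<in> borel_measurable borel"
  unfolding truncate_def[abs_def] by measurable

text \<open>Where truncation acts, \<open>\<bar>x\<bar>\<close> exceeds \<open>m\<close> and is thus
  at most \<open>x\<^sup>2 / m\<close>. A bounded second moment therefore makes the truncation error
  of order \<open>1 / m\<close>, uniformly in \<open>n\<close>.\<close>

lemma abs_truncate_minus_le:
  assumes "m > 0"
  shows "\<bar>truncate m x - x\<bar> \<le> x\<^sup>2 / m"
proof (cases "\<bar>x\<bar> \<le> m")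
  case True
  then show ?thesis using assms by (simp add: truncate_eq)
next
  case False
  then have "\<bar>truncate m x - x\<bar> \<le> \<bar>x\<bar>" using assms by (auto simp: truncate_def)
  moreover have "m * \<bar>x\<bar> \<le> \<bar>x\<bar> * \<bar>x\<bar>" using False assms by (intro mult_right_mono) auto
  ultimately show ?thesis using assms by (simp add: field_simps power2_eq_square) (smt (verit) mult_left_mono)
qed

lemma abs_integral_le_integral:
  fixes f g :: "'a \<Rightarrow> real"
  assumes "integrable M f" "integrable M g" "\<And>x. x \<in> space M \<Longrightarrow> \<bar>f x\<bar> \<le> g x"
  shows "\<bar>\<integral>x. f x \<partial>M\<bar> \<le> (\<integral>x. g x \<partial>M)"
  using assms by (intro order_trans[OF integral_abs_bound integral_mono]) auto

text \<open>Off the event that \<open>Z n\<close> and \<open>W n\<close> differ by more than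
  \<open>e / 2\<close> the Lipschitz bound suffices; on it, whose probability vanishes, the bound
  \<open>2 * m\<close> does.\<close>

lemma tendsto_in_probability_Lipschitz_diff:
  fixes Z W :: "nat \<Rightarrow> 'w \<Rightarrow> real" and g :: "real \<Rightarrow> real"
  assumes "prob_space M"
    and Z[measurable]: "\<And>n. Z n \<in> borel_measurable M" and W[measurable]: "\<And>n. W n \<in> borel_measurable M"
    and close: "tendsto_in_probability M (\<lambda>n \<omega>. Z n \<omega> - W n \<omega>) 0"
    and g[measurable]: "g \<in> borel_measurable borel"
    and lip: "\<And>x y. \<bar>g x - g y\<bar> \<le> \<bar>x - y\<bar>" and bdd: "\<And>x. \<bar>g x\<bar> \<le> m"
  shows "(\<lambda>n. (\<integral>\<omega>. g (Z n \<omega>) \<partial>M) - (\<integral>\<omega>. g (W n \<omega>) \<partial>M)) \<longlonglongrightarrow> 0"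
proof (rule tendstoI)
  interpret prob_space M by fact
  fix e :: real assume e: "e > 0"
  have m0: "m \<ge> 0" using bdd[of 0] by linarith
  have int: "integrable M (\<lambda>\<omega>. g (Z n \<omega>))" "integrable M (\<lambda>\<omega>. g (W n \<omega>))" for n
    using bdd by (auto intro!: integrable_const_bound[where B = m])
  define A where "A n = {\<omega> \<in> space M. \<bar>Z n \<omega> - W n \<omega>\<bar> > e / 2}" for n
  have A_sets[measurable, simp]: "A n \<in> sets M" for n unfolding A_def by measurable
  have "(\<lambda>n. measure M (A n)) \<longlonglongrightarrow> 0"
    using close e unfolding tendsto_in_probability_def A_def by (auto dest: spec[of _ "e / 2"])
  \<comment> \<open>The denominator \<open>4 * m + 4\<close> instead of \<open>4 * m\<close> also
    covers \<open>m = 0\<close>.\<close>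
  then have "\<forall>\<^sub>F n in sequentially. measure M (A n) < e / (4 * m + 4)"
    using e m0 by (intro order_tendstoD(2)[of _ 0]) auto
  then show "\<forall>\<^sub>F n in sequentially. dist ((\<integral>\<omega>. g (Z n \<omega>) \<partial>M) - (\<integral>\<omega>. g (W n \<omega>) \<partial>M)) 0 < e"
  proof eventually_elim
    case (elim n)
    have "\<bar>(\<integral>\<omega>. g (Z n \<omega>) \<partial>M) - (\<integral>\<omega>. g (W n \<omega>) \<partial>M)\<bar> = \<bar>\<integral>\<omega>. g (Z n \<omega>) - g (W n \<omega>) \<partial>M\<bar>"
      using int by simp
    also have "\<dots> \<le> (\<integral>\<omega>. e / 2 + 2 * m * indicator (A n) \<omega> \<partial>M)"
    proof (rule abs_integral_le_integral)
      show "integrable M (\<lambda>\<omega>. e / 2 + 2 * m * indicator (A n) \<omega>)"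
        by (intro Bochner_Integration.integrable_add integrable_mult_right) (auto simp: less_top[symmetric])
      fix \<omega> assume "\<omega> \<in> space M"
      then show "\<bar>g (Z n \<omega>) - g (W n \<omega>)\<bar> \<le> e / 2 + 2 * m * indicator (A n) \<omega>"
        using lip[of "Z n \<omega>" "W n \<omega>"] bdd[of "Z n \<omega>"] bdd[of "W n \<omega>"] e
        by (auto simp: A_def indicator_def)
    qed (use int in simp)
    also have "\<dots> = e / 2 + 2 * m * measure M (A n)"
      by (subst Bochner_Integration.integral_add) (auto simp: prob_space less_top[symmetric])
    also have "\<dots> < e"
    proof -
      have "2 * m * measure M (A n) \<le> 2 * m * (e / (4 * m + 4))"
        using elim m0 by (intro mult_left_mono) auto
      also have "\<dots> < e / 2" using m0 e by (simp add: field_simps)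
      finally show ?thesis by simp
    qed
    finally show ?case by simp
  qed
qed

text \<open>Weak convergence sees only bounded functions, so both \<open>W n\<close> and
  \<open>z\<close> are truncated at \<open>m\<close>; the second moments of \<open>W n\<close>
  control the error before \<open>m\<close> tends to infinity. No moment of \<open>Z n\<close> is
  assumed.\<close>

lemma expectation_of_weak_limit:
  fixes Z W :: "nat \<Rightarrow> 'w \<Rightarrow> real" and z :: "'v \<Rightarrow> real"
  assumes M: "prob_space M" and N: "prob_space N"
    and Z[measurable]: "\<And>n. Z n \<in> borel_measurable M" and W[measurable]: "\<And>n. W n \<in> borel_measurable M"
    and z[measurable]: "z \<in> borel_measurable N"
    and weak: "weak_conv_m (\<lambda>n. distr M borel (Z n)) (distr N borel z)"
    and close: "tendsto_in_probability M (\<lambda>n \<omega>. Z n \<omega> - W n \<omega>) 0"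
    and moment: "\<forall>\<^sub>F n in sequentially. integrable M (\<lambda>\<omega>. (W n \<omega>)\<^sup>2) \<and> (\<integral>\<omega>. (W n \<omega>)\<^sup>2 \<partial>M) \<le> C"
    and mean: "(\<lambda>n. \<integral>\<omega>. W n \<omega> \<partial>M) \<longlonglongrightarrow> k"
  shows "integrable N z \<and> (\<integral>v. z v \<partial>N) = k"
proof -
  interpret M: prob_space M by fact
  interpret N: prob_space N by fact
  have conv: "(\<lambda>n. \<integral>\<omega>. g (W n \<omega>) \<partial>M) \<longlonglongrightarrow> (\<integral>v. g (z v) \<partial>N)"
    if g: "\<And>x. isCont g x" "\<And>x y. \<bar>g x - g y\<bar> \<le> \<bar>x - y\<bar>" "\<And>x. \<bar>g x\<bar> \<le> m"
    for g :: "real \<Rightarrow> real" and m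
  proof -
    have [measurable]: "g \<in> borel_measurable borel"
      using g(1) by (intro borel_measurable_continuous_onI continuous_at_imp_continuous_on) auto
    have "(\<lambda>n. integral\<^sup>L (distr M borel (Z n)) g) \<longlonglongrightarrow> integral\<^sup>L (distr N borel z) g"
      using g by (intro weak_conv_imp_integral_bdd_continuous_conv[OF _ _ weak, where B = m]) auto
    then have "(\<lambda>n. \<integral>\<omega>. g (Z n \<omega>) \<partial>M) \<longlonglongrightarrow> (\<integral>v. g (z v) \<partial>N)"
      by (simp add: integral_distr)
    from tendsto_diff[OF this tendsto_in_probability_Lipschitz_diff[OF M Z W close _ g(2,3)]]
    show ?thesis by simp
  qed
  have intW: "integrable M (W n)" if "integrable M (\<lambda>\<omega>. (W n \<omega>)\<^sup>2)" for n
    by (rule M.square_integrable_imp_integrable[OF W that])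
  have C0: "C \<ge> 0"
  proof -
    obtain n where "(\<integral>\<omega>. (W n \<omega>)\<^sup>2 \<partial>M) \<le> C"
      using eventually_happens[OF moment] by auto
    moreover have "0 \<le> (\<integral>\<omega>. (W n \<omega>)\<^sup>2 \<partial>M)" by simp
    ultimately show ?thesis by linarith
  qed
  have trunc_lim: "\<bar>(\<integral>v. truncate m (z v) \<partial>N) - k\<bar> \<le> C / m" if m: "m > 0" for m
  proof (rule tendsto_upperbound)
    show "(\<lambda>n. \<bar>(\<integral>\<omega>. truncate m (W n \<omega>) \<partial>M) - (\<integral>\<omega>. W n \<omega> \<partial>M)\<bar>) \<longlonglongrightarrow> \<bar>(\<integral>v. truncate m (z v) \<partial>N) - k\<bar>"
      using m by (intro tendsto_intros mean conv[of "truncate m" m] isCont_truncate truncate_diff_le abs_truncate_le) auto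
    show "\<forall>\<^sub>F n in sequentially. \<bar>(\<integral>\<omega>. truncate m (W n \<omega>) \<partial>M) - (\<integral>\<omega>. W n \<omega> \<partial>M)\<bar> \<le> C / m"
      using moment
    proof eventually_elim
      case (elim n)
      have int: "integrable M (\<lambda>\<omega>. truncate m (W n \<omega>))"
        using m by (intro M.integrable_const_bound[where B = m]) (auto simp: abs_truncate_le)
      have "\<bar>(\<integral>\<omega>. truncate m (W n \<omega>) \<partial>M) - (\<integral>\<omega>. W n \<omega> \<partial>M)\<bar> = \<bar>\<integral>\<omega>. truncate m (W n \<omega>) - W n \<omega> \<partial>M\<bar>"
        using int intW elim by simp
      also have "\<dots> \<le> (\<integral>\<omega>. (W n \<omega>)\<^sup>2 / m \<partial>M)"
        using elim int intW m by (intro abs_integral_le_integral) (auto simp: abs_truncate_minus_le)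
      also have "\<dots> \<le> C / m" using elim m by (simp add: divide_right_mono)
      finally show ?case .
    qed
  qed simp
  \<comment> \<open>A bound independent of \<open>m\<close>, from which monotone convergence yields
    integrability of \<open>z\<close>.\<close>
  have abs_bound: "(\<integral>v. \<bar>truncate m (z v)\<bar> \<partial>N) \<le> C + 1" if m: "m \<ge> 0" for m
  proof (rule tendsto_upperbound)
    show "(\<lambda>n. \<integral>\<omega>. \<bar>truncate m (W n \<omega>)\<bar> \<partial>M) \<longlonglongrightarrow> (\<integral>v. \<bar>truncate m (z v)\<bar> \<partial>N)"
    proof (rule conv)
      show "isCont (\<lambda>x. \<bar>truncate m x\<bar>) x" for x by (intro continuous_intros isCont_truncate)
      show "\<bar>\<bar>truncate m x\<bar> - \<bar>truncate m y\<bar>\<bar> \<le> \<bar>x - y\<bar>" for x y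
        using truncate_diff_le[of m x y] by linarith
      show "\<bar>\<bar>truncate m x\<bar>\<bar> \<le> m" for x using abs_truncate_le[OF m] by simp
    qed
    show "\<forall>\<^sub>F n in sequentially. (\<integral>\<omega>. \<bar>truncate m (W n \<omega>)\<bar> \<partial>M) \<le> C + 1"
      using moment
    proof eventually_elim
      case (elim n)
      have "(\<integral>\<omega>. \<bar>truncate m (W n \<omega>)\<bar> \<partial>M) \<le> (\<integral>\<omega>. (W n \<omega>)\<^sup>2 + 1 \<partial>M)"
      proof (rule integral_mono)
        show "integrable M (\<lambda>\<omega>. \<bar>truncate m (W n \<omega>)\<bar>)"
          using m by (intro M.integrable_const_bound[where B = m]) (auto simp: abs_truncate_le)
        show "integrable M (\<lambda>\<omega>. (W n \<omega>)\<^sup>2 + 1)" using elim by simp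
        have "\<bar>x\<bar> \<le> x\<^sup>2 + 1" for x :: real
          using zero_le_power2[of "\<bar>x\<bar> - 1 / 2"] by (simp add: power2_eq_square algebra_simps)
        then show "\<bar>truncate m (W n \<omega>)\<bar> \<le> (W n \<omega>)\<^sup>2 + 1" for \<omega>
          using abs_truncate_le_abs[OF m, of "W n \<omega>"] by (rule order_trans[rotated])
      qed
      also have "\<dots> \<le> C + 1" using elim by (simp add: M.prob_space)
      finally show ?case .
    qed
  qed simp
  have trunc_z: "(\<lambda>i. truncate (real i) x) \<longlonglongrightarrow> x" for x
  proof (rule tendsto_eventually)
    show "\<forall>\<^sub>F i in sequentially. truncate (real i) x = x"
      using eventually_ge_at_top[of "nat \<lceil>\<bar>x\<bar>\<rceil>"]
      by eventually_elim (rule truncate_eq, linarith)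
  qed
  have int_z: "integrable N z"
  proof -
    let ?I = "\<lambda>i. \<integral>v. \<bar>truncate (real i) (z v)\<bar> \<partial>N"
    have int: "integrable N (\<lambda>v. \<bar>truncate (real i) (z v)\<bar>)" for i
      by (intro N.integrable_const_bound[where B = "real i"]) (auto simp: abs_truncate_le)
    have mono: "\<bar>truncate (real i) x\<bar> \<le> \<bar>truncate (real j) x\<bar>" if "i \<le> j" for i j x
      using that by (auto simp: truncate_def)
    have inc: "incseq ?I" using int by (intro monoI integral_mono) (auto simp: mono)
    have "\<forall>i. ?I i \<le> C + 1" using abs_bound by simp
    from incseq_convergent[OF inc this] obtain L where L: "?I \<longlonglongrightarrow> L" by blast
    have "integrable N (\<lambda>v. \<bar>z v\<bar>)"
    proof (rule integrable_monotone_convergence[OF int _ _ L])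
      show "AE v in N. mono (\<lambda>i. \<bar>truncate (real i) (z v)\<bar>)"
        by (intro AE_I2 monoI mono)
      show "AE v in N. (\<lambda>i. \<bar>truncate (real i) (z v)\<bar>) \<longlonglongrightarrow> \<bar>z v\<bar>"
        by (intro AE_I2 tendsto_intros trunc_z)
    qed measurable
    then show ?thesis by (simp add: integrable_abs_iff)
  qed
  have "(\<lambda>i. \<integral>v. truncate (real i) (z v) \<partial>N) \<longlonglongrightarrow> (\<integral>v. z v \<partial>N)"
    using int_z trunc_z
    by (intro integral_dominated_convergence[where w = "\<lambda>v. \<bar>z v\<bar>"]) (auto simp: abs_truncate_le_abs)
  moreover have "(\<lambda>i. \<integral>v. truncate (real i) (z v) \<partial>N) \<longlonglongrightarrow> k"
  proof (rule LIM_zero_cancel, rule Lim_null_comparison)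
    show "\<forall>\<^sub>F i in sequentially. norm ((\<integral>v. truncate (real i) (z v) \<partial>N) - k) \<le> C / real i"
      using eventually_gt_at_top[of 0] by eventually_elim (simp add: trunc_lim)
    show "(\<lambda>i. C / real i) \<longlonglongrightarrow> 0" by (rule lim_const_over_n)
  qed
  ultimately show ?thesis using int_z LIMSEQ_unique by blast
qed

section \<open>Exponential families\<close>

lemma has_derivative_quadratic_remainder:
  fixes f :: "'a::real_normed_vector \<Rightarrow> real"
  assumes "bounded_linear D" "r > 0"
    and "\<And>d. norm d \<le> r \<Longrightarrow> \<bar>f (x + d) - f x - D d\<bar> \<le> C * (norm d)\<^sup>2"
  shows "(f has_derivative D) (at x)"
  unfolding has_derivative_at
proof
  have "eventually (\<lambda>d. d \<in> ball 0 r) (at (0::'a))"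
    using assms(2) by (intro eventually_at_in_open') auto
  then have "\<forall>\<^sub>F d in at 0. norm (norm (f (x + d) - f x - D d) / norm d) \<le> C * norm d"
  proof eventually_elim
    case (elim d)
    then show ?case using assms(3)[of d]
      by (cases "d = 0") (auto simp: field_simps power2_eq_square)
  qed
  moreover have "((\<lambda>d. C * norm d) \<longlongrightarrow> 0) (at (0::'a))"
    by (auto intro!: tendsto_eq_intros)
  ultimately show "((\<lambda>d. norm (f (x + d) - f x - D d) / norm d) \<longlongrightarrow> 0) (at 0)"
    by (rule Lim_null_comparison)
qed fact

text \<open>The norm is at most \<open>CARD('r)\<close> times the largest absolute coordinate, and
  the exponential of an absolute value is at most the sum over both signs. An exponential weight in
  the norm is thus dominated by finitely many shifts of the natural parameter along the
  axes.\<close>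

lemma exp_norm_le_sum_exp_component:
  fixes y :: "real^'r"
  assumes "\<rho> \<ge> 0"
  shows "exp (\<rho> * norm y) \<le>
    (\<Sum>j\<in>UNIV. exp (real CARD('r) * \<rho> * y $ j) + exp (- (real CARD('r) * \<rho> * y $ j)))"
proof -
  have "Max (range (\<lambda>j. \<bar>y $ j\<bar>)) \<in> range (\<lambda>j. \<bar>y $ j\<bar>)" by (intro Max_in) auto
  then obtain k where k: "Max (range (\<lambda>j. \<bar>y $ j\<bar>)) = \<bar>y $ k\<bar>" by blast
  have le: "\<bar>y $ j\<bar> \<le> \<bar>y $ k\<bar>" for j unfolding k[symmetric] by (rule Max_ge) auto
  have "norm y \<le> (\<Sum>j\<in>UNIV. \<bar>y $ j\<bar>)" by (rule norm_le_l1_cart)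
  also have "\<dots> \<le> real CARD('r) * \<bar>y $ k\<bar>" using sum_bounded_above[of UNIV "\<lambda>j. \<bar>y $ j\<bar>"] le by auto
  finally have "\<rho> * norm y \<le> \<rho> * (real CARD('r) * \<bar>y $ k\<bar>)" using assms by (intro mult_left_mono) auto
  then have "exp (\<rho> * norm y) \<le> exp (real CARD('r) * \<rho> * \<bar>y $ k\<bar>)" by (simp add: mult_ac)
  also have "\<dots> \<le> exp (real CARD('r) * \<rho> * y $ k) + exp (- (real CARD('r) * \<rho> * y $ k))"
    by (auto simp: abs_if)
  also have "\<dots> \<le> (\<Sum>j\<in>UNIV. exp (real CARD('r) * \<rho> * y $ j) + exp (- (real CARD('r) * \<rho> * y $ j)))"
    by (rule member_le_sum) (auto intro: add_nonneg_nonneg)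
  finally show ?thesis .
qed

lemma abs_exp_remainder_le: "\<bar>exp x - 1 - x\<bar> \<le> x\<^sup>2 / 2 * exp \<bar>x\<bar>" for x :: real
proof -
  obtain t where t: "\<bar>t\<bar> \<le> \<bar>x\<bar>" "exp x = (\<Sum>m<2. x ^ m / fact m) + exp t / fact 2 * x\<^sup>2"
    using Maclaurin_exp_le[of x 2] by blast
  have "exp x - 1 - x = x\<^sup>2 / 2 * exp t" using t(2) by (simp add: numeral_2_eq_2 field_simps)
  moreover have "x\<^sup>2 / 2 * exp t \<le> x\<^sup>2 / 2 * exp \<bar>x\<bar>" using t(1) by (intro mult_left_mono) auto
  ultimately show ?thesis by (simp only:) (simp add: abs_mult)
qed

locale exponential_family =
  fixes \<nu> :: "(real^'r) measure" and b :: "real^'r \<Rightarrow> real"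
  assumes sets_\<nu>[measurable_cong]: "sets \<nu> = sets borel"
    and b_measurable[measurable]: "b \<in> borel_measurable borel"
begin

text \<open>
  Up to the factor \<open>tilted (\<lambda>y. 1) \<theta>\<close>, \<open>tilted h \<theta>\<close> is the expectation of \<open>h y\<close> under the density
  with parameter \<open>\<theta>\<close>.
\<close>

definition tilted :: "(real^'r \<Rightarrow> real) \<Rightarrow> real^'r \<Rightarrow> real" where
  "tilted h \<theta> = (\<integral>y. h y * exp (y \<bullet> \<theta> + b y) \<partial>\<nu>)"

text \<open>\<open>U\<close> is an open set where room to shift the parameter is wanted, and a
  singleton where one expectation is at stake.\<close>

definition tilted_integrable :: "(real^'r) set \<Rightarrow> (real^'r \<Rightarrow> real) \<Rightarrow> bool" where
  "tilted_integrable U h \<longleftrightarrow> h \<in> borel_measurable borel \<and>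
     (\<forall>\<theta>\<in>U. integrable \<nu> (\<lambda>y. h y * exp (y \<bullet> \<theta> + b y)))"

text \<open>Openness allows moving \<open>\<theta>\<close> by \<open>r\<close> in both directions
  along every axis; these finitely many shifts dominate the weight
  \<open>exp (\<rho> * norm y)\<close>.\<close>

lemma tilted_integrable_exp_norm:
  assumes U: "open U" "\<theta> \<in> U" and h: "tilted_integrable U h"
  shows "\<exists>\<rho>>0. integrable \<nu> (\<lambda>y. h y * exp (y \<bullet> \<theta> + b y) * exp (\<rho> * norm y))"
proof -
  have [measurable]: "h \<in> borel_measurable borel" using h by (simp add: tilted_integrable_def)
  obtain r where r: "r > 0" "cball \<theta> r \<subseteq> U" using U open_contains_cball by blast
  \<comment> \<open>Makes the shifts in \<open>exp_norm_le_sum_exp_component\<close> have length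
    exactly \<open>r\<close>.\<close>
  define \<rho> where "\<rho> = r / real CARD('r)"
  have \<rho>: "\<rho> > 0" "real CARD('r) * \<rho> = r" using r by (auto simp: \<rho>_def)
  have int: "integrable \<nu> (\<lambda>y. h y * exp (y \<bullet> (\<theta> + c *\<^sub>R axis j 1) + b y))" if "\<bar>c\<bar> \<le> r" for c j
    using h r that by (auto simp: tilted_integrable_def dist_norm norm_axis_1 subset_iff)
  let ?g = "\<lambda>y. \<Sum>j\<in>UNIV. \<bar>h y * exp (y \<bullet> (\<theta> + r *\<^sub>R axis j 1) + b y)\<bar> +
      \<bar>h y * exp (y \<bullet> (\<theta> + (- r) *\<^sub>R axis j 1) + b y)\<bar>"
  have "integrable \<nu> (\<lambda>y. h y * exp (y \<bullet> \<theta> + b y) * exp (\<rho> * norm y))"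
  proof (rule Bochner_Integration.integrable_bound[of _ ?g])
    show "integrable \<nu> ?g"
      using r by (intro Bochner_Integration.integrable_sum Bochner_Integration.integrable_add
          integrable_abs int) auto
    show "(\<lambda>y. h y * exp (y \<bullet> \<theta> + b y) * exp (\<rho> * norm y)) \<in> borel_measurable \<nu>" by measurable
    have "norm (h y * exp (y \<bullet> \<theta> + b y) * exp (\<rho> * norm y)) \<le> ?g y" for y
    proof -
      have "norm (h y * exp (y \<bullet> \<theta> + b y) * exp (\<rho> * norm y))
        = \<bar>h y\<bar> * exp (y \<bullet> \<theta> + b y) * exp (\<rho> * norm y)" by (simp add: abs_mult)
      also have "\<dots> \<le> \<bar>h y\<bar> * exp (y \<bullet> \<theta> + b y) * (\<Sum>j\<in>UNIV. exp (r * y $ j) + exp (- (r * y $ j)))"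
        using exp_norm_le_sum_exp_component[of \<rho> y] \<rho> by (intro mult_left_mono) auto
      also have "\<dots> = ?g y"
      proof -
        have "\<bar>h y * exp (y \<bullet> (\<theta> + c *\<^sub>R axis j 1) + b y)\<bar> = \<bar>h y\<bar> * exp (y \<bullet> \<theta> + b y) * exp (c * y $ j)" for c j
          by (simp add: abs_mult inner_add_right inner_axis mult.assoc add_ac flip: exp_add)
        then show ?thesis by (simp only: sum_distrib_left) (simp add: distrib_left)
      qed
      finally show ?thesis .
    qed
    then show "AE y in \<nu>. norm (h y * exp (y \<bullet> \<theta> + b y) * exp (\<rho> * norm y)) \<le> norm (?g y)"
      by (auto intro!: AE_I2 order_trans[OF _ abs_ge_self])
  qed
  with \<rho> show ?thesis by blast
qed

text \<open>A coordinate is at most \<open>exp (\<rho> * norm y) / \<rho>\<close>, so the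
  exponential slack absorbs it. Since \<open>U\<close> is kept, the lemma can be iterated to reach
  higher moments.\<close>

lemma tilted_integrable_component:
  assumes U: "open U" and h: "tilted_integrable U h"
  shows "tilted_integrable U (\<lambda>y. h y * y $ j)"
  unfolding tilted_integrable_def
proof safe
  have [measurable]: "h \<in> borel_measurable borel" using h by (simp add: tilted_integrable_def)
  show "(\<lambda>y. h y * y $ j) \<in> borel_measurable borel" by measurable
  fix \<theta> assume "\<theta> \<in> U"
  then obtain \<rho> where \<rho>: "\<rho> > 0" "integrable \<nu> (\<lambda>y. h y * exp (y \<bullet> \<theta> + b y) * exp (\<rho> * norm y))"
    using tilted_integrable_exp_norm[OF U _ h] by blast
  show "integrable \<nu> (\<lambda>y. h y * y $ j * exp (y \<bullet> \<theta> + b y))"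
  proof (rule Bochner_Integration.integrable_bound)
    show "integrable \<nu> (\<lambda>y. (1 / \<rho>) * (h y * exp (y \<bullet> \<theta> + b y) * exp (\<rho> * norm y)))"
      using \<rho> by simp
    show "(\<lambda>y. h y * y $ j * exp (y \<bullet> \<theta> + b y)) \<in> borel_measurable \<nu>" by measurable
    have "norm (h y * y $ j * exp (y \<bullet> \<theta> + b y))
      \<le> norm ((1 / \<rho>) * (h y * exp (y \<bullet> \<theta> + b y) * exp (\<rho> * norm y)))" for y
    proof -
      have "\<rho> * \<bar>y $ j\<bar> \<le> \<rho> * norm y" using \<rho> component_le_norm_cart by (intro mult_left_mono) auto
      also have "\<dots> \<le> exp (\<rho> * norm y)" using exp_ge_add_one_self[of "\<rho> * norm y"] by linarith
      finally have "\<bar>y $ j\<bar> \<le> (1 / \<rho>) * exp (\<rho> * norm y)" using \<rho> by (simp add: field_simps)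
      then have "\<bar>h y\<bar> * exp (y \<bullet> \<theta> + b y) * \<bar>y $ j\<bar>
        \<le> \<bar>h y\<bar> * exp (y \<bullet> \<theta> + b y) * ((1 / \<rho>) * exp (\<rho> * norm y))"
        by (intro mult_left_mono) auto
      then show ?thesis using \<rho> by (simp add: abs_mult mult_ac)
    qed
    then show "AE y in \<nu>. norm (h y * y $ j * exp (y \<bullet> \<theta> + b y))
      \<le> norm ((1 / \<rho>) * (h y * exp (y \<bullet> \<theta> + b y) * exp (\<rho> * norm y)))" by simp
  qed
qed

text \<open>Differentiation under the integral: the second-order remainder of the exponential is
  dominated by an integrable function times \<open>(norm d)\<^sup>2\<close>.\<close>

lemma has_derivative_tilted:
  assumes U: "open U" "\<theta> \<in> U" and h: "tilted_integrable U h"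
  shows "(tilted h has_derivative (\<lambda>d. \<Sum>j\<in>UNIV. d $ j * tilted (\<lambda>y. h y * y $ j) \<theta>)) (at \<theta>)"
proof -
  have [measurable]: "h \<in> borel_measurable borel" using h by (simp add: tilted_integrable_def)
  obtain \<rho> where \<rho>: "\<rho> > 0" and int\<rho>: "integrable \<nu> (\<lambda>y. h y * exp (y \<bullet> \<theta> + b y) * exp (\<rho> * norm y))"
    using tilted_integrable_exp_norm[OF U h] by blast
  obtain r where r: "r > 0" "cball \<theta> r \<subseteq> U" using U open_contains_cball by blast
  let ?E = "\<lambda>y. exp (y \<bullet> \<theta> + b y)"
  define I where "I = (\<integral>y. \<bar>h y * ?E y * exp (\<rho> * norm y)\<bar> \<partial>\<nu>)"
  have int_h: "integrable \<nu> (\<lambda>y. h y * exp (y \<bullet> \<theta>' + b y))" if "\<theta>' \<in> U" for \<theta>'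
    using h that by (simp add: tilted_integrable_def)
  have int_hj: "integrable \<nu> (\<lambda>y. h y * y $ j * ?E y)" for j
    using tilted_integrable_component[OF U(1) h, of j] U(2) by (simp add: tilted_integrable_def)
  show ?thesis
  proof (rule has_derivative_quadratic_remainder)
    show "bounded_linear (\<lambda>d. \<Sum>j\<in>UNIV. d $ j * tilted (\<lambda>y. h y * y $ j) \<theta>)"
      by (intro bounded_linear_sum bounded_linear_mult_const bounded_linear_vec_nth)
    show "min r (\<rho> / 2) > 0" using r \<rho> by simp
    fix d :: "real^'r" assume d: "norm d \<le> min r (\<rho> / 2)"
    have d': "\<theta> + d \<in> U" using d r by (auto simp: dist_norm subset_iff)
    have D: "(\<Sum>j\<in>UNIV. d $ j * tilted (\<lambda>y. h y * y $ j) \<theta>) = (\<integral>y. h y * ?E y * (y \<bullet> d) \<partial>\<nu>)"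
      and intD: "integrable \<nu> (\<lambda>y. h y * ?E y * (y \<bullet> d))"
    proof -
      have eq: "(\<lambda>y. h y * ?E y * (y \<bullet> d)) = (\<lambda>y. \<Sum>j\<in>UNIV. d $ j * (h y * y $ j * ?E y))"
      proof
        fix y
        have "y \<bullet> d = (\<Sum>j\<in>UNIV. y $ j * d $ j)" by (simp add: inner_vec_def)
        then show "h y * ?E y * (y \<bullet> d) = (\<Sum>j\<in>UNIV. d $ j * (h y * y $ j * ?E y))"
          by (simp only: sum_distrib_left) (simp add: mult_ac)
      qed
      show "integrable \<nu> (\<lambda>y. h y * ?E y * (y \<bullet> d))" unfolding eq using int_hj by simp
      show "(\<Sum>j\<in>UNIV. d $ j * tilted (\<lambda>y. h y * y $ j) \<theta>) = (\<integral>y. h y * ?E y * (y \<bullet> d) \<partial>\<nu>)"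
        unfolding eq tilted_def using int_hj by (subst Bochner_Integration.integral_sum) auto
    qed
    have exp_add': "exp (y \<bullet> (\<theta> + d) + b y) = ?E y * exp (y \<bullet> d)" for y
      by (simp add: inner_add_right add_ac flip: exp_add)
    have rem: "tilted h (\<theta> + d) - tilted h \<theta> - (\<Sum>j\<in>UNIV. d $ j * tilted (\<lambda>y. h y * y $ j) \<theta>)
      = (\<integral>y. h y * ?E y * (exp (y \<bullet> d) - 1 - y \<bullet> d) \<partial>\<nu>)"
    proof -
      have "(\<lambda>y. h y * ?E y * (exp (y \<bullet> d) - 1 - y \<bullet> d))
        = (\<lambda>y. h y * (?E y * exp (y \<bullet> d)) - h y * ?E y - h y * ?E y * (y \<bullet> d))"
        by (auto simp: algebra_simps)
      then show ?thesis
        using int_h[OF d'] int_h[OF U(2)] intD unfolding tilted_def exp_add'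
        by (simp add: D[unfolded tilted_def])
    qed
    have bound: "norm (h y * ?E y * (exp (y \<bullet> d) - 1 - y \<bullet> d))
      \<le> 4 / \<rho>\<^sup>2 * (norm d)\<^sup>2 * \<bar>h y * ?E y * exp (\<rho> * norm y)\<bar>" for y
    proof -
      \<comment> \<open>Only half of the slack \<open>\<rho>\<close> goes to each factor: one
        \<open>exp z\<close> bounds the exponential in the remainder, another bounds
        \<open>z\<^sup>2 / 2\<close>, and their product is
        \<open>exp (\<rho> * norm y)\<close>.\<close>
      define z where "z = \<rho> * norm y / 2"
      have z: "z \<ge> 0" using \<rho> by (simp add: z_def)
      have yd: "\<bar>y \<bullet> d\<bar> \<le> norm y * norm d" by (rule Cauchy_Schwarz_ineq2)
      also have "\<dots> \<le> norm y * (\<rho> / 2)" using d by (intro mult_left_mono) auto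
      finally have ydz: "\<bar>y \<bullet> d\<bar> \<le> z" by (simp add: z_def mult.commute)
      have "\<bar>exp (y \<bullet> d) - 1 - y \<bullet> d\<bar> \<le> (y \<bullet> d)\<^sup>2 / 2 * exp \<bar>y \<bullet> d\<bar>" by (rule abs_exp_remainder_le)
      also have "\<dots> \<le> (norm y * norm d)\<^sup>2 / 2 * exp z"
        using power_mono[OF yd, of 2] ydz by (intro mult_mono) auto
      also have "(norm y * norm d)\<^sup>2 / 2 = 4 / \<rho>\<^sup>2 * (norm d)\<^sup>2 * (z\<^sup>2 / 2)"
        using \<rho> by (simp add: z_def field_simps)
      also have "4 / \<rho>\<^sup>2 * (norm d)\<^sup>2 * (z\<^sup>2 / 2) * exp z \<le> 4 / \<rho>\<^sup>2 * (norm d)\<^sup>2 * exp z * exp z"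
        using exp_lower_Taylor_quadratic[OF z] z by (intro mult_left_mono mult_right_mono) auto
      also have "\<dots> = 4 / \<rho>\<^sup>2 * (norm d)\<^sup>2 * exp (\<rho> * norm y)"
        by (simp add: z_def mult.assoc flip: exp_add)
      finally have "\<bar>h y * ?E y\<bar> * \<bar>exp (y \<bullet> d) - 1 - y \<bullet> d\<bar>
        \<le> \<bar>h y * ?E y\<bar> * (4 / \<rho>\<^sup>2 * (norm d)\<^sup>2 * exp (\<rho> * norm y))" by (intro mult_left_mono) auto
      then show ?thesis by (simp add: abs_mult mult_ac)
    qed
    have "\<bar>\<integral>y. h y * ?E y * (exp (y \<bullet> d) - 1 - y \<bullet> d) \<partial>\<nu>\<bar>
      \<le> (\<integral>y. 4 / \<rho>\<^sup>2 * (norm d)\<^sup>2 * \<bar>h y * ?E y * exp (\<rho> * norm y)\<bar> \<partial>\<nu>)"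
      unfolding real_norm_def[symmetric]
    proof (rule Bochner_Integration.integral_norm_bound_integral)
      show int: "integrable \<nu> (\<lambda>y. 4 / \<rho>\<^sup>2 * (norm d)\<^sup>2 * norm (h y * ?E y * exp (\<rho> * norm y)))"
        using int\<rho> by (intro integrable_mult_right integrable_norm)
      show "integrable \<nu> (\<lambda>y. h y * ?E y * (exp (y \<bullet> d) - 1 - y \<bullet> d))"
        by (rule Bochner_Integration.integrable_bound[OF int]) (use bound in \<open>auto intro!: AE_I2 simp: abs_mult\<close>)
    qed (use bound in auto)
    also have "\<dots> = 4 / \<rho>\<^sup>2 * I * (norm d)\<^sup>2" by (simp add: I_def)
    finally show "\<bar>tilted h (\<theta> + d) - tilted h \<theta> - (\<Sum>j\<in>UNIV. d $ j * tilted (\<lambda>y. h y * y $ j) \<theta>)\<bar>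
      \<le> 4 / \<rho>\<^sup>2 * I * (norm d)\<^sup>2" unfolding rem .
  qed
qed

definition interior_parameters :: "(real^'r) set" where
  "interior_parameters = interior (natural_parameter_space \<nu> b)"

text \<open>Written as a quotient of \<open>tilted\<close> integrals, so that the quotient rule
  gives its derivative; for the covariance likewise.\<close>

definition mean :: "real^'r \<Rightarrow> real^'r" where
  "mean \<theta> = (\<chi> i. tilted (\<lambda>y. y $ i) \<theta> / tilted (\<lambda>y. 1) \<theta>)"

definition covariance :: "real^'r \<Rightarrow> real^'r^'r" where
  "covariance \<theta> = (\<chi> i j. tilted (\<lambda>y. y $ i * y $ j) \<theta> / tilted (\<lambda>y. 1) \<theta> - mean \<theta> $ i * mean \<theta> $ j)"

lemma open_interior_parameters: "open interior_parameters"
  by (simp add: interior_parameters_def)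

lemma tilted_integrable_moments:
  "tilted_integrable interior_parameters (\<lambda>y. 1)"
  "tilted_integrable interior_parameters (\<lambda>y. y $ i)"
  "tilted_integrable interior_parameters (\<lambda>y. y $ i * y $ j)"
proof -
  show 0: "tilted_integrable interior_parameters (\<lambda>y. 1)"
    unfolding tilted_integrable_def
  proof safe
    fix \<theta> assume "\<theta> \<in> interior_parameters"
    then have "\<theta> \<in> natural_parameter_space \<nu> b" using interior_subset by (auto simp: interior_parameters_def)
    then have "(\<integral>\<^sup>+ y. ennreal (exp (y \<bullet> \<theta> + b y)) \<partial>\<nu>) < \<infinity>" by (simp add: natural_parameter_space_def)
    then show "integrable \<nu> (\<lambda>y. 1 * exp (y \<bullet> \<theta> + b y))"
      by (intro integrableI_nonneg) auto
  qed simp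
  show 1: "tilted_integrable interior_parameters (\<lambda>y. y $ i)" for i
    using tilted_integrable_component[OF open_interior_parameters 0] by simp
  show "tilted_integrable interior_parameters (\<lambda>y. y $ i * y $ j)"
    by (rule tilted_integrable_component[OF open_interior_parameters 1])
qed

lemma tilted_one_pos:
  assumes "\<theta> \<in> interior_parameters"
  shows "tilted (\<lambda>y. 1) \<theta> > 0"
proof -
  have \<theta>: "\<theta> \<in> natural_parameter_space \<nu> b"
    using assms interior_subset by (auto simp: interior_parameters_def)
  have "integrable \<nu> (\<lambda>y. exp (y \<bullet> \<theta> + b y))"
    using tilted_integrable_moments(1) assms by (simp add: tilted_integrable_def)
  then have "(\<integral>\<^sup>+ y. ennreal (exp (y \<bullet> \<theta> + b y)) \<partial>\<nu>) = ennreal (tilted (\<lambda>y. 1) \<theta>)"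
    by (simp add: tilted_def nn_integral_eq_integral)
  then show ?thesis using \<theta> by (simp add: natural_parameter_space_def)
qed

lemma log_partition_tilted: "log_partition \<nu> b \<theta> = ln (tilted (\<lambda>y. 1) \<theta>)"
  by (simp add: log_partition_def tilted_def)

lemma has_derivative_tilted_moments:
  assumes "\<theta> \<in> interior_parameters"
  shows "(tilted (\<lambda>y. 1) has_derivative (\<lambda>d. \<Sum>j\<in>UNIV. d $ j * tilted (\<lambda>y. y $ j) \<theta>)) (at \<theta>)"
    and "(tilted (\<lambda>y. y $ i) has_derivative (\<lambda>d. \<Sum>j\<in>UNIV. d $ j * tilted (\<lambda>y. y $ i * y $ j) \<theta>)) (at \<theta>)"
    and "isCont (tilted (\<lambda>y. y $ i * y $ j)) \<theta>"
  using has_derivative_tilted[OF open_interior_parameters assms tilted_integrable_moments(1)]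
    has_derivative_tilted[OF open_interior_parameters assms tilted_integrable_moments(2)]
    has_derivative_continuous[OF has_derivative_tilted[OF open_interior_parameters assms tilted_integrable_moments(3)]]
  by auto

lemma has_derivative_log_partition:
  assumes \<theta>: "\<theta> \<in> interior_parameters"
  shows "(log_partition \<nu> b has_derivative (\<lambda>d. mean \<theta> \<bullet> d)) (at \<theta>)"
proof -
  have "((\<lambda>\<theta>. ln (tilted (\<lambda>y. 1) \<theta>)) has_derivative
      (\<lambda>d. (\<Sum>j\<in>UNIV. d $ j * tilted (\<lambda>y. y $ j) \<theta>) * inverse (tilted (\<lambda>y. 1) \<theta>))) (at \<theta>)"
    using has_derivative_ln[OF tilted_one_pos[OF \<theta>] has_derivative_tilted_moments(1)[OF \<theta>]]
    by (simp add: mult.commute divide_inverse)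
  moreover have "(\<Sum>j\<in>UNIV. d $ j * tilted (\<lambda>y. y $ j) \<theta>) * inverse (tilted (\<lambda>y. 1) \<theta>) = mean \<theta> \<bullet> d" for d
    by (simp add: mean_def inner_vec_def sum_distrib_left sum_distrib_right divide_inverse mult_ac)
  ultimately show ?thesis by (simp add: log_partition_tilted[abs_def])
qed

lemma gradient_log_partition:
  assumes \<theta>: "\<theta> \<in> interior_parameters"
  shows "gradient (log_partition \<nu> b) \<theta> = mean \<theta>"
  unfolding gradient_def frechet_derivative_at[OF has_derivative_log_partition[OF \<theta>], symmetric]
  by (simp add: inner_axis vec_eq_iff)

lemma has_derivative_mean:
  assumes \<theta>: "\<theta> \<in> interior_parameters"
  shows "(mean has_derivative (\<lambda>d. covariance \<theta> *v d)) (at \<theta>)"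
  unfolding has_derivative_componentwise_within[of mean]
proof safe
  fix x :: "real^'r" assume "x \<in> Basis"
  then obtain i where x: "x = axis i 1" by (auto simp: Basis_vec_def)
  note D = has_derivative_divide[OF has_derivative_tilted_moments(2)[OF \<theta>]
      has_derivative_tilted_moments(1)[OF \<theta>] less_imp_neq[OF tilted_one_pos[OF \<theta>], symmetric]]
  have "((\<lambda>\<theta>. tilted (\<lambda>y. y $ i) \<theta> / tilted (\<lambda>y. 1) \<theta>) has_derivative (\<lambda>d. (covariance \<theta> *v d) $ i)) (at \<theta>)"
  proof (rule has_derivative_eq_rhs[OF D], rule ext)
    fix d :: "real^'r"
    let ?Z = "tilted (\<lambda>y. 1) \<theta>"
    have "(covariance \<theta> *v d) $ i = (\<Sum>j\<in>UNIV. d $ j * tilted (\<lambda>y. y $ i * y $ j) \<theta> / ?Z -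
        tilted (\<lambda>y. y $ i) \<theta> * (inverse ?Z * (d $ j * tilted (\<lambda>y. y $ j) \<theta>) * inverse ?Z))"
      by (simp add: matrix_vector_mult_def covariance_def mean_def divide_inverse algebra_simps)
    then show "- tilted (\<lambda>y. y $ i) \<theta> *
          (inverse ?Z * (\<Sum>j\<in>UNIV. d $ j * tilted (\<lambda>y. y $ j) \<theta>) * inverse ?Z) +
          (\<Sum>j\<in>UNIV. d $ j * tilted (\<lambda>y. y $ i * y $ j) \<theta>) / ?Z = (covariance \<theta> *v d) $ i"
      by (simp add: sum_subtractf sum_negf sum_distrib_left sum_distrib_right sum_divide_distrib)
  qed
  then show "((\<lambda>\<theta>. mean \<theta> \<bullet> x) has_derivative (\<lambda>d. (covariance \<theta> *v d) \<bullet> x)) (at \<theta>)"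
    by (simp add: x inner_axis mean_def)
qed

text \<open>The gradient is known to equal \<open>mean\<close> only on the interior parameters; as
  this set is open, the derivative transfers.\<close>

lemma hessian_log_partition:
  assumes \<theta>: "\<theta> \<in> interior_parameters"
  shows "hessian (log_partition \<nu> b) \<theta> = covariance \<theta>"
proof -
  have "(gradient (log_partition \<nu> b) has_derivative (\<lambda>d. covariance \<theta> *v d)) (at \<theta>)"
    using gradient_log_partition
    by (intro has_derivative_transform_within_open[OF has_derivative_mean[OF \<theta>] open_interior_parameters \<theta>])
      simp
  then show ?thesis
    unfolding hessian_def jacobian_def by (simp flip: frechet_derivative_at)
qed

lemma continuous_on_covariance: "continuous_on interior_parameters covariance"
proof -
  have "continuous_on interior_parameters (tilted (\<lambda>y. 1))"
    using has_derivative_continuous[OF has_derivative_tilted_moments(1)]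
    by (intro continuous_at_imp_continuous_on) auto
  moreover have "continuous_on interior_parameters (tilted (\<lambda>y. y $ i))" for i
    using has_derivative_continuous[OF has_derivative_tilted_moments(2)]
    by (intro continuous_at_imp_continuous_on) auto
  moreover have "continuous_on interior_parameters (tilted (\<lambda>y. y $ i * y $ j))" for i j
    using has_derivative_tilted_moments(3)
    by (intro continuous_at_imp_continuous_on) auto
  moreover have "tilted (\<lambda>y. 1) \<theta> \<noteq> 0" if "\<theta> \<in> interior_parameters" for \<theta>
    using tilted_one_pos[OF that] by simp
  ultimately show ?thesis
    unfolding covariance_def mean_def by (auto intro!: continuous_intros)
qed

end

section \<open>Regression with natural link\<close>

text \<open>\<open>norm A\<close> is here the Frobenius norm; the bound is Cauchy-Schwarz in each
  row.\<close>

lemma norm_matrix_vector_mult_le: "norm (A *v x) \<le> norm A * norm x" for A :: "real^'n^'m"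
proof -
  have "norm (A *v x) = L2_set (\<lambda>i. norm ((A *v x) $ i)) UNIV" by (simp add: norm_vec_def)
  also have "\<dots> \<le> L2_set (\<lambda>i. norm (A $ i) * norm x) UNIV"
    by (rule L2_set_mono) (auto simp: matrix_vector_mul_component Cauchy_Schwarz_ineq2)
  also have "\<dots> = norm A * norm x" by (simp add: norm_vec_def L2_set_left_distrib)
  finally show ?thesis .
qed

lemma abs_quadratic_form_le: "\<bar>x \<bullet> (A *v x)\<bar> \<le> norm A * (norm x)\<^sup>2" for A :: "real^'n^'n"
proof -
  have "\<bar>x \<bullet> (A *v x)\<bar> \<le> norm x * norm (A *v x)" by (rule Cauchy_Schwarz_ineq2)
  also have "\<dots> \<le> norm x * (norm A * norm x)"
    by (intro mult_left_mono norm_matrix_vector_mult_le) auto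
  finally show ?thesis by (simp add: power2_eq_square mult_ac)
qed

lemma quadratic_form_sum: "x \<bullet> ((\<Sum>i<n. A i) *v x) = (\<Sum>i<n. x \<bullet> (A i *v x))"
  for A :: "nat \<Rightarrow> real^'n^'n"
  by (induction n) (simp_all add: matrix_vector_mult_add_rdistrib inner_add_right)

lemma quadratic_form_congruence:
  "x \<bullet> ((transpose A ** C ** A) *v x) = (A *v x) \<bullet> (C *v (A *v x))"
  for A :: "real^'p^'r" and C :: "real^'r^'r"
proof -
  have "x \<bullet> ((transpose A ** C ** A) *v x) = x \<bullet> (transpose A *v (C *v (A *v x)))"
    by (simp add: matrix_vector_mul_assoc matrix_mul_assoc)
  also have "\<dots> = (x v* transpose A) \<bullet> (C *v (A *v x))" by (simp only: dot_lmul_matrix)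
  finally show ?thesis by simp
qed

context exponential_family
begin

text \<open>Restriction to the segment reduces this to the one-variable Lagrange remainder of order
  two.\<close>

lemma log_partition_Taylor:
  assumes seg: "\<And>t. 0 \<le> t \<Longrightarrow> t \<le> 1 \<Longrightarrow> \<theta> + t *\<^sub>R h \<in> interior_parameters"
  shows "\<exists>t. 0 < t \<and> t < 1 \<and> log_partition \<nu> b (\<theta> + h) =
    log_partition \<nu> b \<theta> + mean \<theta> \<bullet> h + (h \<bullet> (covariance (\<theta> + t *\<^sub>R h) *v h)) / 2"
proof -
  \<comment> \<open>The derivatives of orders 0, 1 and 2 along the segment, as the Maclaurin theorem
    requires; the last branch is evaluated at order 2 only.\<close>
  define D where "D = (\<lambda>m::nat. if m = 0 then (\<lambda>t. log_partition \<nu> b (\<theta> + t *\<^sub>R h))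
    else if m = 1 then (\<lambda>t. mean (\<theta> + t *\<^sub>R h) \<bullet> h)
    else (\<lambda>t. h \<bullet> (covariance (\<theta> + t *\<^sub>R h) *v h)))"
  have line: "((\<lambda>t. \<theta> + t *\<^sub>R h) has_derivative (\<lambda>s. s *\<^sub>R h)) (at t)" for t
    by (auto intro!: derivative_eq_intros)
  have "DERIV (D m) t :> D (Suc m) t" if "m < 2" "0 \<le> t" "t \<le> 1" for m t
  proof (cases "m = 0")
    case True
    have "((\<lambda>t. log_partition \<nu> b (\<theta> + t *\<^sub>R h)) has_derivative (\<lambda>s. mean (\<theta> + t *\<^sub>R h) \<bullet> (s *\<^sub>R h))) (at t)"
      by (rule has_derivative_compose[OF line has_derivative_log_partition[OF seg[OF that(2,3)]]])
    then show ?thesis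
      using True by (auto simp: D_def intro!: has_derivative_imp_has_field_derivative)
  next
    case False
    then have m: "m = 1" using that by simp
    have "((\<lambda>t. mean (\<theta> + t *\<^sub>R h)) has_derivative (\<lambda>s. covariance (\<theta> + t *\<^sub>R h) *v (s *\<^sub>R h))) (at t)"
      by (rule has_derivative_compose[OF line has_derivative_mean[OF seg[OF that(2,3)]]])
    then have "((\<lambda>t. mean (\<theta> + t *\<^sub>R h) \<bullet> h) has_derivative
        (\<lambda>s. (covariance (\<theta> + t *\<^sub>R h) *v (s *\<^sub>R h)) \<bullet> h)) (at t)"
      by (rule has_derivative_inner_left)
    then show ?thesis
      using m by (auto simp: D_def inner_commute matrix_vector_mult_scaleR
          intro!: has_derivative_imp_has_field_derivative)
  qed
  then have "\<exists>t. 0 < t \<and> t < 1 \<and> D 0 1 = (\<Sum>m<2. D m 0 / fact m * 1 ^ m) + D 2 t / fact 2 * 1 ^ 2"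
    by (intro Maclaurin[of 1 2 D "D 0"]) auto
  then show ?thesis by (simp add: D_def numeral_2_eq_2)
qed

end

text \<open>\<open>J\<close> stands for the integral of the Fisher summands at
  \<open>\<beta>s\<close> against the invariant distribution.\<close>

locale natural_link_regression = exponential_family \<nu> b
  for \<nu> :: "(real^'r) measure" and b :: "real^'r \<Rightarrow> real" +
  fixes \<X> :: "(real^'p^'r) set" and X :: "nat \<Rightarrow> real^'p^'r" and B :: "(real^'p) set"
    and \<beta>s :: "real^'p" and J :: "real^'p^'p"
  assumes hessian_pos_def: "\<theta> \<in> interior_parameters \<Longrightarrow> pos_def (hessian (log_partition \<nu> b) \<theta>)"
    and open_B: "open B" and convex_B: "convex B" and \<beta>s_in_B: "\<beta>s \<in> B"
    and X_in: "X i \<in> \<X>" and compact_X: "compact \<X>"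
    and predictor_interior: "A \<in> \<X> \<Longrightarrow> \<beta> \<in> B \<Longrightarrow> A *v \<beta> \<in> interior_parameters"
    and J_pos_def: "pos_def J"
    and fisher_tendsto: "(\<lambda>n. (1 / real n) *\<^sub>R (\<Sum>i<n. fisher_summand \<nu> b \<beta>s (X i))) \<longlonglongrightarrow> J"
begin

definition mean_fisher :: "nat \<Rightarrow> real^'p^'p" where
  "mean_fisher n = (1 / real n) *\<^sub>R (\<Sum>i<n. fisher_summand \<nu> b \<beta>s (X i))"

text \<open>
  The objective is \<open>excess\<close> plus a linear term in the score plus the penalty. As
  \<open>exp (excess n (\<beta>s + t / sqrt n))\<close> is also the moment generating function of the score at \<open>t\<close>, one
  quadratic bound on \<open>excess\<close> controls both the estimator and the moments.
\<close>

definition excess :: "nat \<Rightarrow> real^'p \<Rightarrow> real" where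
  "excess n \<beta> = (\<Sum>i<n. log_partition \<nu> b (X i *v \<beta>) - log_partition \<nu> b (X i *v \<beta>s)
     - mean (X i *v \<beta>s) \<bullet> (X i *v (\<beta> - \<beta>s)))"

lemma fisher_quadratic_form:
  assumes "A \<in> \<X>" "\<beta> \<in> B"
  shows "x \<bullet> (fisher_summand \<nu> b \<beta> A *v x) = (A *v x) \<bullet> (covariance (A *v \<beta>) *v (A *v x))"
  using hessian_log_partition[OF predictor_interior[OF assms]]
  by (simp add: fisher_summand_def quadratic_form_congruence)

lemma fisher_nonneg:
  assumes "A \<in> \<X>" "\<beta> \<in> B"
  shows "0 \<le> x \<bullet> (fisher_summand \<nu> b \<beta> A *v x)"
proof -
  have "pos_def (covariance (A *v \<beta>))"
    using hessian_pos_def[OF predictor_interior[OF assms]]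
      hessian_log_partition[OF predictor_interior[OF assms]] by simp
  then show ?thesis
    unfolding fisher_quadratic_form[OF assms] pos_def_def by (cases "A *v x = 0") (auto intro: less_imp_le)
qed

lemma mean_fisher_quadratic_form:
  "real n * (x \<bullet> (mean_fisher n *v x)) = (\<Sum>i<n. x \<bullet> (fisher_summand \<nu> b \<beta>s (X i) *v x))"
  by (cases "n = 0") (simp_all add: mean_fisher_def quadratic_form_sum flip: scaleR_matrix_vector_assoc)

lemma predictor_Taylor:
  assumes A: "A \<in> \<X>" and \<beta>: "\<beta> \<in> B" "\<beta>' \<in> B"
  shows "\<exists>\<xi>\<in>closed_segment \<beta> \<beta>'. log_partition \<nu> b (A *v \<beta>') = log_partition \<nu> b (A *v \<beta>)
    + mean (A *v \<beta>) \<bullet> (A *v (\<beta>' - \<beta>)) + ((\<beta>' - \<beta>) \<bullet> (fisher_summand \<nu> b \<xi> A *v (\<beta>' - \<beta>))) / 2"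
proof -
  have eq: "A *v \<beta> + t *\<^sub>R (A *v (\<beta>' - \<beta>)) = A *v (\<beta> + t *\<^sub>R (\<beta>' - \<beta>))" for t
    by (simp add: matrix_vector_right_distrib matrix_vector_mult_scaleR)
  have seg: "\<beta> + t *\<^sub>R (\<beta>' - \<beta>) \<in> closed_segment \<beta> \<beta>'" if "0 \<le> t" "t \<le> 1" for t
    using that by (auto simp: closed_segment_def algebra_simps intro!: exI[of _ t])
  have inB: "\<beta> + t *\<^sub>R (\<beta>' - \<beta>) \<in> B" if "0 \<le> t" "t \<le> 1" for t
    using seg[OF that] closed_segment_subset[OF \<beta> convex_B] by blast
  have "\<exists>t. 0 < t \<and> t < 1 \<and> log_partition \<nu> b (A *v \<beta> + A *v (\<beta>' - \<beta>)) = log_partition \<nu> b (A *v \<beta>)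
    + mean (A *v \<beta>) \<bullet> (A *v (\<beta>' - \<beta>))
    + ((A *v (\<beta>' - \<beta>)) \<bullet> (covariance (A *v \<beta> + t *\<^sub>R (A *v (\<beta>' - \<beta>))) *v (A *v (\<beta>' - \<beta>)))) / 2"
    by (rule log_partition_Taylor) (simp add: eq predictor_interior A inB)
  then obtain t where t: "0 < t" "t < 1" and T: "log_partition \<nu> b (A *v \<beta> + A *v (\<beta>' - \<beta>)) =
    log_partition \<nu> b (A *v \<beta>) + mean (A *v \<beta>) \<bullet> (A *v (\<beta>' - \<beta>))
    + ((A *v (\<beta>' - \<beta>)) \<bullet> (covariance (A *v (\<beta> + t *\<^sub>R (\<beta>' - \<beta>))) *v (A *v (\<beta>' - \<beta>)))) / 2"
    unfolding eq by blast
  have "A *v \<beta> + A *v (\<beta>' - \<beta>) = A *v \<beta>'" by (simp add: matrix_vector_mult_diff_distrib)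
  with T have "log_partition \<nu> b (A *v \<beta>') =
    log_partition \<nu> b (A *v \<beta>) + mean (A *v \<beta>) \<bullet> (A *v (\<beta>' - \<beta>))
    + ((\<beta>' - \<beta>) \<bullet> (fisher_summand \<nu> b (\<beta> + t *\<^sub>R (\<beta>' - \<beta>)) A *v (\<beta>' - \<beta>))) / 2"
    using t by (simp add: fisher_quadratic_form A inB)
  then show ?thesis using seg[of t] t by (intro bexI[of _ "\<beta> + t *\<^sub>R (\<beta>' - \<beta>)"]) auto
qed

text \<open>The Taylor remainder is half a Fisher quadratic form at a point of \<open>B\<close>,
  hence nonnegative.\<close>

lemma gradient_inequality:
  assumes "A \<in> \<X>" "\<beta> \<in> B" "\<beta>' \<in> B"
  shows "log_partition \<nu> b (A *v \<beta>) + mean (A *v \<beta>) \<bullet> (A *v (\<beta>' - \<beta>)) \<le> log_partition \<nu> b (A *v \<beta>')"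
proof -
  obtain \<xi> where \<xi>: "\<xi> \<in> closed_segment \<beta> \<beta>'" "log_partition \<nu> b (A *v \<beta>') = log_partition \<nu> b (A *v \<beta>)
    + mean (A *v \<beta>) \<bullet> (A *v (\<beta>' - \<beta>)) + ((\<beta>' - \<beta>) \<bullet> (fisher_summand \<nu> b \<xi> A *v (\<beta>' - \<beta>))) / 2"
    using predictor_Taylor[OF assms] by blast
  have "\<xi> \<in> B" using \<xi>(1) closed_segment_subset[OF assms(2,3) convex_B] by blast
  then show ?thesis using fisher_nonneg[OF assms(1), of \<xi> "\<beta>' - \<beta>"] \<xi>(2) by simp
qed

lemma excess_nonneg:
  assumes "\<beta> \<in> B"
  shows "0 \<le> excess n \<beta>"
  unfolding excess_def
proof (rule sum_nonneg)
  fix i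
  show "0 \<le> log_partition \<nu> b (X i *v \<beta>) - log_partition \<nu> b (X i *v \<beta>s)
     - mean (X i *v \<beta>s) \<bullet> (X i *v (\<beta> - \<beta>s))"
    using gradient_inequality[OF X_in \<beta>s_in_B assms, of i] by simp
qed

lemma excess_self: "excess n \<beta>s = 0"
  by (simp add: excess_def)

text \<open>The tangent inequalities at the intermediate point \<open>z\<close>, weighted by
  \<open>1 - t\<close> and \<open>t\<close>, have slopes that cancel; the terms of
  \<open>excess\<close> linear in the parameter do not affect convexity.\<close>

lemma convex_on_excess: "convex_on B (excess n)"
proof (rule convex_onI)
  fix t :: real and x y assume t: "0 < t" "t < 1" and xy: "x \<in> B" "y \<in> B"
  define z where "z = (1 - t) *\<^sub>R x + t *\<^sub>R y"
  have z: "z \<in> B" unfolding z_def using convexD_alt[OF convex_B xy] t by simp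
  have conv: "log_partition \<nu> b (A *v z) \<le> (1 - t) * log_partition \<nu> b (A *v x) + t * log_partition \<nu> b (A *v y)"
    if "A \<in> \<X>" for A
  proof -
    define p where "p = mean (A *v z) \<bullet> (A *v (x - z))"
    define q where "q = mean (A *v z) \<bullet> (A *v (y - z))"
    have "(1 - t) * p + t * q = mean (A *v z) \<bullet> (A *v ((1 - t) *\<^sub>R (x - z) + t *\<^sub>R (y - z)))"
      unfolding p_def q_def
      by (simp only: matrix_vector_right_distrib matrix_vector_mult_scaleR inner_add_right inner_scaleR_right)
    also have "(1 - t) *\<^sub>R (x - z) + t *\<^sub>R (y - z) = 0" by (simp add: z_def algebra_simps)
    finally have 0: "(1 - t) * p + t * q = 0" by simp
    have "(1 - t) * (log_partition \<nu> b (A *v z) + p) + t * (log_partition \<nu> b (A *v z) + q)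
      \<le> (1 - t) * log_partition \<nu> b (A *v x) + t * log_partition \<nu> b (A *v y)"
      unfolding p_def q_def
      using t gradient_inequality[OF that z xy(1)] gradient_inequality[OF that z xy(2)]
      by (intro add_mono mult_left_mono) auto
    with 0 show ?thesis by (simp add: algebra_simps)
  qed
  have lin: "c \<bullet> (A *v (z - \<beta>s)) = (1 - t) * (c \<bullet> (A *v (x - \<beta>s))) + t * (c \<bullet> (A *v (y - \<beta>s)))"
    for A :: "real^'p^'r" and c
  proof -
    have "z - \<beta>s = (1 - t) *\<^sub>R (x - \<beta>s) + t *\<^sub>R (y - \<beta>s)" by (simp add: z_def algebra_simps)
    then show ?thesis
      by (simp only: matrix_vector_right_distrib matrix_vector_mult_scaleR inner_add_right inner_scaleR_right)
  qed
  have "excess n z \<le> (\<Sum>i<n. (1 - t) * (log_partition \<nu> b (X i *v x) - log_partition \<nu> b (X i *v \<beta>s)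
     - mean (X i *v \<beta>s) \<bullet> (X i *v (x - \<beta>s))) + t * (log_partition \<nu> b (X i *v y) - log_partition \<nu> b (X i *v \<beta>s)
     - mean (X i *v \<beta>s) \<bullet> (X i *v (y - \<beta>s))))"
    unfolding excess_def
  proof (rule sum_mono)
    fix i
    show "log_partition \<nu> b (X i *v z) - log_partition \<nu> b (X i *v \<beta>s)
     - mean (X i *v \<beta>s) \<bullet> (X i *v (z - \<beta>s)) \<le> (1 - t) * (log_partition \<nu> b (X i *v x) - log_partition \<nu> b (X i *v \<beta>s)
     - mean (X i *v \<beta>s) \<bullet> (X i *v (x - \<beta>s))) + t * (log_partition \<nu> b (X i *v y) - log_partition \<nu> b (X i *v \<beta>s)
     - mean (X i *v \<beta>s) \<bullet> (X i *v (y - \<beta>s)))"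
      using conv[OF X_in, of i] lin[of "mean (X i *v \<beta>s)" "X i"] by (simp add: right_diff_distrib left_diff_distrib)
  qed
  then show "excess n ((1 - t) *\<^sub>R x + t *\<^sub>R y) \<le> (1 - t) * excess n x + t * excess n y"
    by (simp add: z_def excess_def sum.distrib sum_distrib_left)
qed (rule convex_B)

lemma continuous_on_fisher_summand:
  assumes "K \<subseteq> \<X> \<times> B"
  shows "continuous_on K (\<lambda>p. fisher_summand \<nu> b (snd p) (fst p))"
proof -
  have mult: "continuous_on K (\<lambda>p. fst p *v snd p)"
    unfolding matrix_vector_mult_def by (auto intro!: continuous_intros)
  have cov: "continuous_on K (\<lambda>p. covariance (fst p *v snd p))"
    using assms predictor_interior by (intro continuous_on_compose2[OF continuous_on_covariance mult]) auto
  have "continuous_on K (\<lambda>p. transpose (fst p) ** covariance (fst p *v snd p) ** fst p)"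
    unfolding matrix_matrix_mult_def transpose_def by (auto intro!: continuous_intros cov)
  then show ?thesis
    using assms predictor_interior
    by (subst continuous_on_cong[OF refl, where g = "\<lambda>p. transpose (fst p) ** covariance (fst p *v snd p) ** fst p"])
      (auto simp: fisher_summand_def hessian_log_partition)
qed

text \<open>Joint continuity on the compact set of regressors times a closed ball is uniform, so one
  \<open>\<delta>\<close> serves all observations.\<close>

lemma fisher_summand_equicontinuous:
  assumes "\<epsilon> > 0"
  shows "\<exists>\<delta>>0. cball \<beta>s \<delta> \<subseteq> B \<and>
    (\<forall>A\<in>\<X>. \<forall>\<beta>\<in>cball \<beta>s \<delta>. norm (fisher_summand \<nu> b \<beta> A - fisher_summand \<nu> b \<beta>s A) \<le> \<epsilon>)"
proof -
  obtain r where r: "r > 0" "cball \<beta>s r \<subseteq> B" using open_B \<beta>s_in_B open_contains_cball by blast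
  have "uniformly_continuous_on (\<X> \<times> cball \<beta>s r) (\<lambda>p. fisher_summand \<nu> b (snd p) (fst p))"
    using r by (intro compact_uniformly_continuous continuous_on_fisher_summand compact_Times compact_X) auto
  then obtain d where d: "d > 0" "\<And>p q. p \<in> \<X> \<times> cball \<beta>s r \<Longrightarrow> q \<in> \<X> \<times> cball \<beta>s r \<Longrightarrow> dist q p < d \<Longrightarrow>
      dist (fisher_summand \<nu> b (snd q) (fst q)) (fisher_summand \<nu> b (snd p) (fst p)) < \<epsilon>"
    unfolding uniformly_continuous_on_def using assms by metis
  define \<delta> where "\<delta> = min r (d / 2)"
  have \<delta>: "\<delta> > 0" "\<delta> \<le> r" "\<delta> < d" using r d by (auto simp: \<delta>_def)
  have "norm (fisher_summand \<nu> b \<beta> A - fisher_summand \<nu> b \<beta>s A) \<le> \<epsilon>"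
    if "A \<in> \<X>" "\<beta> \<in> cball \<beta>s \<delta>" for A \<beta>
    using d(2)[of "(A, \<beta>s)" "(A, \<beta>)"] that r \<delta> by (auto simp: dist_Pair_Pair dist_commute dist_norm norm_minus_commute)
  then show ?thesis using \<delta> r by (intro exI[of _ \<delta>]) auto
qed

text \<open>There are two errors, each at most half of the allowance: the Fisher summands are
  evaluated at intermediate points instead of \<open>\<beta>s\<close>, and their average differs
  from \<open>J\<close>.\<close>

lemma excess_quadratic:
  assumes "\<epsilon> > 0"
  shows "\<exists>\<delta>>0. \<forall>\<^sub>F n in sequentially. \<forall>u. norm u \<le> \<delta> \<longrightarrow>
    \<bar>excess n (\<beta>s + u) - real n / 2 * (u \<bullet> (J *v u))\<bar> \<le> \<epsilon> * real n * (norm u)\<^sup>2"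
proof -
  obtain \<delta> where \<delta>: "\<delta> > 0" "cball \<beta>s \<delta> \<subseteq> B"
    "\<And>A \<beta>. A \<in> \<X> \<Longrightarrow> \<beta> \<in> cball \<beta>s \<delta> \<Longrightarrow> norm (fisher_summand \<nu> b \<beta> A - fisher_summand \<nu> b \<beta>s A) \<le> \<epsilon>"
    using fisher_summand_equicontinuous[OF assms] by blast
  have "\<forall>\<^sub>F n in sequentially. norm (mean_fisher n - J) < \<epsilon>"
    using tendstoD[OF fisher_tendsto assms] by (simp add: mean_fisher_def dist_norm)
  then have "\<forall>\<^sub>F n in sequentially. \<forall>u. norm u \<le> \<delta> \<longrightarrow>
    \<bar>excess n (\<beta>s + u) - real n / 2 * (u \<bullet> (J *v u))\<bar> \<le> \<epsilon> * real n * (norm u)\<^sup>2"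
  proof eventually_elim
    case (elim n)
    show ?case
    proof safe
      fix u :: "real^'p" assume u: "norm u \<le> \<delta>"
      have uB: "\<beta>s + u \<in> cball \<beta>s \<delta>" using u by (simp add: dist_norm)
      have uB': "\<beta>s + u \<in> B" using uB \<delta>(2) by blast
      let ?F = "\<lambda>i. u \<bullet> (fisher_summand \<nu> b \<beta>s (X i) *v u)"
      have "\<bar>(log_partition \<nu> b (X i *v (\<beta>s + u)) - log_partition \<nu> b (X i *v \<beta>s)
         - mean (X i *v \<beta>s) \<bullet> (X i *v ((\<beta>s + u) - \<beta>s))) - ?F i / 2\<bar> \<le> \<epsilon> * (norm u)\<^sup>2 / 2" for i
      proof -
        obtain \<xi> where \<xi>: "\<xi> \<in> closed_segment \<beta>s (\<beta>s + u)"
          "log_partition \<nu> b (X i *v (\<beta>s + u)) = log_partition \<nu> b (X i *v \<beta>s)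
          + mean (X i *v \<beta>s) \<bullet> (X i *v u) + (u \<bullet> (fisher_summand \<nu> b \<xi> (X i) *v u)) / 2"
          using predictor_Taylor[OF X_in \<beta>s_in_B uB', of i, unfolded add_diff_cancel_left'] by blast
        have "\<xi> \<in> cball \<beta>s \<delta>"
          using \<xi>(1) closed_segment_subset[OF _ uB convex_cball, of \<beta>s] \<delta>(1) by auto
        then have *: "norm (fisher_summand \<nu> b \<xi> (X i) - fisher_summand \<nu> b \<beta>s (X i)) \<le> \<epsilon>"
          by (intro \<delta>(3) X_in)
        have "\<bar>u \<bullet> ((fisher_summand \<nu> b \<xi> (X i) - fisher_summand \<nu> b \<beta>s (X i)) *v u)\<bar> \<le>
          norm (fisher_summand \<nu> b \<xi> (X i) - fisher_summand \<nu> b \<beta>s (X i)) * (norm u)\<^sup>2"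
          by (rule abs_quadratic_form_le)
        also have "\<dots> \<le> \<epsilon> * (norm u)\<^sup>2" using * by (intro mult_right_mono) auto
        finally show ?thesis
          unfolding \<xi>(2) abs_le_iff by (simp add: matrix_vector_mult_diff_rdistrib inner_diff_right)
      qed
      then have "\<bar>\<Sum>i<n. (log_partition \<nu> b (X i *v (\<beta>s + u)) - log_partition \<nu> b (X i *v \<beta>s)
         - mean (X i *v \<beta>s) \<bullet> (X i *v ((\<beta>s + u) - \<beta>s))) - ?F i / 2\<bar> \<le> (\<Sum>i<n. \<epsilon> * (norm u)\<^sup>2 / 2)"
        by (intro order_trans[OF sum_abs] sum_mono)
      then have 1: "\<bar>excess n (\<beta>s + u) - (\<Sum>i<n. ?F i) / 2\<bar> \<le> real n * (\<epsilon> * (norm u)\<^sup>2 / 2)"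
        unfolding sum_subtractf[of _ "\<lambda>i. ?F i / 2"] by (simp add: excess_def sum_divide_distrib)
      have "\<bar>u \<bullet> ((mean_fisher n - J) *v u)\<bar> \<le> norm (mean_fisher n - J) * (norm u)\<^sup>2"
        by (rule abs_quadratic_form_le)
      also have "\<dots> \<le> \<epsilon> * (norm u)\<^sup>2" using elim by (intro mult_right_mono) auto
      finally have "real n / 2 * \<bar>u \<bullet> ((mean_fisher n - J) *v u)\<bar> \<le> real n / 2 * (\<epsilon> * (norm u)\<^sup>2)"
        by (intro mult_left_mono) auto
      then have 2: "\<bar>real n / 2 * (u \<bullet> ((mean_fisher n - J) *v u))\<bar> \<le> real n / 2 * (\<epsilon> * (norm u)\<^sup>2)"
        by (simp add: abs_mult)
      have 3: "real n / 2 * (u \<bullet> ((mean_fisher n - J) *v u)) = (\<Sum>i<n. ?F i) / 2 - real n / 2 * (u \<bullet> (J *v u))"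
        using mean_fisher_quadratic_form[of n u]
        by (simp add: matrix_vector_mult_diff_rdistrib inner_diff_right right_diff_distrib)
      show "\<bar>excess n (\<beta>s + u) - real n / 2 * (u \<bullet> (J *v u))\<bar> \<le> \<epsilon> * real n * (norm u)\<^sup>2"
      proof -
        have "\<epsilon> * real n * (norm u)\<^sup>2 = real n * (\<epsilon> * (norm u)\<^sup>2 / 2) + real n / 2 * (\<epsilon> * (norm u)\<^sup>2)"
          by (simp add: field_simps)
        then show ?thesis using 1 2 unfolding 3 by linarith
      qed
    qed
  qed
  with \<delta>(1) show ?thesis by blast
qed

end

section \<open>Moments of the score\<close>

text \<open>Squaring the bound of \<open>\<bar>x\<bar>\<^sup>2 / 8\<close> by
  \<open>exp (\<bar>x\<bar> / 2)\<close> gives the constant 64.\<close>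

lemma power4_le_exp: "x ^ 4 \<le> 64 * (exp x + exp (- x))" for x :: real
proof -
  have "\<bar>x\<bar>\<^sup>2 / 8 \<le> exp (\<bar>x\<bar> / 2)"
    using exp_lower_Taylor_quadratic[of "\<bar>x\<bar> / 2"] by (simp add: power2_eq_square)
  then have "(\<bar>x\<bar>\<^sup>2 / 8)\<^sup>2 \<le> (exp (\<bar>x\<bar> / 2))\<^sup>2" by (intro power_mono) auto
  also have "\<dots> = exp \<bar>x\<bar>" by (simp add: power2_eq_square flip: exp_add)
  also have "\<dots> \<le> exp x + exp (- x)" by (auto simp: abs_if)
  finally show ?thesis by (simp add: power2_eq_square power4_eq_xxxx)
qed

text \<open>Independence and centring make every cross term integrate to 0.\<close>

lemma (in prob_space) expectation_square_sum_indep: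
  fixes Y :: "nat \<Rightarrow> 'a \<Rightarrow> real"
  assumes indep: "indep_vars (\<lambda>_. borel) Y UNIV"
    and int: "\<And>i. integrable M (Y i)" and int2: "\<And>i. integrable M (\<lambda>\<omega>. (Y i \<omega>)\<^sup>2)"
    and zero: "\<And>i. expectation (Y i) = 0"
  shows "integrable M (\<lambda>\<omega>. (\<Sum>i<n. Y i \<omega>)\<^sup>2)"
    and "expectation (\<lambda>\<omega>. (\<Sum>i<n. Y i \<omega>)\<^sup>2) = (\<Sum>i<n. expectation (\<lambda>\<omega>. (Y i \<omega>)\<^sup>2))"
proof -
  have ind: "indep_var borel (Y i) borel (Y j)" if "i \<noteq> j" for i j
  proof -
    \<comment> \<open>Independence of disjoint subfamilies concerns restricted functions; evaluation
      at the single index recovers \<open>Y i\<close> and \<open>Y j\<close>.\<close>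
    have "indep_var (Pi\<^sub>M {i} (\<lambda>_. borel)) (\<lambda>\<omega>. restrict (\<lambda>k. Y k \<omega>) {i})
      (Pi\<^sub>M {j} (\<lambda>_. borel)) (\<lambda>\<omega>. restrict (\<lambda>k. Y k \<omega>) {j})"
      using that by (intro indep_var_restrict[OF indep]) auto
    from indep_var_compose[OF this, of "\<lambda>f. f i" borel "\<lambda>f. f j" borel]
    show ?thesis by (simp add: comp_def)
  qed
  have prod: "integrable M (\<lambda>\<omega>. Y i \<omega> * Y j \<omega>)"
    "expectation (\<lambda>\<omega>. Y i \<omega> * Y j \<omega>) = (if i = j then expectation (\<lambda>\<omega>. (Y i \<omega>)\<^sup>2) else 0)" for i j
    using indep_var_integrable[OF ind int int, of i j] indep_var_lebesgue_integral[OF ind int int, of i j]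
      int2[of i] zero by (auto simp: power2_eq_square)
  have eq: "(\<Sum>i<n. Y i \<omega>)\<^sup>2 = (\<Sum>i<n. \<Sum>j<n. Y i \<omega> * Y j \<omega>)" for \<omega>
    by (simp add: power2_eq_square sum_product)
  show "integrable M (\<lambda>\<omega>. (\<Sum>i<n. Y i \<omega>)\<^sup>2)" unfolding eq using prod by simp
  show "expectation (\<lambda>\<omega>. (\<Sum>i<n. Y i \<omega>)\<^sup>2) = (\<Sum>i<n. expectation (\<lambda>\<omega>. (Y i \<omega>)\<^sup>2))"
    unfolding eq using prod by simp
qed

context exponential_family
begin

lemma expfam_density_tilted:
  assumes "\<theta> \<in> interior_parameters"
  shows "expfam_density \<nu> b \<theta> v = exp (v \<bullet> \<theta> + b v) / tilted (\<lambda>y. 1) \<theta>"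
  using tilted_one_pos[OF assms]
  by (simp add: expfam_density_def log_partition_tilted exp_add exp_diff)

text \<open>An exponential weight is a shift of the natural parameter, so the moment generating
  function of an observation is a ratio of normalizing integrals.\<close>

lemma tilted_integrable_exp_inner:
  assumes \<theta>: "\<theta> + h \<in> interior_parameters"
  shows "tilted_integrable {\<theta>} (\<lambda>y. exp (y \<bullet> h))" "tilted (\<lambda>y. exp (y \<bullet> h)) \<theta> = tilted (\<lambda>y. 1) (\<theta> + h)"
proof -
  have eq: "exp (y \<bullet> h) * exp (y \<bullet> \<theta> + b y) = 1 * exp (y \<bullet> (\<theta> + h) + b y)" for y
    by (simp add: inner_add_right add_ac flip: exp_add)
  show "tilted_integrable {\<theta>} (\<lambda>y. exp (y \<bullet> h))"
    using tilted_integrable_moments(1) \<theta> by (auto simp: tilted_integrable_def eq)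
  show "tilted (\<lambda>y. exp (y \<bullet> h)) \<theta> = tilted (\<lambda>y. 1) (\<theta> + h)"
    unfolding tilted_def eq ..
qed

end

locale natural_link_sample = natural_link_regression \<nu> b \<X> X B \<beta>s J + prob_space M
  for \<nu> :: "(real^'r) measure" and b :: "real^'r \<Rightarrow> real"
    and \<X> :: "(real^'p^'r) set" and X :: "nat \<Rightarrow> real^'p^'r" and B :: "(real^'p) set"
    and \<beta>s :: "real^'p" and J :: "real^'p^'p" and M :: "'w measure" +
  fixes y :: "nat \<Rightarrow> 'w \<Rightarrow> real^'r"
  assumes indep_y: "indep_vars (\<lambda>_. borel) y UNIV"
    and distributed_y: "distributed M \<nu> (y i) (\<lambda>v. ennreal (expfam_density \<nu> b (X i *v \<beta>s) v))"
begin

text \<open>The gradient of the log-likelihood at \<open>\<beta>s\<close>, divided by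
  \<open>sqrt (real n)\<close>; with the natural link it is affine in the data.\<close>

definition score :: "nat \<Rightarrow> (nat \<Rightarrow> real^'r) \<Rightarrow> real^'p" where
  "score n ys = (1 / sqrt (real n)) *\<^sub>R (\<Sum>i<n. transpose (X i) *v (ys i - mean (X i *v \<beta>s)))"

abbreviation \<theta>s :: "nat \<Rightarrow> real^'r" where
  "\<theta>s i \<equiv> X i *v \<beta>s"

lemma \<theta>s_interior: "\<theta>s i \<in> interior_parameters"
  by (rule predictor_interior[OF X_in \<beta>s_in_B])

lemma y_measurable[measurable]: "y i \<in> borel_measurable M"
  using distributed_measurable[OF distributed_y, of i] unfolding measurable_cong_sets[OF refl sets_\<nu>] .

lemma inner_score: "score n ys \<bullet> t = (\<Sum>i<n. (ys i - mean (\<theta>s i)) \<bullet> (X i *v (t /\<^sub>R sqrt (real n))))"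
proof -
  have "(transpose A *v v) \<bullet> t = v \<bullet> (A *v t)" for A :: "real^'p^'r" and v
    by (metis dot_lmul_matrix transpose_matrix_vector)
  then show ?thesis
    by (simp add: score_def inner_sum_left sum_distrib_left matrix_vector_mult_scaleR divide_inverse)
qed

lemma score_sample: "score n (sample y n \<omega>) = score n (\<lambda>i. y i \<omega>)"
  by (simp add: score_def sample_def)

lemma measurable_score[measurable]: "score n \<in> borel_measurable (\<Pi>\<^sub>M i\<in>{..<n}. borel)"
proof (rule borel_measurable_euclidean_space[THEN iffD2], safe)
  fix t :: "real^'p"
  show "(\<lambda>ys. score n ys \<bullet> t) \<in> borel_measurable (\<Pi>\<^sub>M i\<in>{..<n}. borel)"
    unfolding inner_score
    by (intro borel_measurable_sum borel_measurable_inner borel_measurable_diff borel_measurable_const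
        measurable_component_singleton) auto
qed

lemma measurable_sample_y[measurable]: "sample y n \<in> measurable M (\<Pi>\<^sub>M i\<in>{..<n}. borel)"
  unfolding sample_def by (rule measurable_restrict) simp

lemma expectation_y:
  assumes "tilted_integrable {\<theta>s i} h"
  shows "integrable M (\<lambda>\<omega>. h (y i \<omega>))" "expectation (\<lambda>\<omega>. h (y i \<omega>)) = tilted h (\<theta>s i) / tilted (\<lambda>y. 1) (\<theta>s i)"
proof -
  have [measurable]: "h \<in> borel_measurable borel" using assms by (simp add: tilted_integrable_def)
  have eq: "expfam_density \<nu> b (\<theta>s i) v * h v = h v * exp (v \<bullet> \<theta>s i + b v) / tilted (\<lambda>y. 1) (\<theta>s i)" for v
    by (simp add: expfam_density_tilted[OF \<theta>s_interior])
  have nn: "0 \<le> expfam_density \<nu> b (\<theta>s i) v" for v by (simp add: expfam_density_def)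
  have h\<nu>: "h \<in> borel_measurable \<nu>" by measurable
  show "integrable M (\<lambda>\<omega>. h (y i \<omega>))"
    using assms distributed_integrable[OF distributed_y[of i] h\<nu> nn]
    unfolding eq by (simp add: tilted_integrable_def)
  show "expectation (\<lambda>\<omega>. h (y i \<omega>)) = tilted h (\<theta>s i) / tilted (\<lambda>y. 1) (\<theta>s i)"
    using distributed_integral[OF distributed_y[of i] h\<nu> nn]
    unfolding eq by (simp add: tilted_def)
qed

lemma tilted_integrable_moments_\<theta>s:
  "tilted_integrable {\<theta>s i} (\<lambda>y. y $ j)" "tilted_integrable {\<theta>s i} (\<lambda>y. y $ j * y $ k)"
  using tilted_integrable_moments(2,3) \<theta>s_interior by (auto simp: tilted_integrable_def)

lemma residual_moments:
  shows "integrable M (\<lambda>\<omega>. (y i \<omega> - mean (\<theta>s i)) \<bullet> h)"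
    and "expectation (\<lambda>\<omega>. (y i \<omega> - mean (\<theta>s i)) \<bullet> h) = 0"
    and "integrable M (\<lambda>\<omega>. ((y i \<omega> - mean (\<theta>s i)) \<bullet> h)\<^sup>2)"
    and "expectation (\<lambda>\<omega>. ((y i \<omega> - mean (\<theta>s i)) \<bullet> h)\<^sup>2) = h \<bullet> (covariance (\<theta>s i) *v h)"
proof -
  let ?m = "mean (\<theta>s i)"
  have 1: "integrable M (\<lambda>\<omega>. y i \<omega> $ j)" "expectation (\<lambda>\<omega>. y i \<omega> $ j) = ?m $ j" for j
    using expectation_y[OF tilted_integrable_moments_\<theta>s(1)] by (simp_all add: mean_def)
  have 2: "integrable M (\<lambda>\<omega>. y i \<omega> $ j * y i \<omega> $ k)"
    "expectation (\<lambda>\<omega>. y i \<omega> $ j * y i \<omega> $ k) = covariance (\<theta>s i) $ j $ k + ?m $ j * ?m $ k" for j k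
    using expectation_y[OF tilted_integrable_moments_\<theta>s(2)] by (simp_all add: covariance_def)
  have eq1: "(y i \<omega> - ?m) \<bullet> h = (\<Sum>j\<in>UNIV. h $ j * (y i \<omega> $ j - ?m $ j))" for \<omega>
    by (simp add: inner_vec_def mult.commute)
  show "integrable M (\<lambda>\<omega>. (y i \<omega> - ?m) \<bullet> h)" unfolding eq1 using 1 by simp
  show "expectation (\<lambda>\<omega>. (y i \<omega> - ?m) \<bullet> h) = 0" unfolding eq1 using 1 by (simp add: prob_space)
  have cross: "(y i \<omega> $ j - ?m $ j) * (y i \<omega> $ k - ?m $ k) =
    y i \<omega> $ j * y i \<omega> $ k - ?m $ k * y i \<omega> $ j - ?m $ j * y i \<omega> $ k + ?m $ j * ?m $ k" for \<omega> j k
    by (simp add: algebra_simps)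
  have 3: "integrable M (\<lambda>\<omega>. (y i \<omega> $ j - ?m $ j) * (y i \<omega> $ k - ?m $ k))"
    "expectation (\<lambda>\<omega>. (y i \<omega> $ j - ?m $ j) * (y i \<omega> $ k - ?m $ k)) = covariance (\<theta>s i) $ j $ k" for j k
    unfolding cross using 1 2 by (simp_all add: prob_space)
  have eq2: "((y i \<omega> - ?m) \<bullet> h)\<^sup>2 =
    (\<Sum>j\<in>UNIV. \<Sum>k\<in>UNIV. (h $ j * h $ k) * ((y i \<omega> $ j - ?m $ j) * (y i \<omega> $ k - ?m $ k)))" for \<omega>
    unfolding eq1 by (simp add: power2_eq_square sum_product mult_ac)
  show "integrable M (\<lambda>\<omega>. ((y i \<omega> - ?m) \<bullet> h)\<^sup>2)" unfolding eq2 using 3 by simp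
  have "expectation (\<lambda>\<omega>. ((y i \<omega> - ?m) \<bullet> h)\<^sup>2) = (\<Sum>j\<in>UNIV. \<Sum>k\<in>UNIV. (h $ j * h $ k) * covariance (\<theta>s i) $ j $ k)"
    unfolding eq2 using 3 by simp
  also have "\<dots> = h \<bullet> (covariance (\<theta>s i) *v h)"
    by (simp add: inner_vec_def matrix_vector_mult_def sum_distrib_left mult_ac)
  finally show "expectation (\<lambda>\<omega>. ((y i \<omega> - ?m) \<bullet> h)\<^sup>2) = h \<bullet> (covariance (\<theta>s i) *v h)" .
qed

lemma residual_exp_moment:
  assumes "\<theta>s i + h \<in> interior_parameters"
  shows "integrable M (\<lambda>\<omega>. exp ((y i \<omega> - mean (\<theta>s i)) \<bullet> h))"
    and "expectation (\<lambda>\<omega>. exp ((y i \<omega> - mean (\<theta>s i)) \<bullet> h)) =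
      exp (log_partition \<nu> b (\<theta>s i + h) - log_partition \<nu> b (\<theta>s i) - mean (\<theta>s i) \<bullet> h)"
proof -
  have eq: "exp ((y i \<omega> - mean (\<theta>s i)) \<bullet> h) = exp (- (mean (\<theta>s i) \<bullet> h)) * exp (y i \<omega> \<bullet> h)" for \<omega>
    by (simp add: inner_diff_left flip: exp_add)
  note E = expectation_y[OF tilted_integrable_exp_inner(1)[OF assms]]
  show "integrable M (\<lambda>\<omega>. exp ((y i \<omega> - mean (\<theta>s i)) \<bullet> h))" unfolding eq using E by simp
  have "expectation (\<lambda>\<omega>. exp ((y i \<omega> - mean (\<theta>s i)) \<bullet> h)) =
    exp (- (mean (\<theta>s i) \<bullet> h)) * (tilted (\<lambda>y. 1) (\<theta>s i + h) / tilted (\<lambda>y. 1) (\<theta>s i))"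
    unfolding eq using E by (simp add: tilted_integrable_exp_inner(2)[OF assms])
  also have "\<dots> = exp (log_partition \<nu> b (\<theta>s i + h) - log_partition \<nu> b (\<theta>s i) - mean (\<theta>s i) \<bullet> h)"
    using tilted_one_pos[OF assms] tilted_one_pos[OF \<theta>s_interior, of i]
    by (simp add: log_partition_tilted exp_diff exp_minus divide_inverse mult_ac)
  finally show "expectation (\<lambda>\<omega>. exp ((y i \<omega> - mean (\<theta>s i)) \<bullet> h)) =
      exp (log_partition \<nu> b (\<theta>s i + h) - log_partition \<nu> b (\<theta>s i) - mean (\<theta>s i) \<bullet> h)" .
qed

lemma score_moments:
  assumes n: "n \<ge> 1"
  shows "integrable M (\<lambda>\<omega>. score n (sample y n \<omega>) \<bullet> t)"
    and "expectation (\<lambda>\<omega>. score n (sample y n \<omega>) \<bullet> t) = 0"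
    and "integrable M (\<lambda>\<omega>. (score n (sample y n \<omega>) \<bullet> t)\<^sup>2)"
    and "expectation (\<lambda>\<omega>. (score n (sample y n \<omega>) \<bullet> t)\<^sup>2) = t \<bullet> (mean_fisher n *v t)"
proof -
  define h where "h i = X i *v (t /\<^sub>R sqrt (real n))" for i
  define Y where "Y i \<omega> = (y i \<omega> - mean (\<theta>s i)) \<bullet> h i" for i \<omega>
  have S: "score n (sample y n \<omega>) \<bullet> t = (\<Sum>i<n. Y i \<omega>)" for \<omega>
    unfolding score_sample inner_score by (simp add: Y_def h_def)
  have indep: "indep_vars (\<lambda>_. borel) Y UNIV"
    unfolding Y_def by (rule indep_vars_compose2[OF indep_y]) simp
  have Y: "integrable M (Y i)" "expectation (Y i) = 0" "integrable M (\<lambda>\<omega>. (Y i \<omega>)\<^sup>2)"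
    "expectation (\<lambda>\<omega>. (Y i \<omega>)\<^sup>2) = h i \<bullet> (covariance (\<theta>s i) *v h i)" for i
    using residual_moments[of i "h i"] by (simp_all add: Y_def[abs_def])
  show "integrable M (\<lambda>\<omega>. score n (sample y n \<omega>) \<bullet> t)" "expectation (\<lambda>\<omega>. score n (sample y n \<omega>) \<bullet> t) = 0"
    unfolding S using Y by simp_all
  note E = expectation_square_sum_indep[OF indep Y(1,3,2)]
  show "integrable M (\<lambda>\<omega>. (score n (sample y n \<omega>) \<bullet> t)\<^sup>2)" unfolding S by (rule E(1))
  have "expectation (\<lambda>\<omega>. (score n (sample y n \<omega>) \<bullet> t)\<^sup>2) = (\<Sum>i<n. h i \<bullet> (covariance (\<theta>s i) *v h i))"
    unfolding S E(2) Y(4) ..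
  also have "\<dots> = (\<Sum>i<n. (t /\<^sub>R sqrt (real n)) \<bullet> (fisher_summand \<nu> b \<beta>s (X i) *v (t /\<^sub>R sqrt (real n))))"
    by (simp add: h_def fisher_quadratic_form[OF X_in \<beta>s_in_B])
  also have "\<dots> = (\<Sum>i<n. t \<bullet> (fisher_summand \<nu> b \<beta>s (X i) *v t)) / real n"
    unfolding sum_divide_distrib
  proof (rule sum.cong)
    fix i
    have "inverse (sqrt (real n)) * (inverse (sqrt (real n)) * x) = x / real n" for x
      using n by (simp add: divide_inverse mult.assoc[symmetric] flip: inverse_mult_distrib)
    then show "(t /\<^sub>R sqrt (real n)) \<bullet> (fisher_summand \<nu> b \<beta>s (X i) *v (t /\<^sub>R sqrt (real n)))
      = t \<bullet> (fisher_summand \<nu> b \<beta>s (X i) *v t) / real n"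
      by (simp add: matrix_vector_mult_scaleR)
  qed simp
  also have "\<dots> = t \<bullet> (mean_fisher n *v t)"
    using n unfolding mean_fisher_quadratic_form[symmetric] by simp
  finally show "expectation (\<lambda>\<omega>. (score n (sample y n \<omega>) \<bullet> t)\<^sup>2) = t \<bullet> (mean_fisher n *v t)" .
qed

text \<open>Independence factors the moment generating function; the logarithm of each factor is one
  summand of \<open>excess\<close>.\<close>

lemma score_exp_moment:
  assumes "\<beta>s + t /\<^sub>R sqrt (real n) \<in> B"
  shows "integrable M (\<lambda>\<omega>. exp (score n (sample y n \<omega>) \<bullet> t))"
    and "expectation (\<lambda>\<omega>. exp (score n (sample y n \<omega>) \<bullet> t)) = exp (excess n (\<beta>s + t /\<^sub>R sqrt (real n)))"
proof -
  define h where "h i = X i *v (t /\<^sub>R sqrt (real n))" for i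
  define Y where "Y i \<omega> = exp ((y i \<omega> - mean (\<theta>s i)) \<bullet> h i)" for i \<omega>
  have h: "\<theta>s i + h i = X i *v (\<beta>s + t /\<^sub>R sqrt (real n))" for i
    by (simp add: h_def matrix_vector_right_distrib)
  have hi: "\<theta>s i + h i \<in> interior_parameters" for i
    unfolding h by (rule predictor_interior[OF X_in assms])
  have S: "exp (score n (sample y n \<omega>) \<bullet> t) = (\<Prod>i<n. Y i \<omega>)" for \<omega>
    unfolding score_sample inner_score by (simp add: Y_def h_def exp_sum)
  have indep: "indep_vars (\<lambda>_. borel) Y {..<n}"
    unfolding Y_def by (rule indep_vars_compose2[OF indep_vars_subset[OF indep_y]]) simp_all
  have Y: "integrable M (Y i)" for i
    using residual_exp_moment(1)[OF hi] by (simp add: Y_def[abs_def])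
  show "integrable M (\<lambda>\<omega>. exp (score n (sample y n \<omega>) \<bullet> t))"
    unfolding S by (rule indep_vars_integrable[OF _ indep Y]) simp
  have "expectation (\<lambda>\<omega>. exp (score n (sample y n \<omega>) \<bullet> t)) = (\<Prod>i<n. expectation (Y i))"
    unfolding S by (rule indep_vars_lebesgue_integral[OF _ indep Y]) simp
  also have "\<dots> = (\<Prod>i<n. exp (log_partition \<nu> b (\<theta>s i + h i) - log_partition \<nu> b (\<theta>s i) - mean (\<theta>s i) \<bullet> h i))"
    unfolding Y_def by (simp only: residual_exp_moment(2)[OF hi])
  also have "\<dots> = exp (excess n (\<beta>s + t /\<^sub>R sqrt (real n)))"
    unfolding h by (simp add: excess_def exp_sum h_def)
  finally show "expectation (\<lambda>\<omega>. exp (score n (sample y n \<omega>) \<bullet> t)) = exp (excess n (\<beta>s + t /\<^sub>R sqrt (real n)))" .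
qed

text \<open>\<open>power4_le_exp\<close> reduces the fourth moment to the moment generating function
  at \<open>t\<close> and \<open>- t\<close>. Its exponent is quadratic in
  \<open>t / sqrt (real n)\<close> with a factor \<open>real n\<close>, so the sample size
  cancels.\<close>

lemma score_fourth_moment_bounded:
  "\<exists>C. \<forall>\<^sub>F n in sequentially. integrable M (\<lambda>\<omega>. (score n (sample y n \<omega>) \<bullet> t) ^ 4) \<and>
     expectation (\<lambda>\<omega>. (score n (sample y n \<omega>) \<bullet> t) ^ 4) \<le> C"
proof -
  obtain \<delta>1 where \<delta>1: "\<delta>1 > 0" "\<forall>\<^sub>F n in sequentially. \<forall>u. norm u \<le> \<delta>1 \<longrightarrow>
    \<bar>excess n (\<beta>s + u) - real n / 2 * (u \<bullet> (J *v u))\<bar> \<le> 1 * real n * (norm u)\<^sup>2"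
    using excess_quadratic[of 1] by auto
  obtain \<delta>2 where \<delta>2: "\<delta>2 > 0" "cball \<beta>s \<delta>2 \<subseteq> B" using open_B \<beta>s_in_B open_contains_cball by blast
  \<comment> \<open>The exponent bounds \<open>excess\<close> at the shifted parameter: the first
    term from the quadratic form of \<open>J\<close>, the second from the approximation error with
    tolerance 1.\<close>
  define c where "c = exp (norm J / 2 * (norm t)\<^sup>2 + (norm t)\<^sup>2)"
  have "filterlim (\<lambda>n. sqrt (real n)) at_top sequentially"
    by (rule filterlim_compose[OF sqrt_at_top filterlim_real_sequentially])
  then have "\<forall>\<^sub>F n in sequentially. norm t / min \<delta>1 \<delta>2 \<le> sqrt (real n)" by (simp add: filterlim_at_top)
  with \<delta>1(2) have "\<forall>\<^sub>F n in sequentially. integrable M (\<lambda>\<omega>. (score n (sample y n \<omega>) \<bullet> t) ^ 4) \<and>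
     expectation (\<lambda>\<omega>. (score n (sample y n \<omega>) \<bullet> t) ^ 4) \<le> 64 * (c + c)"
    using eventually_ge_at_top[of 1]
  proof eventually_elim
    case (elim n)
    have n: "sqrt (real n) > 0" using elim by simp
    have "integrable M (\<lambda>\<omega>. exp (score n (sample y n \<omega>) \<bullet> s)) \<and>
      expectation (\<lambda>\<omega>. exp (score n (sample y n \<omega>) \<bullet> s)) \<le> c" if s: "s = t \<or> s = - t" for s
    proof -
      have ns: "norm s = norm t" using s by auto
      define u where "u = s /\<^sub>R sqrt (real n)"
      have nu: "real n * (norm u)\<^sup>2 = (norm t)\<^sup>2"
        using n by (simp add: u_def power_mult_distrib ns power_inverse)
      have "norm t \<le> min \<delta>1 \<delta>2 * sqrt (real n)"
        using elim(2) \<delta>1(1) \<delta>2(1) by (simp add: pos_divide_le_eq mult.commute)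
      then have "norm t / sqrt (real n) \<le> min \<delta>1 \<delta>2"
        by (subst pos_divide_le_eq[OF n])
      then have u: "norm u \<le> min \<delta>1 \<delta>2"
        by (simp add: u_def ns divide_inverse mult.commute)
      then have uB: "\<beta>s + u \<in> B" using \<delta>2 by (auto simp: dist_norm subset_iff)
      have "\<bar>u \<bullet> (J *v u)\<bar> \<le> norm J * (norm u)\<^sup>2" by (rule abs_quadratic_form_le)
      then have "real n / 2 * (u \<bullet> (J *v u)) \<le> real n / 2 * (norm J * (norm u)\<^sup>2)"
        by (intro mult_left_mono) auto
      also have "\<dots> = norm J / 2 * (norm t)\<^sup>2" by (simp flip: nu)
      finally have "real n / 2 * (u \<bullet> (J *v u)) \<le> norm J / 2 * (norm t)\<^sup>2" .
      moreover have "\<bar>excess n (\<beta>s + u) - real n / 2 * (u \<bullet> (J *v u))\<bar> \<le> (norm t)\<^sup>2"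
        using elim(1)[rule_format, of u] u nu by simp
      ultimately have "exp (excess n (\<beta>s + u)) \<le> c" by (simp add: c_def)
      then show ?thesis using score_exp_moment[OF uB[unfolded u_def]] by (simp add: u_def)
    qed
    from this[of t] this[of "- t"]
    have E: "integrable M (\<lambda>\<omega>. exp (score n (sample y n \<omega>) \<bullet> t))"
      "integrable M (\<lambda>\<omega>. exp (- (score n (sample y n \<omega>) \<bullet> t)))"
      "expectation (\<lambda>\<omega>. exp (score n (sample y n \<omega>) \<bullet> t)) \<le> c"
      "expectation (\<lambda>\<omega>. exp (- (score n (sample y n \<omega>) \<bullet> t))) \<le> c" by simp_all
    let ?g = "\<lambda>\<omega>. 64 * (exp (score n (sample y n \<omega>) \<bullet> t) + exp (- (score n (sample y n \<omega>) \<bullet> t)))"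
    have g: "integrable M ?g" using E by simp
    have "integrable M (\<lambda>\<omega>. (score n (sample y n \<omega>) \<bullet> t) ^ 4)"
    proof (rule Bochner_Integration.integrable_bound[OF g])
      show "AE \<omega> in M. norm ((score n (sample y n \<omega>) \<bullet> t) ^ 4) \<le> norm (?g \<omega>)"
        using power4_le_exp by (intro AE_I2) (auto simp: abs_of_nonneg intro!: order_trans[OF _ abs_ge_self])
    qed measurable
    moreover from this have "expectation (\<lambda>\<omega>. (score n (sample y n \<omega>) \<bullet> t) ^ 4) \<le> expectation ?g"
      using g power4_le_exp by (intro integral_mono) auto
    moreover have "expectation ?g \<le> 64 * (c + c)"
      using E by simp
    ultimately show ?case by simp
  qed
  then show ?thesis by blast
qed

lemma mean_fisher_tendsto: "(\<lambda>n. t \<bullet> (mean_fisher n *v t)) \<longlonglongrightarrow> t \<bullet> (J *v t)"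
proof (rule LIM_zero_cancel, rule Lim_null_comparison)
  have "t \<bullet> (mean_fisher n *v t) - t \<bullet> (J *v t) = t \<bullet> ((mean_fisher n - J) *v t)" for n
    by (simp add: matrix_vector_mult_diff_rdistrib inner_diff_right)
  then show "\<forall>\<^sub>F n in sequentially. norm (t \<bullet> (mean_fisher n *v t) - t \<bullet> (J *v t)) \<le> norm (mean_fisher n - J) * (norm t)\<^sup>2"
    by (simp add: abs_quadratic_form_le)
  have "(\<lambda>n. norm (mean_fisher n - J)) \<longlonglongrightarrow> 0"
    using fisher_tendsto unfolding mean_fisher_def[symmetric] by (simp add: LIM_zero tendsto_norm_zero)
  then show "(\<lambda>n. norm (mean_fisher n - J) * (norm t)\<^sup>2) \<longlonglongrightarrow> 0" by (rule tendsto_mult_left_zero)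
qed

text \<open>Chebyshev's inequality: the second moment of the norm is the trace of
  \<open>mean_fisher n\<close>, eventually below the trace of \<open>J\<close> plus 1. The threshold
  for \<open>n\<close> is independent of \<open>K\<close>.\<close>

lemma score_tail:
  "\<exists>D>0. \<forall>\<^sub>F n in sequentially. \<forall>K>0. prob {\<omega> \<in> space M. norm (score n (sample y n \<omega>)) \<ge> K} \<le> D / K\<^sup>2"
proof -
  define D where "D = (\<Sum>j\<in>UNIV. (axis j 1 :: real^'p) \<bullet> (J *v axis j 1)) + 1"
  have D: "D > 0" unfolding D_def using J_pos_def by (intro add_nonneg_pos sum_nonneg) (auto simp: pos_def_def intro: less_imp_le)
  have "(\<lambda>n. \<Sum>j\<in>UNIV. axis j 1 \<bullet> (mean_fisher n *v axis j 1)) \<longlonglongrightarrow> (\<Sum>j\<in>UNIV. (axis j 1 :: real^'p) \<bullet> (J *v axis j 1))"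
    by (intro tendsto_sum mean_fisher_tendsto)
  then have "\<forall>\<^sub>F n in sequentially. (\<Sum>j\<in>UNIV. axis j 1 \<bullet> (mean_fisher n *v axis j 1)) < D"
    by (rule order_tendstoD) (simp add: D_def)
  with eventually_ge_at_top[of 1]
  have "\<forall>\<^sub>F n in sequentially. \<forall>K>0. prob {\<omega> \<in> space M. norm (score n (sample y n \<omega>)) \<ge> K} \<le> D / K\<^sup>2"
  proof eventually_elim
    case (elim n)
    let ?s = "\<lambda>\<omega>. score n (sample y n \<omega>)"
    have eq: "(norm (?s \<omega>))\<^sup>2 = (\<Sum>j\<in>UNIV. (?s \<omega> \<bullet> axis j 1)\<^sup>2)" for \<omega>
      unfolding power2_norm_eq_inner
      by (simp only: inner_axis) (simp add: inner_vec_def power2_eq_square)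
    have int: "integrable M (\<lambda>\<omega>. (norm (?s \<omega>))\<^sup>2)"
      unfolding eq using score_moments(3)[OF elim(1)] by simp
    have E: "expectation (\<lambda>\<omega>. (norm (?s \<omega>))\<^sup>2) \<le> D"
      unfolding eq using score_moments(3,4)[OF elim(1)] elim(2) by simp
    show ?case
    proof safe
      fix K :: real assume K: "K > 0"
      have "{\<omega> \<in> space M. norm (?s \<omega>) \<ge> K} = {\<omega> \<in> space M. (norm (?s \<omega>))\<^sup>2 \<ge> K\<^sup>2}"
        using K by (auto simp: power2_le_iff_abs_le abs_le_square_iff[symmetric])
      also have "prob \<dots> \<le> expectation (\<lambda>\<omega>. (norm (?s \<omega>))\<^sup>2) / K\<^sup>2"
        using K by (intro integral_Markov_inequality_measure[OF int sets.empty_sets]) auto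
      also have "\<dots> \<le> D / K\<^sup>2" using E K by (intro divide_right_mono) auto
      finally show "prob {\<omega> \<in> space M. norm (?s \<omega>) \<ge> K} \<le> D / K\<^sup>2" .
    qed
  qed
  with D show ?thesis by blast
qed

lemma sqrt_inner_score:
  "sqrt (real n) * (score n ys \<bullet> u) = (\<Sum>i<n. (ys i - mean (\<theta>s i)) \<bullet> (X i *v u))"
proof (cases "n = 0")
  case False
  have "sqrt (real n) * (score n ys \<bullet> u) = score n ys \<bullet> (sqrt (real n) *\<^sub>R u)" by simp
  also have "\<dots> = (\<Sum>i<n. (ys i - mean (\<theta>s i)) \<bullet> (X i *v u))"
    using False unfolding inner_score by simp
  finally show ?thesis .
qed simp

text \<open>The terms \<open>b\<close> cancel within each gain and the log-partition terms between
  the two gains; only the part linear in the data survives, so no Taylor remainder appears.\<close>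

lemma loglik_gain_diff:
  "loglik_gain \<nu> b X \<beta>s n ys \<beta> - loglik_gain \<nu> b X \<beta>s n yts \<beta> =
    sqrt (real n) * ((score n ys - score n yts) \<bullet> (\<beta> - \<beta>s))"
  unfolding inner_diff_left right_diff_distrib sqrt_inner_score
  by (simp add: loglik_gain_def loglik_def matrix_vector_mult_diff_distrib inner_diff_right inner_diff_left
      algebra_simps flip: sum_subtractf)

text \<open>The last sum is free of \<open>\<beta>\<close>, so the set of minimizers depends on the
  sample only through its score.\<close>

lemma penalized_objective_score:
  "penalized_objective \<nu> b X pen n ys \<beta> =
    excess n \<beta> - sqrt (real n) * (score n ys \<bullet> (\<beta> - \<beta>s)) + real n * (\<Sum>j\<in>UNIV. pen (\<beta> $ j))
    - (\<Sum>i<n. loglik \<nu> b (ys i) (X i) \<beta>s)"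
  unfolding sqrt_inner_score
  by (simp add: penalized_objective_def excess_def loglik_def sum_subtractf sum.distrib inner_diff_left
      inner_diff_right matrix_vector_mult_diff_distrib algebra_simps)


end

section \<open>Consistency of the active set size\<close>

lemma eventually_powr_ge:
  assumes "a > (0::real)"
  shows "\<forall>\<^sub>F n in sequentially. R \<le> real n powr a"
proof -
  define R' where "R' = max R 1"
  have R': "R' > 0" "R \<le> R'" by (auto simp: R'_def)
  have "\<forall>\<^sub>F n in sequentially. R' powr (1 / a) \<le> real n"
    by (rule eventually_compose_filterlim[OF eventually_ge_at_top filterlim_real_sequentially])
  then show ?thesis
  proof eventually_elim
    case (elim n)
    have "R' = (R' powr (1 / a)) powr a" using R' assms by (simp add: powr_powr)
    also have "\<dots> \<le> real n powr a" using elim assms by (intro powr_mono2) auto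
    finally show ?case using R' by simp
  qed
qed

section \<open>Consequences of the penalty conditions\<close>

context
  fixes \<eta> :: "real \<Rightarrow> real \<Rightarrow> real" and l :: "nat \<Rightarrow> real"
  assumes P1: "cond_P1 \<eta> l" and P2: "cond_P2 \<eta> l"
begin

lemma penalty_zero: "n \<ge> 1 \<Longrightarrow> \<eta> (l n) 0 = 0"
  using P2 by (simp add: cond_P2_def)

lemma penalty_nonneg:
  assumes "n \<ge> 1"
  shows "0 \<le> \<eta> (l n) x"
proof -
  have "\<eta> (l n) 0 \<le> \<eta> (l n) x" using P1 assms unfolding cond_P1_def by (metis abs_ge_zero abs_zero)
  then show ?thesis using penalty_zero[OF assms] by simp
qed

text \<open>At the origin, where the penalty is not differentiable, continuity follows from the
  limit of its ratio to \<open>\<bar>\<beta>\<bar>\<close>. It provides the minimizer on compact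
  balls.\<close>

lemma penalty_continuous:
  assumes n: "n \<ge> 1"
  shows "continuous_on UNIV (\<eta> (l n))"
proof (rule continuous_at_imp_continuous_on, safe)
  fix x
  show "isCont (\<eta> (l n)) x"
  proof (cases "x = 0")
    case False
    then show ?thesis
      using P1 n by (auto simp: cond_P1_def intro: differentiable_imp_continuous_within)
  next
    case True
    have "((\<lambda>\<beta>. \<eta> (l n) \<beta> / \<bar>\<beta>\<bar>) \<longlongrightarrow> l n) (at 0)" using P2 n by (simp add: cond_P2_def)
    moreover have "((\<lambda>\<beta>. \<bar>\<beta>\<bar>) \<longlongrightarrow> 0) (at (0::real))" by (auto intro!: tendsto_eq_intros)
    ultimately have "((\<lambda>\<beta>. \<eta> (l n) \<beta> / \<bar>\<beta>\<bar> * \<bar>\<beta>\<bar>) \<longlongrightarrow> l n * 0) (at 0)" by (rule tendsto_mult)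
    moreover have "\<forall>\<^sub>F \<beta> in at 0. \<eta> (l n) \<beta> / \<bar>\<beta>\<bar> * \<bar>\<beta>\<bar> = \<eta> (l n) \<beta>"
      by (auto simp: eventually_at_filter)
    ultimately have "(\<eta> (l n) \<longlongrightarrow> 0) (at 0)" by (auto dest: Lim_transform_eventually)
    then show ?thesis using True penalty_zero[OF n] by (simp add: isCont_def)
  qed
qed

text \<open>The interval stays at distance at least \<open>\<bar>c\<bar> / 2\<close> from 0, which
  eventually exceeds \<open>\<tau> * l n\<close>; the derivative then vanishes on the whole
  interval.\<close>

lemma penalty_locally_flat:
  assumes P4: "cond_P4 \<eta> l" and l: "l \<longlonglongrightarrow> 0" and c: "c \<noteq> 0"
  shows "\<forall>\<^sub>F n in sequentially. \<forall>x. \<bar>x - c\<bar> \<le> \<bar>c\<bar> / 2 \<longrightarrow> \<eta> (l n) x = \<eta> (l n) c"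
proof -
  obtain \<tau> where \<tau>: "\<tau> > 0" "\<And>n \<beta>. n \<ge> 1 \<Longrightarrow> \<bar>\<beta>\<bar> \<ge> \<tau> * l n \<Longrightarrow> deriv (\<eta> (l n)) \<beta> = 0"
    using P4 unfolding cond_P4_def by blast
  have "(\<lambda>n. \<tau> * l n) \<longlonglongrightarrow> \<tau> * 0" by (intro tendsto_intros l)
  then have "\<forall>\<^sub>F n in sequentially. \<tau> * l n < \<bar>c\<bar> / 2" using c by (intro order_tendstoD) auto
  with eventually_ge_at_top[of 1] show ?thesis
  proof eventually_elim
    case (elim n)
    have "(\<eta> (l n) has_field_derivative 0) (at x within cball c (\<bar>c\<bar> / 2))"
      if "x \<in> cball c (\<bar>c\<bar> / 2)" for x
    proof -
      have "\<bar>c - x\<bar> \<le> \<bar>c\<bar> / 2" using that by (simp add: dist_real_def)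
      then have x: "\<bar>c\<bar> / 2 \<le> \<bar>x\<bar>" by linarith
      then have "\<eta> (l n) differentiable (at x)"
        using P1 elim(1) c by (auto simp: cond_P1_def)
      moreover have "deriv (\<eta> (l n)) x = 0" using \<tau>(2)[OF elim(1), of x] x elim(2) by simp
      ultimately show ?thesis
        using DERIV_deriv_iff_real_differentiable[of "\<eta> (l n)" x] by (simp add: has_field_derivative_at_within)
    qed
    then obtain d where d: "\<And>x. x \<in> cball c (\<bar>c\<bar> / 2) \<Longrightarrow> \<eta> (l n) x = d"
      using has_field_derivative_zero_constant[OF convex_cball] by metis
    show ?case using d by (auto simp: dist_real_def abs_minus_commute)
  qed
qed

text \<open>The uniform part of \<open>cond_P2\<close> with tolerance 1/2 bounds the penalty below
  by \<open>l n * \<bar>x\<bar> / 2\<close>. Multiplied by \<open>real n\<close>, this has slope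
  \<open>sqrt (real n)\<close> times half of the diverging
  \<open>sqrt (real n) * l n\<close>.\<close>

lemma penalty_steep:
  assumes lim: "filterlim (\<lambda>n. sqrt (real n) * l n) at_top sequentially" and K: "K > 0"
  shows "\<forall>\<^sub>F n in sequentially. \<forall>x. \<bar>x\<bar> \<le> K / sqrt (real n) \<longrightarrow>
    sqrt (real n) * (R * \<bar>x\<bar>) \<le> real n * \<eta> (l n) x"
proof -
  have "\<forall>\<^sub>F n in sequentially. \<forall>\<beta>. 0 < \<bar>\<beta>\<bar> \<and> \<bar>\<beta>\<bar> \<le> K / sqrt (real n) \<longrightarrow>
      \<bar>\<eta> (l n) \<beta> / \<bar>\<beta>\<bar> - l n\<bar> \<le> 1 / 2 * l n"
    using P2 K unfolding cond_P2_def by (meson half_gt_zero_iff zero_less_one)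
  moreover have "\<forall>\<^sub>F n in sequentially. 2 * R \<le> sqrt (real n) * l n"
    using lim by (simp add: filterlim_at_top)
  ultimately show ?thesis using eventually_ge_at_top[of 1]
  proof eventually_elim
    case (elim n)
    show ?case
    proof safe
      fix x assume x: "\<bar>x\<bar> \<le> K / sqrt (real n)"
      show "sqrt (real n) * (R * \<bar>x\<bar>) \<le> real n * \<eta> (l n) x"
      proof (cases "x = 0")
        case True
        then show ?thesis using penalty_zero[OF elim(3)] by simp
      next
        case False
        then have "\<bar>\<eta> (l n) x / \<bar>x\<bar> - l n\<bar> \<le> 1 / 2 * l n" using elim(1)[rule_format, of x] x by simp
        then have "l n / 2 \<le> \<eta> (l n) x / \<bar>x\<bar>" by linarith
        then have "l n / 2 * \<bar>x\<bar> \<le> \<eta> (l n) x" using False by (simp add: field_simps)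
        then have "real n * (l n / 2 * \<bar>x\<bar>) \<le> real n * \<eta> (l n) x" by (intro mult_left_mono) auto
        moreover have "sqrt (real n) * \<bar>x\<bar> * (2 * R) \<le> sqrt (real n) * \<bar>x\<bar> * (sqrt (real n) * l n)"
          using elim(2) by (intro mult_left_mono) auto
        moreover have "sqrt (real n) * \<bar>x\<bar> * (sqrt (real n) * l n) = (sqrt (real n) * sqrt (real n)) * (l n * \<bar>x\<bar>)"
          by (simp only: mult_ac)
        ultimately show ?thesis by (simp add: mult_ac)
      qed
    qed
  qed
qed

end

section \<open>The sample together with its independent copy\<close>

locale natural_link_copied_sample = natural_link_sample \<nu> b \<X> X B \<beta>s J M y
  for \<nu> :: "(real^'r) measure" and b :: "real^'r \<Rightarrow> real"
    and \<X> :: "(real^'p^'r) set" and X :: "nat \<Rightarrow> real^'p^'r" and B :: "(real^'p) set"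
    and \<beta>s :: "real^'p" and J :: "real^'p^'p" and M :: "'w measure"
    and y :: "nat \<Rightarrow> 'w \<Rightarrow> real^'r" +
  fixes yt :: "nat \<Rightarrow> 'w \<Rightarrow> real^'r"
  assumes indep_copy: "indep_var (\<Pi>\<^sub>M i\<in>{..<n}. borel) (sample y n) (\<Pi>\<^sub>M i\<in>{..<n}. borel) (sample yt n)"
    and distr_copy: "distr M (\<Pi>\<^sub>M i\<in>{..<n}. borel) (sample yt n) = distr M (\<Pi>\<^sub>M i\<in>{..<n}. borel) (sample y n)"
begin

abbreviation s :: "nat \<Rightarrow> 'w \<Rightarrow> real^'p" where "s n \<omega> \<equiv> score n (sample y n \<omega>)"

abbreviation st :: "nat \<Rightarrow> 'w \<Rightarrow> real^'p" where "st n \<omega> \<equiv> score n (sample yt n \<omega>)"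

lemma measurable_sample_yt[measurable]: "sample yt n \<in> measurable M (\<Pi>\<^sub>M i\<in>{..<n}. borel)"
  using indep_copy by (rule indep_var_rv2)

lemma copy_integral:
  fixes \<phi> :: "(nat \<Rightarrow> real^'r) \<Rightarrow> real"
  assumes [measurable]: "\<phi> \<in> borel_measurable (\<Pi>\<^sub>M i\<in>{..<n}. borel)"
  shows "integrable M (\<lambda>\<omega>. \<phi> (sample yt n \<omega>)) \<longleftrightarrow> integrable M (\<lambda>\<omega>. \<phi> (sample y n \<omega>))"
    and "expectation (\<lambda>\<omega>. \<phi> (sample yt n \<omega>)) = expectation (\<lambda>\<omega>. \<phi> (sample y n \<omega>))"
  using integrable_distr_eq[OF measurable_sample_yt assms] integrable_distr_eq[OF measurable_sample_y assms]
    integral_distr[OF measurable_sample_yt assms] integral_distr[OF measurable_sample_y assms]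
  by (simp_all add: distr_copy)

lemma copy_tail: "prob {\<omega> \<in> space M. norm (st n \<omega>) \<ge> K} = prob {\<omega> \<in> space M. norm (s n \<omega>) \<ge> K}"
proof -
  let ?P = "\<Pi>\<^sub>M i\<in>{..<n}. borel :: (real^'r) measure"
  let ?A = "{ys \<in> space ?P. norm (score n ys) \<ge> K}"
  have A: "?A \<in> sets ?P" by measurable
  have "{\<omega> \<in> space M. norm (st n \<omega>) \<ge> K} = sample yt n -` ?A \<inter> space M"
    "{\<omega> \<in> space M. norm (s n \<omega>) \<ge> K} = sample y n -` ?A \<inter> space M"
    using measurable_space[OF measurable_sample_yt] measurable_space[OF measurable_sample_y] by auto
  then show ?thesis
    using measure_distr[OF measurable_sample_yt A] measure_distr[OF measurable_sample_y A]
    by (simp add: distr_copy)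
qed

lemma scores_tail:
  assumes e: "e > 0"
  shows "\<exists>K>0. \<forall>\<^sub>F n in sequentially.
    prob ({\<omega> \<in> space M. norm (s n \<omega>) \<ge> K} \<union> {\<omega> \<in> space M. norm (st n \<omega>) \<ge> K}) < e"
proof -
  obtain D where D: "D > 0" "\<forall>\<^sub>F n in sequentially. \<forall>K>0. prob {\<omega> \<in> space M. norm (s n \<omega>) \<ge> K} \<le> D / K\<^sup>2"
    using score_tail by blast
  \<comment> \<open>Each of the two tails becomes at most \<open>e / 3\<close>, leaving room for the
    strict inequality.\<close>
  define K where "K = sqrt (3 * D / e)"
  have K: "K > 0" "K\<^sup>2 = 3 * D / e" using D e by (auto simp: K_def)
  have DK: "D / K\<^sup>2 = e / 3" using D e unfolding K(2) by simp
  from D(2) have "\<forall>\<^sub>F n in sequentially.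
    prob ({\<omega> \<in> space M. norm (s n \<omega>) \<ge> K} \<union> {\<omega> \<in> space M. norm (st n \<omega>) \<ge> K}) < e"
  proof eventually_elim
    case (elim n)
    have "prob ({\<omega> \<in> space M. norm (s n \<omega>) \<ge> K} \<union> {\<omega> \<in> space M. norm (st n \<omega>) \<ge> K}) \<le>
      prob {\<omega> \<in> space M. norm (s n \<omega>) \<ge> K} + prob {\<omega> \<in> space M. norm (st n \<omega>) \<ge> K}"
      by (rule measure_Un_le) measurable
    also have "\<dots> \<le> e / 3 + e / 3" unfolding copy_tail using elim[rule_format, OF K(1)] unfolding DK by (intro add_mono)
    also have "\<dots> < e" using e by simp
    finally show ?case .
  qed
  with K(1) show ?thesis by blast
qed

text \<open>
  The log-likelihood difference with \<open>sqrt n (est - \<beta>s)\<close> replaced by its linear approximation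
  in the score; \<open>e\<close> will be a \<open>J\<close>-orthonormal basis of the vectors supported on \<open>S\<close>.
\<close>

definition bias_approx :: "('p \<Rightarrow> real^'p) \<Rightarrow> 'p set \<Rightarrow> nat \<Rightarrow> 'w \<Rightarrow> real" where
  "bias_approx e S n \<omega> = (\<Sum>a\<in>S. ((s n \<omega> - st n \<omega>) \<bullet> e a) * (s n \<omega> \<bullet> e a))"

lemma bias_approx_measurable[measurable]: "bias_approx e S n \<in> borel_measurable M"
  unfolding bias_approx_def[abs_def] by measurable

text \<open>The squares of the sample score contribute \<open>mean_fisher n\<close>; the products
  with the score of the copy vanish by independence and centring.\<close>

lemma bias_approx_expectation:
  assumes n: "n \<ge> 1"
  shows "expectation (bias_approx e S n) = (\<Sum>a\<in>S. e a \<bullet> (mean_fisher n *v e a))"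
proof -
  have \<phi>: "(\<lambda>ys. score n ys \<bullet> t) \<in> borel_measurable (\<Pi>\<^sub>M i\<in>{..<n}. borel)" for t by measurable
  have ind: "indep_var borel (\<lambda>\<omega>. s n \<omega> \<bullet> t) borel (\<lambda>\<omega>. st n \<omega> \<bullet> t)" for t
    using indep_var_compose[OF indep_copy \<phi> \<phi>] by (simp add: comp_def)
  have it: "integrable M (\<lambda>\<omega>. st n \<omega> \<bullet> t)" for t
    using copy_integral(1)[OF \<phi>] score_moments(1)[OF n] by simp
  have cross: "integrable M (\<lambda>\<omega>. (s n \<omega> \<bullet> t) * (st n \<omega> \<bullet> t))"
    "expectation (\<lambda>\<omega>. (s n \<omega> \<bullet> t) * (st n \<omega> \<bullet> t)) = 0" for t
    using indep_var_integrable[OF ind score_moments(1)[OF n] it]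
      indep_var_lebesgue_integral[OF ind score_moments(1)[OF n] it] score_moments(2)[OF n, of t] by simp_all
  have eq: "((s n \<omega> - st n \<omega>) \<bullet> t) * (s n \<omega> \<bullet> t) = (s n \<omega> \<bullet> t)\<^sup>2 - (s n \<omega> \<bullet> t) * (st n \<omega> \<bullet> t)" for \<omega> t
    by (simp add: inner_diff_left power2_eq_square algebra_simps)
  have summand: "integrable M (\<lambda>\<omega>. ((s n \<omega> - st n \<omega>) \<bullet> t) * (s n \<omega> \<bullet> t))"
    "expectation (\<lambda>\<omega>. ((s n \<omega> - st n \<omega>) \<bullet> t) * (s n \<omega> \<bullet> t)) = t \<bullet> (mean_fisher n *v t)" for t
    unfolding eq
    using Bochner_Integration.integrable_diff[OF score_moments(3)[OF n] cross(1)]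
      Bochner_Integration.integral_diff[OF score_moments(3)[OF n] cross(1)]
    by (simp_all add: score_moments(4)[OF n] cross(2))
  show ?thesis
    unfolding bias_approx_def[abs_def]
    by (subst Bochner_Integration.integral_sum) (simp_all add: summand)
qed

text \<open>Cauchy-Schwarz over \<open>S\<close> and a bound of each product by fourth powers reduce
  the claim to fourth moments of the score. The copy has the same ones, which turns the factor 3
  into 6.\<close>

lemma bias_approx_second_moment:
  "\<exists>C. \<forall>\<^sub>F n in sequentially. integrable M (\<lambda>\<omega>. (bias_approx e S n \<omega>)\<^sup>2) \<and>
     expectation (\<lambda>\<omega>. (bias_approx e S n \<omega>)\<^sup>2) \<le> C"
proof -
  have "\<forall>a. \<exists>C. \<forall>\<^sub>F n in sequentially. integrable M (\<lambda>\<omega>. (s n \<omega> \<bullet> e a) ^ 4) \<and>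
     expectation (\<lambda>\<omega>. (s n \<omega> \<bullet> e a) ^ 4) \<le> C"
    using score_fourth_moment_bounded by blast
  from choice[OF this] obtain C where C: "\<forall>a. \<forall>\<^sub>F n in sequentially. integrable M (\<lambda>\<omega>. (s n \<omega> \<bullet> e a) ^ 4) \<and>
     expectation (\<lambda>\<omega>. (s n \<omega> \<bullet> e a) ^ 4) \<le> C a" ..
  then have "\<forall>\<^sub>F n in sequentially. \<forall>a\<in>S. integrable M (\<lambda>\<omega>. (s n \<omega> \<bullet> e a) ^ 4) \<and>
     expectation (\<lambda>\<omega>. (s n \<omega> \<bullet> e a) ^ 4) \<le> C a"
    by (intro eventually_ball_finite) auto
  then have "\<forall>\<^sub>F n in sequentially. integrable M (\<lambda>\<omega>. (bias_approx e S n \<omega>)\<^sup>2) \<and>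
     expectation (\<lambda>\<omega>. (bias_approx e S n \<omega>)\<^sup>2) \<le> (\<Sum>a\<in>S. 6 * C a) * real (card S)"
  proof eventually_elim
    case (elim n)
    define g where "g \<omega> = (\<Sum>a\<in>S. 3 * ((s n \<omega> \<bullet> e a) ^ 4 + (st n \<omega> \<bullet> e a) ^ 4)) * real (card S)" for \<omega>
    have \<phi>: "(\<lambda>ys. (score n ys \<bullet> t) ^ 4) \<in> borel_measurable (\<Pi>\<^sub>M i\<in>{..<n}. borel)" for t by measurable
    have g: "integrable M g" "expectation g \<le> (\<Sum>a\<in>S. 6 * C a) * real (card S)"
    proof -
      show "integrable M g" unfolding g_def using elim copy_integral(1)[OF \<phi>] by simp
      have "expectation g = (\<Sum>a\<in>S. 6 * expectation (\<lambda>\<omega>. (s n \<omega> \<bullet> e a) ^ 4)) * real (card S)"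
        unfolding g_def using elim copy_integral[OF \<phi>] by simp
      also have "\<dots> \<le> (\<Sum>a\<in>S. 6 * C a) * real (card S)"
        using elim by (intro mult_right_mono sum_mono) auto
      finally show "expectation g \<le> (\<Sum>a\<in>S. 6 * C a) * real (card S)" .
    qed
    have bound: "(bias_approx e S n \<omega>)\<^sup>2 \<le> g \<omega>" for \<omega>
    proof -
      \<comment> \<open>With \<open>P = p\<^sup>2\<close> and \<open>Q = q\<^sup>2\<close> this
        amounts to \<open>2 * P * Q \<le> P\<^sup>2 + Q\<^sup>2\<close>.\<close>
      have pq: "((p - q) * p)\<^sup>2 \<le> 3 * (p ^ 4 + q ^ 4)" for p q :: real
      proof -
        have "(p - q)\<^sup>2 \<le> 2 * (p\<^sup>2 + q\<^sup>2)"
          using zero_le_power2[of "p + q"] by (simp add: power2_eq_square algebra_simps)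
        then have "(p - q)\<^sup>2 * p\<^sup>2 \<le> 2 * (p\<^sup>2 + q\<^sup>2) * p\<^sup>2" by (intro mult_right_mono) auto
        also have "2 * (P + Q) * P \<le> 3 * (P\<^sup>2 + Q\<^sup>2)" for P Q :: real
          using zero_le_power2[of "P - Q"] zero_le_power2[of Q] unfolding power2_eq_square
          by (simp add: algebra_simps) (use zero_le_square[of Q] in linarith)
        finally have "(p - q)\<^sup>2 * p\<^sup>2 \<le> 3 * ((p\<^sup>2)\<^sup>2 + (q\<^sup>2)\<^sup>2)" .
        then show ?thesis by (simp add: power_mult_distrib flip: power_mult)
      qed
      have "(bias_approx e S n \<omega>)\<^sup>2 \<le>
        (\<Sum>a\<in>S. (((s n \<omega> - st n \<omega>) \<bullet> e a) * (s n \<omega> \<bullet> e a))\<^sup>2) * real (card S)"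
        unfolding bias_approx_def by (rule sum_squared_le_sum_of_squares)
      also have "\<dots> \<le> g \<omega>"
        unfolding g_def inner_diff_left by (intro mult_right_mono sum_mono pq) auto
      finally show ?thesis .
    qed
    have "integrable M (\<lambda>\<omega>. (bias_approx e S n \<omega>)\<^sup>2)"
    proof (rule Bochner_Integration.integrable_bound[OF g(1)])
      show "AE \<omega> in M. norm ((bias_approx e S n \<omega>)\<^sup>2) \<le> norm (g \<omega>)"
        using bound by (intro AE_I2) (auto intro: order_trans[OF _ abs_ge_self])
    qed measurable
    moreover from this have "expectation (\<lambda>\<omega>. (bias_approx e S n \<omega>)\<^sup>2) \<le> expectation g"
      using g(1) bound by (intro integral_mono) auto
    ultimately show ?case using g(2) by simp
  qed
  then show ?thesis by blast
qed

end

theorem mainTheorem5: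
  fixes \<nu> :: "(real^'r) measure"
    and b :: "real^'r \<Rightarrow> real"
    and \<X> :: "(real^'p^'r) set"
    and X :: "nat \<Rightarrow> real^'p^'r"
    and B :: "(real^'p) set"
    and \<beta>s :: "real^'p"
    and M :: "'w measure"
    and y yt :: "nat \<Rightarrow> 'w \<Rightarrow> real^'r"
    and lam \<gamma>0 :: real
    and l :: "nat \<Rightarrow> real"
    and \<eta> :: "real \<Rightarrow> real \<Rightarrow> real"
    and est :: "nat \<Rightarrow> (nat \<Rightarrow> real^'r) \<Rightarrow> real^'p"
    and N :: "'v measure"
    and zlimit :: "'v \<Rightarrow> real"
  assumes "sigma_finite_measure \<nu>" "sets \<nu> = sets borel" "b \<in> borel_measurable borel"
    and "\<forall>\<theta> \<in> interior (natural_parameter_space \<nu> b). pos_def (hessian (log_partition \<nu> b) \<theta>)"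
    and "open B" "convex B" "\<beta>s \<in> B"
    and "\<forall>i. X i \<in> \<X>"
    and "cond_C1 \<nu> b \<X> B"
    and "cond_C2 \<nu> b \<X> B X"
    and "prob_space M"
    and "prob_space.indep_vars M (\<lambda>_. borel) y UNIV"
    and "\<forall>i. distributed M \<nu> (y i) (\<lambda>v. ennreal (expfam_density \<nu> b (X i *v \<beta>s) v))"
    and "\<forall>n. prob_space.indep_var M (\<Pi>\<^sub>M i\<in>{..<n}. borel) (sample y n)
                                   (\<Pi>\<^sub>M i\<in>{..<n}. borel) (sample yt n)"
    and "\<forall>n. distr M (\<Pi>\<^sub>M i\<in>{..<n}. borel) (sample yt n) = distr M (\<Pi>\<^sub>M i\<in>{..<n}. borel) (sample y n)"
    and "lam > 0" "1 < \<gamma>0" "\<gamma>0 < 2"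
    and "\<forall>n. l n = real n powr ((\<gamma>0 - 2) / 2) * lam"
    and "cond_P1 \<eta> l" "cond_P2 \<eta> l" "cond_P3 \<eta> l" "cond_P4 \<eta> l" "cond_P5 \<eta> l"
    and "penalized_mle \<nu> b X B \<eta> l est"
    and "prob_space N" "zlimit \<in> borel_measurable N"
    and "weak_conv_m
           (\<lambda>n. distr M borel (\<lambda>\<omega>. loglik_gain \<nu> b X \<beta>s n (sample y n \<omega>) (est n (sample y n \<omega>))
                                 - loglik_gain \<nu> b X \<beta>s n (sample yt n \<omega>) (est n (sample y n \<omega>))))
           (distr N borel zlimit)"
  shows "integrable N zlimit \<and>
         tendsto_in_probability M
           (\<lambda>n \<omega>. real (card (active_set (est n (sample y n \<omega>)))))
           (prob_space.expectation N zlimit)"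
proof -
  have "\<exists>J. pos_def J \<and> (\<lambda>n. (1 / real n) *\<^sub>R (\<Sum>i<n. fisher_summand \<nu> b \<beta>s (X i))) \<longlonglongrightarrow> J"
    using assms(7,10) unfolding cond_C2_def by blast
  then obtain J where J: "pos_def J"
    "(\<lambda>n. (1 / real n) *\<^sub>R (\<Sum>i<n. fisher_summand \<nu> b \<beta>s (X i))) \<longlonglongrightarrow> J"
    by blast
  interpret prob_space M by fact
  interpret exponential_family \<nu> b by standard (fact assms)+
  interpret natural_link_copied_sample \<nu> b \<X> X B \<beta>s J M y yt
  proof
    show "pos_def (hessian (log_partition \<nu> b) \<theta>)" if "\<theta> \<in> interior_parameters" for \<theta>
      using assms(4) that by (simp add: interior_parameters_def)
    show "X i \<in> \<X>" for i using assms(8) by simp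
    show "compact \<X>" using assms(9) by (simp add: cond_C1_def)
    show "A *v \<beta> \<in> interior_parameters" if "A \<in> \<X>" "\<beta> \<in> B" for A \<beta>
      using assms(9) that by (simp add: cond_C1_def interior_parameters_def)
    show "distributed M \<nu> (y i) (\<lambda>v. ennreal (expfam_density \<nu> b (X i *v \<beta>s) v))" for i
      by (rule assms(13)[rule_format])
    show "indep_var (\<Pi>\<^sub>M i\<in>{..<n}. borel) (sample y n) (\<Pi>\<^sub>M i\<in>{..<n}. borel) (sample yt n)" for n
      by (rule assms(14)[rule_format])
    show "distr M (\<Pi>\<^sub>M i\<in>{..<n}. borel) (sample yt n) = distr M (\<Pi>\<^sub>M i\<in>{..<n}. borel) (sample y n)" for n
      by (rule assms(15)[rule_format])
  qed (fact assms J)+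
  define S where "S = active_set \<beta>s"
  obtain e where e_supp: "\<forall>a\<in>S. \<forall>j. j \<notin> S \<longrightarrow> e a $ j = 0"
    and e_norm: "\<forall>a\<in>S. e a \<bullet> (J *v e a) = 1"
    and e_span: "\<forall>w. (\<forall>j. j \<notin> S \<longrightarrow> w $ j = 0) \<longrightarrow> w = (\<Sum>a\<in>S. (e a \<bullet> (J *v w)) *\<^sub>R e a)"
    using pos_def_orthonormal_basis[OF J(1), of S] by (elim exE conjE) (rule that)
  have l: "l = (\<lambda>n. real n powr ((\<gamma>0 - 2) / 2) * lam)" using assms(19) by auto
  have "(\<lambda>n. real n powr ((\<gamma>0 - 2) / 2) * lam) \<longlonglongrightarrow> 0 * lam"
    using assms by (intro tendsto_intros tendsto_neg_powr filterlim_real_sequentially) auto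
  then have l_lim: "l \<longlonglongrightarrow> 0" by (simp add: l)
  \<comment> \<open>\<open>sqrt (real n) * l n\<close> is \<open>lam\<close> times the power
    \<open>(\<gamma>0 - 1) / 2\<close> of \<open>real n\<close>. So \<open>\<gamma>0 > 1\<close>
    lets the penalty outweigh the score near 0, while \<open>\<gamma>0 < 2\<close> made
    \<open>l\<close> tend to 0.\<close>
  have l_rate: "filterlim (\<lambda>n. sqrt (real n) * l n) at_top sequentially"
    unfolding filterlim_at_top
  proof
    fix R
    have "\<forall>\<^sub>F n in sequentially. R / lam \<le> real n powr ((\<gamma>0 - 1) / 2)"
      using assms by (intro eventually_powr_ge) auto
    then show "\<forall>\<^sub>F n in sequentially. R \<le> sqrt (real n) * l n"
      using eventually_ge_at_top[of 1]
    proof eventually_elim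
      case (elim n)
      have "sqrt (real n) * l n = real n powr (1 / 2 + (\<gamma>0 - 2) / 2) * lam"
        using elim by (simp add: l powr_add powr_half_sqrt)
      also have "1 / 2 + (\<gamma>0 - 2) / 2 = (\<gamma>0 - 1) / 2" by (simp add: field_simps)
      finally show ?case using elim assms(16) by (simp add: pos_divide_le_eq)
    qed
  qed
  note P1 = assms(20) and P2 = assms(21)
  let ?est = "\<lambda>n \<omega>. est n (sample y n \<omega>)"
  \<comment> \<open>On samples with bounded score a minimizer exists, so the estimator is forced to
    be one; any selection among minimizers is covered.\<close>
  have expansion: "\<forall>\<^sub>F n in sequentially. \<forall>\<omega>\<in>space M. norm (s n \<omega>) \<le> K \<longrightarrow>
      active_set (?est n \<omega>) = S \<and>
      norm (sqrt (real n) *\<^sub>R (?est n \<omega> - \<beta>s) - (\<Sum>a\<in>S. (s n \<omega> \<bullet> e a) *\<^sub>R e a)) \<le> \<epsilon>"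
    if "K > 0" "\<epsilon> > 0" for K \<epsilon>
  proof -
    let ?Q = "\<lambda>n t \<beta>. excess n \<beta> - sqrt (real n) * (t \<bullet> (\<beta> - \<beta>s)) + real n * (\<Sum>j\<in>UNIV. \<eta> (l n) (\<beta> $ j))"
    have "\<forall>\<^sub>F n in sequentially. \<forall>t. norm t \<le> K \<longrightarrow>
      (\<exists>\<beta>. is_arg_min (?Q n t) (\<lambda>\<beta>. \<beta> \<in> B) \<beta>) \<and>
      (\<forall>\<beta>. is_arg_min (?Q n t) (\<lambda>\<beta>. \<beta> \<in> B) \<beta> \<longrightarrow> active_set \<beta> = active_set \<beta>s \<and>
         norm (sqrt (real n) *\<^sub>R (\<beta> - \<beta>s) - (\<Sum>a\<in>active_set \<beta>s. (t \<bullet> e a) *\<^sub>R e a)) \<le> \<epsilon>)"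
    proof (rule penalized_minimizer_expansion[OF open_B convex_B \<beta>s_in_B J(1) convex_on_excess excess_self
          excess_nonneg excess_quadratic])
      show "continuous_on UNIV (\<eta> (l n))" if "n \<ge> 1" for n by (rule penalty_continuous[OF P1 P2 that])
      show "0 \<le> \<eta> (l n) x" if "n \<ge> 1" for n x by (rule penalty_nonneg[OF P1 P2 that])
      show "\<eta> (l n) 0 = 0" if "n \<ge> 1" for n by (rule penalty_zero[OF P1 P2 that])
      show "\<forall>\<^sub>F n in sequentially. \<forall>x. \<bar>x - c\<bar> \<le> \<bar>c\<bar> / 2 \<longrightarrow> \<eta> (l n) x = \<eta> (l n) c" if "c \<noteq> 0" for c
        by (rule penalty_locally_flat[OF P1 P2 assms(23) l_lim that])
      show "(\<lambda>n. \<eta> (l n) x) \<longlonglongrightarrow> 0" for x using assms(22) by (simp add: cond_P3_def)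
      show "\<forall>\<^sub>F n in sequentially. \<forall>x. \<bar>x\<bar> \<le> K / sqrt (real n) \<longrightarrow>
        sqrt (real n) * (R * \<bar>x\<bar>) \<le> real n * \<eta> (l n) x" if "K > 0" for K R
        by (rule penalty_steep[OF P1 P2 l_rate that])
      show "e a $ j = 0" if "a \<in> active_set \<beta>s" "j \<notin> active_set \<beta>s" for a j
        using e_supp that by (simp add: S_def)
      show "w = (\<Sum>a\<in>active_set \<beta>s. (e a \<bullet> (J *v w)) *\<^sub>R e a)"
        if "\<And>j. j \<notin> active_set \<beta>s \<Longrightarrow> w $ j = 0" for w
        by (rule e_span[unfolded S_def, rule_format]) (rule that)
    qed (use that in auto)
    then show ?thesis
      using eventually_ge_at_top[of 1]
    proof eventually_elim
      case (elim n)
      show ?case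
      proof safe
        fix \<omega> assume \<omega>: "\<omega> \<in> space M" "norm (s n \<omega>) \<le> K"
        let ?P = "penalized_objective \<nu> b X (\<eta> (l n)) n (sample y n \<omega>)"
        have iff: "is_arg_min ?P (\<lambda>\<beta>. \<beta> \<in> B) \<beta> \<longleftrightarrow> is_arg_min (?Q n (s n \<omega>)) (\<lambda>\<beta>. \<beta> \<in> B) \<beta>" for \<beta>
          unfolding is_arg_min_linorder penalized_objective_score by (simp only: diff_conv_add_uminus add_le_cancel_right)
        have ex: "\<exists>\<beta>. is_arg_min ?P (\<lambda>\<beta>. \<beta> \<in> B) \<beta>" using elim(1) \<omega>(2) unfolding iff by blast
        have "sample y n \<omega> \<in> space (\<Pi>\<^sub>M i\<in>{..<n}. borel)"
          by (rule measurable_space[OF measurable_sample_y \<omega>(1)])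
        then have "is_arg_min ?P (\<lambda>\<beta>. \<beta> \<in> B) (?est n \<omega>)"
          using assms(25) elim(2) ex unfolding penalized_mle_def by blast
        then have *: "active_set (?est n \<omega>) = S \<and>
          norm (sqrt (real n) *\<^sub>R (?est n \<omega> - \<beta>s) - (\<Sum>a\<in>S. (s n \<omega> \<bullet> e a) *\<^sub>R e a)) \<le> \<epsilon>"
          using elim(1) \<omega>(2) unfolding iff S_def by blast
        from * show "x \<in> S" if "x \<in> active_set (?est n \<omega>)" for x using that by blast
        from * show "x \<in> active_set (?est n \<omega>)" if "x \<in> S" for x using that by blast
        from * show "norm (sqrt (real n) *\<^sub>R (?est n \<omega> - \<beta>s) - (\<Sum>a\<in>S. (s n \<omega> \<bullet> e a) *\<^sub>R e a)) \<le> \<epsilon>"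
          by blast
      qed
    qed
  qed
  define Z where "Z n \<omega> = loglik_gain \<nu> b X \<beta>s n (sample y n \<omega>) (?est n \<omega>)
    - loglik_gain \<nu> b X \<beta>s n (sample yt n \<omega>) (?est n \<omega>)" for n \<omega>
  have Z: "Z n \<omega> = (s n \<omega> - st n \<omega>) \<bullet> (sqrt (real n) *\<^sub>R (?est n \<omega> - \<beta>s))" for n \<omega>
    unfolding Z_def loglik_gain_diff by simp
  have Z_meas: "Z n \<in> borel_measurable M" for n
  \<comment> \<open>\<open>penalized_mle\<close> constrains the estimator for
    \<open>n \<ge> 1\<close> only; at \<open>n = 0\<close> the factor \<open>sqrt (real n)\<close>
    makes \<open>Z\<close> zero.\<close>
  proof (cases "n = 0")
    case True
    then show ?thesis unfolding Z[abs_def] by simp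
  next
    case False
    then have [measurable]: "est n \<in> borel_measurable (\<Pi>\<^sub>M i\<in>{..<n}. borel)"
      using assms(25) by (simp add: penalized_mle_def)
    show ?thesis unfolding Z[abs_def] by measurable
  qed
  have close: "tendsto_in_probability M (\<lambda>n \<omega>. Z n \<omega> - bias_approx e S n \<omega>) 0"
    unfolding tendsto_in_probability_def
  proof (intro allI impI, rule tendstoI)
    fix \<epsilon> d :: real assume \<epsilon>: "\<epsilon> > 0" and d: "d > 0"
    obtain K where K: "K > 0" and tail: "\<forall>\<^sub>F n in sequentially.
      prob ({\<omega> \<in> space M. norm (s n \<omega>) \<ge> K} \<union> {\<omega> \<in> space M. norm (st n \<omega>) \<ge> K}) < d"
      using scores_tail[OF d] by blast
    \<comment> \<open>When both scores have norm below \<open>K\<close>, their difference has norm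
      at most \<open>2 * K\<close>; this tolerance in the expansion then keeps the error within
      \<open>\<epsilon>\<close>, so larger errors lie in the tail event.\<close>
    have "\<epsilon> / (2 * K) > 0" using \<epsilon> K by simp
    from expansion[OF K this] tail
    show "\<forall>\<^sub>F n in sequentially. dist (prob {\<omega> \<in> space M. \<bar>Z n \<omega> - bias_approx e S n \<omega> - 0\<bar> > \<epsilon>}) 0 < d"
    proof eventually_elim
      case (elim n)
      have "{\<omega> \<in> space M. \<bar>Z n \<omega> - bias_approx e S n \<omega> - 0\<bar> > \<epsilon>} \<subseteq>
        {\<omega> \<in> space M. norm (s n \<omega>) \<ge> K} \<union> {\<omega> \<in> space M. norm (st n \<omega>) \<ge> K}"
      proof (rule subsetI, rule ccontr)
        fix \<omega>
        assume "\<omega> \<in> {\<omega> \<in> space M. \<bar>Z n \<omega> - bias_approx e S n \<omega> - 0\<bar> > \<epsilon>}"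
          "\<omega> \<notin> {\<omega> \<in> space M. norm (s n \<omega>) \<ge> K} \<union> {\<omega> \<in> space M. norm (st n \<omega>) \<ge> K}"
        then have \<omega>: "\<omega> \<in> space M" "\<bar>Z n \<omega> - bias_approx e S n \<omega>\<bar> > \<epsilon>"
          "norm (s n \<omega>) < K" "norm (st n \<omega>) < K" by (auto simp: not_le)
        let ?v = "\<Sum>a\<in>S. (s n \<omega> \<bullet> e a) *\<^sub>R e a"
        have "bias_approx e S n \<omega> = (s n \<omega> - st n \<omega>) \<bullet> ?v"
          by (simp add: bias_approx_def inner_sum_right mult.commute)
        then have "\<bar>Z n \<omega> - bias_approx e S n \<omega>\<bar> =
          \<bar>(s n \<omega> - st n \<omega>) \<bullet> (sqrt (real n) *\<^sub>R (?est n \<omega> - \<beta>s) - ?v)\<bar>"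
          by (simp add: Z inner_diff_right)
        also have "\<dots> \<le> norm (s n \<omega> - st n \<omega>) * norm (sqrt (real n) *\<^sub>R (?est n \<omega> - \<beta>s) - ?v)"
          by (rule Cauchy_Schwarz_ineq2)
        also have "\<dots> \<le> (2 * K) * (\<epsilon> / (2 * K))"
          using elim(1) \<omega> K norm_triangle_ineq4[of "s n \<omega>" "st n \<omega>"] by (intro mult_mono) auto
        finally show False using \<omega>(2) K by simp
      qed
      then have "prob {\<omega> \<in> space M. \<bar>Z n \<omega> - bias_approx e S n \<omega> - 0\<bar> > \<epsilon>} \<le>
        prob ({\<omega> \<in> space M. norm (s n \<omega>) \<ge> K} \<union> {\<omega> \<in> space M. norm (st n \<omega>) \<ge> K})"
        by (rule finite_measure_mono) measurable
      with elim(2) show ?case by (simp del: diff_0_right)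
    qed
  qed
  obtain C where C: "\<forall>\<^sub>F n in sequentially. integrable M (\<lambda>\<omega>. (bias_approx e S n \<omega>)\<^sup>2) \<and>
     expectation (\<lambda>\<omega>. (bias_approx e S n \<omega>)\<^sup>2) \<le> C"
    using bias_approx_second_moment by blast
  \<comment> \<open>Each summand tends to the squared \<open>J\<close>-norm of a unit vector, so the
    limit counts the elements of \<open>S\<close>.\<close>
  have "(\<lambda>n. \<Sum>a\<in>S. e a \<bullet> (mean_fisher n *v e a)) \<longlonglongrightarrow> (\<Sum>a\<in>S. e a \<bullet> (J *v e a))"
    by (intro tendsto_sum mean_fisher_tendsto)
  moreover have "(\<Sum>a\<in>S. e a \<bullet> (J *v e a)) = real (card S)" using e_norm by simp
  moreover have "\<forall>\<^sub>F n in sequentially. (\<Sum>a\<in>S. e a \<bullet> (mean_fisher n *v e a)) = expectation (bias_approx e S n)"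
    using eventually_ge_at_top[of 1] by eventually_elim (simp add: bias_approx_expectation)
  ultimately have mean_lim: "(\<lambda>n. expectation (bias_approx e S n)) \<longlonglongrightarrow> real (card S)"
    using Lim_transform_eventually by force
  have z: "integrable N zlimit \<and> (\<integral>v. zlimit v \<partial>N) = real (card S)"
    by (rule expectation_of_weak_limit[OF assms(11,26) Z_meas bias_approx_measurable assms(27) _ close C mean_lim])
      (use assms(28) in \<open>simp add: Z_def[abs_def]\<close>)
  have "tendsto_in_probability M (\<lambda>n \<omega>. real (card (active_set (?est n \<omega>)))) (real (card S))"
    unfolding tendsto_in_probability_def
  proof (intro allI impI, rule tendstoI)
    fix \<epsilon> d :: real assume \<epsilon>: "\<epsilon> > 0" and d: "d > 0"
    obtain K where K: "K > 0" and tail: "\<forall>\<^sub>F n in sequentially.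
      prob ({\<omega> \<in> space M. norm (s n \<omega>) \<ge> K} \<union> {\<omega> \<in> space M. norm (st n \<omega>) \<ge> K}) < d"
      using scores_tail[OF d] by blast
    \<comment> \<open>The tolerance 1 is arbitrary: here the expansion supplies the equality of
      active sets.\<close>
    from expansion[OF K zero_less_one] tail
    show "\<forall>\<^sub>F n in sequentially.
      dist (prob {\<omega> \<in> space M. \<bar>real (card (active_set (?est n \<omega>))) - real (card S)\<bar> > \<epsilon>}) 0 < d"
    proof eventually_elim
      case (elim n)
      have "{\<omega> \<in> space M. \<bar>real (card (active_set (?est n \<omega>))) - real (card S)\<bar> > \<epsilon>} \<subseteq>
        {\<omega> \<in> space M. norm (s n \<omega>) \<ge> K} \<union> {\<omega> \<in> space M. norm (st n \<omega>) \<ge> K}"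
        using elim(1) \<epsilon> by (force simp: not_le)
      then have "prob {\<omega> \<in> space M. \<bar>real (card (active_set (?est n \<omega>))) - real (card S)\<bar> > \<epsilon>} \<le>
        prob ({\<omega> \<in> space M. norm (s n \<omega>) \<ge> K} \<union> {\<omega> \<in> space M. norm (st n \<omega>) \<ge> K})"
        by (rule finite_measure_mono) measurable
      with elim(2) show ?case by simp
    qed
  qed
  with z show ?thesis by simp
qed

end
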